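(* Let $(\mathcal{A},\Sigma(\mathcal{A}),\mu)$ be a measure space with $\mu$ positive and $\sigma$-finite, let $\mathcal{H}=\int^\oplus_{\mathcal{A}}\mathcal{H}^\alpha\,d\mu(\alpha)$ be a direct integral Hilbert space, and let $Q$ be a Hermitian quadratic form on a dense subspace $\mathcal{D}\subset\mathcal{H}$. Assume: (H1) $Q$ is closable and orthogonally additive; (H2) $\mu$ is point supported and $\mu(\{\alpha\})>0$ for every $\alpha\in\mathcal{A}$; (H3) for every $\alpha\in\mathcal{A}$ the quadratic form $q_\alpha$ on $P_\alpha\mathcal{D}\subset\mathcal{H}^\alpha$ is strongly representable by a self-adjoint operator $T_\alpha$ on $\mathcal{H}^\alpha$. Let $E^\alpha(\cdot)$ be the resolution of the identity of $T_\alpha$, let $E(\sigma)=\int^\oplus_{\mathcal{A}}E^\alpha(\sigma)\,d\mu(\alpha)$ for Borel $\sigma\subset\mathbb{R}$, and let $T=\int_{\mathbb{R}}\lambda\,dE(\lambda)$ be the associated self-adjoint operator on $\mathcal{H}$. Put $$\mathcal{D}_{\mathrm{Fin}}:=\{E(\sigma)P_\Delta\Phi\mid \Phi\in\mathcal{D},\ \Delta\in\Sigma(\mathcal{A}),\ \mu(\Delta)<\infty,\ \sigma\subset\mathbb{R}\text{ compact}\},$$ $$|||\Phi|||^2:=\|\Phi\|^2+\int_{\mathcal{A}}\int_{\mathbb{R}}|\lambda|\,d\nu^\alpha_\Phi(\lambda)\,d\mu(\alpha),\qquad \nu_\Phi^\alpha(\cdot)=\|E^\alpha(\cdot)\Phi(\alpha)\|_\alpha^2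 ,$$ and assume that $\mathcal{D}$ is contained in the closure $\overline{\mathcal{D}_{\mathrm{Fin}}}^{|||\cdot|||}$. Then $(Q,\mathcal{D})$ is strongly representable by $T$, and the extension is $(\widehat Q,\widehat{\mathcal{D}})$ with $\widehat{\mathcal{D}}=\mathcal{D}(|T|^{1/2})$ and $\widehat Q(\Phi)=\langle|T|^{1/2}\Phi,(\operatorname{sgn}T)|T|^{1/2}\Phi\rangle=\int_{\mathbb{R}}\lambda\,d\nu_\Phi(\lambda)$ for $\Phi\in\widehat{\mathcal{D}}$, where $\operatorname{sgn}T=E((0,\infty))-E((-\infty,0))$ and $\nu_\Phi(\cdot)=\|E(\cdot)\Phi\|^2$.
   Context: All Hilbert spaces are complex and separable; inner products are antilinear in the first entry. Quadratic forms. A Hermitian quadratic form $Q$ on a dense subspace $\mathcal{D}\subset\mathcal{H}$ is the diagonal $Q(\Phi):=Q(\Phi,\Phi)$ of a sesquilinear form $Q:\mathcal{D}\times\mathcal{D}\to\mathbb{C}$ (antilinear in the first entry, linear in the second) with $Q(\Phi,\Psi)=\overline{Q(\Psi,\Phi)}$. It is closable if for every sequence $\{\Phi_n\}\subset\mathcal{D}$ with $\Phi_n\to0$ in $\mathcal{H}$ and $\lim_{n,m\to\infty}Q(\Phi_n-\Phi_m)=0$ one has $\lim_nQ(\Phi_n)=0$. A form $\widehat Q$ on $\widehat{\mathcal{D}}$ extends $(Q,\mathcal{D})$ if $\mathcal{D}\subset\widehat{\mathcal{D}}\subset\mathcal{H}$ and $\widehat Q|_{\mathcal{D}}=Q$.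 Strong representability. Let $T$ be self-adjoint with resolution of the identity $E(\cdot)$ and $\nu_\Phi(\sigma)=\|E(\sigma)\Phi\|^2$. The spectral norm is $|||\Phi|||_E^2=\int_{\mathbb{R}}(1+|\lambda|)\,d\nu_\Phi(\lambda)$, $\Phi\in\mathcal{D}(|T|^{1/2})$. A Hermitian quadratic form $(Q,\mathcal{D})$ is strongly representable by $T$ if (1) there is an extension $(\widehat Q,\widehat{\mathcal{D}})$ of $(Q,\mathcal{D})$ with $\mathcal{D}(T)\subset\widehat{\mathcal{D}}$, and $\mathcal{D}\subset\mathcal{D}(|T|^{1/2})$; (2) $\widehat{\mathcal{D}}$ is the closure of $\mathcal{D}$ (in $\mathcal{D}(|T|^{1/2})$) with respect to $|||\cdot|||_E$; (3) $\widehat Q(\Phi)=\int_{\mathbb{R}}\lambda\,d\nu_\Phi(\lambda)$ for all $\Phi\in\widehat{\mathcal{D}}$. Direct integrals. $\int^\oplus_{\mathcal{A}}\mathcal{H}^\alpha\,d\mu(\alpha)$ is the usual direct integral of a $\mu$-measurable field of separable Hilbert spaces, with $\|\Phi\|^2=\int_{\mathcal{A}}\|\Phi(\alpha)\|_\alpha^2\,d\mu(\alpha)$. For $\Delta\in\Sigma(\mathcal{A})$, $P_\Delta$ is the orthogonal projection onto $\mathcal{H}_\Delta=\int_\Delta^\oplus\mathcal{H}^\alpha\,d\mu(\alpha)$; $P_\alpha:=P_{\{\alpha\}}$, and $P_\alpha\mathcal{D}$ is identified with the subspace $\{\Phi(\alpha)\mid\Phi\in\mathcal{D}\}$ of $\mathcal{H}^\alpha$.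 Orthogonal additivity. $(Q,\mathcal{D})$ is orthogonally additive if: (i) $P_\Delta\mathcal{D}\subset\mathcal{D}$ for all $\Delta\in\Sigma(\mathcal{A})$; (ii) for each $\Phi\in\mathcal{D}$ there is $M_\Phi>0$ with $|Q(P_\Delta\Phi)|<M_\Phi$ for all $\Delta\in\Sigma(\mathcal{A})$; (iii) for each finite measurable partition $\{\Delta_i\}_{i=1}^N$ of a $\Delta\in\Sigma(\mathcal{A})$ and each $\Phi\in\mathcal{D}$, $Q(P_\Delta\Phi)=\sum_{i=1}^NQ(P_{\Delta_i}\Phi)$. Point supported. $\mu$ is point supported if $\mathcal{A}$ is countable, $\Sigma(\mathcal{A})$ is the set of all subsets of $\mathcal{A}$, and $\mu(\Delta)=\sum_{x\in\Delta}\mu(\{x\})$ for all $\Delta\subset\mathcal{A}$. Forms $q_\alpha$. Under (H1), (H2), $q_\alpha$ is the Hermitian quadratic form on $P_\alpha\mathcal{D}$ given by $q_\alpha(\Phi(\alpha))=Q(P_\alpha\Phi)/\mu(\{\alpha\})$, $\Phi\in\mathcal{D}$ (its sesquilinear form is obtained by polarisation). The closure $\overline{\mathcal{D}_{\mathrm{Fin}}}^{|||\cdot|||}$ is taken in the space of all $\Phi\in\mathcal{H}$ with $|||\Phi|||<\infty$, with respect to $|||\cdot|||$. *)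

theory Defs
  imports "HOL-Analysis.Analysis" "HOL-Library.Function_Algebras"
begin

section \<open>Complex Hilbert spaces\<close>

text \<open>
  A Hilbert space is a complex linear subspace of some ambient complex vector space together with
  an inner product on that subspace.  Carrying the set explicitly lets the fibres \<open>H \<alpha>\<close> of a field
  of Hilbert spaces be unrelated spaces inside a single type.
\<close>

class complex_vector = ab_group_add +
  fixes scaleC :: "complex \<Rightarrow> 'a \<Rightarrow> 'a"  (infixr \<open>*\<^sub>C\<close> 75)
  assumes scaleC_add_right: "a *\<^sub>C (x + y) = a *\<^sub>C x + a *\<^sub>C y"
    and scaleC_add_left: "(a + b) *\<^sub>C x = a *\<^sub>C x + b *\<^sub>C x"
    and scaleC_scaleC: "a *\<^sub>C (b *\<^sub>C x) = (a * b) *\<^sub>C x"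
    and scaleC_one: "1 *\<^sub>C x = x"

global_interpretation complex_vector: vector_space "scaleC :: complex \<Rightarrow> 'a \<Rightarrow> 'a :: complex_vector"
  by unfold_locales (simp_all add: scaleC_add_right scaleC_add_left scaleC_scaleC scaleC_one)

abbreviation csubspace :: "'v::complex_vector set \<Rightarrow> bool"
  where "csubspace \<equiv> module.subspace scaleC"

abbreviation cspan :: "'v::complex_vector set \<Rightarrow> 'v set"
  where "cspan \<equiv> module.span scaleC"

instantiation "fun" :: (type, complex_vector) complex_vector
begin
definition scaleC_fun_def: "c *\<^sub>C f = (\<lambda>x. c *\<^sub>C f x)"
instance
  by standard
    (simp_all add: scaleC_fun_def fun_eq_iff scaleC_add_right scaleC_add_left scaleC_scaleC scaleC_one)
end

record 'v hspace =
  hcarrier :: "'v set"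
  hinner :: "'v \<Rightarrow> 'v \<Rightarrow> complex"

definition hnorm :: "'v hspace \<Rightarrow> 'v \<Rightarrow> real"
  where "hnorm H x = sqrt (Re (hinner H x x))"

definition hlim :: "('v::complex_vector) hspace \<Rightarrow> (nat \<Rightarrow> 'v) \<Rightarrow> 'v \<Rightarrow> bool"
  where "hlim H s x \<longleftrightarrow> (\<lambda>n. hnorm H (s n - x)) \<longlonglongrightarrow> 0"

definition hdense :: "('v::complex_vector) hspace \<Rightarrow> 'v set \<Rightarrow> bool"
  where "hdense H D \<longleftrightarrow>
    D \<subseteq> hcarrier H \<and> (\<forall>x\<in>hcarrier H. \<forall>e>0. \<exists>d\<in>D. hnorm H (x - d) < e)"

text \<open>Separable complex Hilbert space; the inner product is antilinear in the first entry.\<close>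

locale hilbert_space =
  fixes H :: "('v::complex_vector) hspace"
  assumes subspace: "csubspace (hcarrier H)"
    and inner_add_right:
      "\<lbrakk>x \<in> hcarrier H; y \<in> hcarrier H; z \<in> hcarrier H\<rbrakk>
        \<Longrightarrow> hinner H x (y + z) = hinner H x y + hinner H x z"
    and inner_scale_right:
      "\<lbrakk>x \<in> hcarrier H; y \<in> hcarrier H\<rbrakk> \<Longrightarrow> hinner H x (c *\<^sub>C y) = c * hinner H x y"
    and inner_commute:
      "\<lbrakk>x \<in> hcarrier H; y \<in> hcarrier H\<rbrakk> \<Longrightarrow> hinner H x y = cnj (hinner H y x)"
    and inner_pos: "\<lbrakk>x \<in> hcarrier H; x \<noteq> 0\<rbrakk> \<Longrightarrow> 0 < Re (hinner H x x)"
    and complete: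
      "\<lbrakk>\<And>n. s n \<in> hcarrier H; \<forall>e>0. \<exists>N. \<forall>m\<ge>N. \<forall>n\<ge>N. hnorm H (s m - s n) < e\<rbrakk>
        \<Longrightarrow> \<exists>x\<in>hcarrier H. hlim H s x"
    and separable: "\<exists>A. countable A \<and> hdense H A"

section \<open>Unbounded operators and resolutions of the identity\<close>

text \<open>Unbounded operators are represented by their graphs; the domain is \<open>Domain\<close>.\<close>

definition op_app :: "('v \<times> 'v) set \<Rightarrow> 'v \<Rightarrow> 'v"
  where "op_app T x = (THE y. (x, y) \<in> T)"

definition densely_defined_operator :: "('v::complex_vector) hspace \<Rightarrow> ('v \<times> 'v) set \<Rightarrow> bool"
  where "densely_defined_operator H T \<longleftrightarrow>
    T \<subseteq> hcarrier H \<times> hcarrier H \<and> single_valued T \<and>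
    (\<forall>(x, y)\<in>T. \<forall>(x', y')\<in>T. (x + x', y + y') \<in> T) \<and>
    (\<forall>c. \<forall>(x, y)\<in>T. (c *\<^sub>C x, c *\<^sub>C y) \<in> T) \<and>
    hdense H (Domain T)"

definition adjoint_op :: "('v::complex_vector) hspace \<Rightarrow> ('v \<times> 'v) set \<Rightarrow> ('v \<times> 'v) set"
  where "adjoint_op H T =
    {(x, y). x \<in> hcarrier H \<and> y \<in> hcarrier H \<and> (\<forall>(u, v)\<in>T. hinner H v x = hinner H u y)}"

definition self_adjoint_op :: "('v::complex_vector) hspace \<Rightarrow> ('v \<times> 'v) set \<Rightarrow> bool"
  where "self_adjoint_op H T \<longleftrightarrow> densely_defined_operator H T \<and> adjoint_op H T = T"

definition orthogonal_projection :: "('v::complex_vector) hspace \<Rightarrow> ('v \<Rightarrow> 'v) \<Rightarrow> bool"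
  where "orthogonal_projection H P \<longleftrightarrow>
    (\<forall>x\<in>hcarrier H. P x \<in> hcarrier H \<and> P (P x) = P x) \<and>
    (\<forall>x\<in>hcarrier H. \<forall>y\<in>hcarrier H. P (x + y) = P x + P y) \<and>
    (\<forall>c. \<forall>x\<in>hcarrier H. P (c *\<^sub>C x) = c *\<^sub>C P x) \<and>
    (\<forall>x\<in>hcarrier H. \<forall>y\<in>hcarrier H. hinner H (P x) y = hinner H x (P y))"

definition projection_valued_measure ::
    "('v::complex_vector) hspace \<Rightarrow> (real set \<Rightarrow> 'v \<Rightarrow> 'v) \<Rightarrow> bool"
  where "projection_valued_measure H E \<longleftrightarrow>
    (\<forall>\<sigma>\<in>sets borel. orthogonal_projection H (E \<sigma>)) \<and>
    (\<forall>x\<in>hcarrier H. E UNIV x = x) \<and>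
    (\<forall>\<sigma>\<in>sets borel. \<forall>\<tau>\<in>sets borel. \<forall>x\<in>hcarrier H. E (\<sigma> \<inter> \<tau>) x = E \<sigma> (E \<tau> x)) \<and>
    (\<forall>\<sigma>::nat \<Rightarrow> real set. range \<sigma> \<subseteq> sets borel \<longrightarrow> disjoint_family \<sigma> \<longrightarrow>
      (\<forall>x\<in>hcarrier H. hlim H (\<lambda>n. \<Sum>i<n. E (\<sigma> i) x) (E (\<Union>i. \<sigma> i) x)))"

text \<open>The measure \<open>\<nu>\<^sub>x(\<sigma>) = \<parallel>E(\<sigma>) x\<parallel>\<^sup>2\<close> on the Borel sets of the real line.\<close>

definition spectral_measure ::
    "('v::complex_vector) hspace \<Rightarrow> (real set \<Rightarrow> 'v \<Rightarrow> 'v) \<Rightarrow> 'v \<Rightarrow> real measure"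
  where "spectral_measure H E x =
    measure_of UNIV (sets borel) (\<lambda>\<sigma>. ennreal ((hnorm H (E \<sigma> x))\<^sup>2))"

definition spectral_dom ::
    "('v::complex_vector) hspace \<Rightarrow> (real set \<Rightarrow> 'v \<Rightarrow> 'v) \<Rightarrow> (real \<Rightarrow> real) \<Rightarrow> 'v set"
  where "spectral_dom H E f =
    {x \<in> hcarrier H. integrable (spectral_measure H E x) (\<lambda>t. (f t)\<^sup>2)}"

text \<open>
  The operator \<open>\<integral> f dE\<close> for a real Borel function \<open>f\<close>: its domain consists of the \<open>x\<close> with
  \<open>\<integral> f\<^sup>2 d\<nu>\<^sub>x < \<infinity>\<close>, and \<open>y = (\<integral> f dE) x\<close> is determined by \<open>\<langle>z, y\<rangle> = \<integral> f(t) d\<langle>z, E(t) x\<rangle>\<close> for \<open>z\<close> in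
  the (dense) domain.  The complex measure \<open>\<langle>z, E(\<sigma>) x\<rangle>\<close> is expanded by polarisation as
  \<open>1/4 \<Sum>\<^sub>k i\<^sup>k \<parallel>E(\<sigma>) (x + i\<^sup>k z)\<parallel>\<^sup>2\<close>, \<open>k = 0, \<dots>, 3\<close>.
\<close>

definition spectral_integral ::
    "('v::complex_vector) hspace \<Rightarrow> (real set \<Rightarrow> 'v \<Rightarrow> 'v) \<Rightarrow> (real \<Rightarrow> real) \<Rightarrow> ('v \<times> 'v) set"
  where "spectral_integral H E f =
    {(x, y). x \<in> spectral_dom H E f \<and> y \<in> hcarrier H \<and>
      (\<forall>z\<in>spectral_dom H E f. hinner H z y =
        (1/4) * (\<Sum>k<4::nat. \<i> ^ k *
          complex_of_real (\<integral>t. f t \<partial>spectral_measure H E (x + \<i> ^ k *\<^sub>C z))))}"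

definition resolution_of_identity ::
    "('v::complex_vector) hspace \<Rightarrow> ('v \<times> 'v) set \<Rightarrow> (real set \<Rightarrow> 'v \<Rightarrow> 'v) \<Rightarrow> bool"
  where "resolution_of_identity H T E \<longleftrightarrow>
    projection_valued_measure H E \<and> T = spectral_integral H E (\<lambda>t. t)"

text \<open>\<open>|T|\<^sup>1\<^sup>/\<^sup>2\<close> and \<open>sgn T\<close> in terms of the resolution of the identity of \<open>T\<close>.\<close>

definition sqrt_abs_op :: "('v::complex_vector) hspace \<Rightarrow> (real set \<Rightarrow> 'v \<Rightarrow> 'v) \<Rightarrow> ('v \<times> 'v) set"
  where "sqrt_abs_op H E = spectral_integral H E (\<lambda>t. sqrt \<bar>t\<bar>)"

definition sgn_op :: "(real set \<Rightarrow> 'v::complex_vector \<Rightarrow> 'v) \<Rightarrow> 'v \<Rightarrow> 'v"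
  where "sgn_op E x = E {0<..} x - E {..<0} x"

section \<open>Hermitian quadratic forms and strong representability\<close>

text \<open>
  A Hermitian quadratic form is the (real-valued) diagonal of a Hermitian sesquilinear form \<open>B\<close>;
  antilinearity of \<open>B\<close> in the first entry follows from linearity in the second and symmetry.
\<close>

definition hermitian_quadratic_form ::
    "('v::complex_vector) hspace \<Rightarrow> 'v set \<Rightarrow> ('v \<Rightarrow> real) \<Rightarrow> bool"
  where "hermitian_quadratic_form H D Q \<longleftrightarrow>
    csubspace D \<and> hdense H D \<and>
    (\<exists>B :: 'v \<Rightarrow> 'v \<Rightarrow> complex.
      (\<forall>x\<in>D. \<forall>y\<in>D. \<forall>z\<in>D. B x (y + z) = B x y + B x z) \<and>
      (\<forall>c. \<forall>x\<in>D. \<forall>y\<in>D. B x (c *\<^sub>C y) = c * B x y) \<and>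
      (\<forall>x\<in>D. \<forall>y\<in>D. B x y = cnj (B y x)) \<and>
      (\<forall>x\<in>D. complex_of_real (Q x) = B x x))"

definition closable_form :: "('v::complex_vector) hspace \<Rightarrow> 'v set \<Rightarrow> ('v \<Rightarrow> real) \<Rightarrow> bool"
  where "closable_form H D Q \<longleftrightarrow>
    (\<forall>s :: nat \<Rightarrow> 'v. (\<forall>n. s n \<in> D) \<longrightarrow> hlim H s 0 \<longrightarrow>
      (\<forall>e>0. \<exists>N. \<forall>m\<ge>N. \<forall>n\<ge>N. \<bar>Q (s n - s m)\<bar> < e) \<longrightarrow>
      (\<lambda>n. Q (s n)) \<longlonglongrightarrow> 0)"

text \<open>
  Squared norms with values in \<open>[0, \<infinity>]\<close> are used below, so that no finiteness is presupposed.
  \<open>closure_in N X A\<close> is the closure of \<open>A\<close> in \<open>X\<close> for the norm whose square is \<open>N\<close>.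
\<close>

definition closure_in :: "('v::complex_vector \<Rightarrow> ennreal) \<Rightarrow> 'v set \<Rightarrow> 'v set \<Rightarrow> 'v set"
  where "closure_in N X A = {x \<in> X. \<forall>e>0. \<exists>y\<in>A. N (x - y) < e}"

definition spectral_norm_sq ::
    "('v::complex_vector) hspace \<Rightarrow> (real set \<Rightarrow> 'v \<Rightarrow> 'v) \<Rightarrow> 'v \<Rightarrow> ennreal"
  where "spectral_norm_sq H E x = (\<integral>\<^sup>+t. ennreal (1 + \<bar>t\<bar>) \<partial>spectral_measure H E x)"

text \<open>
  \<open>(Q, D)\<close> is strongly represented by \<open>T\<close> (with resolution of the identity \<open>E\<close>) through the
  extension \<open>(Q', D')\<close>.
\<close>

definition strong_representation ::
    "('v::complex_vector) hspace \<Rightarrow> 'v set \<Rightarrow> ('v \<Rightarrow> real) \<Rightarrow> ('v \<times> 'v) set \<Rightarrow>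
      (real set \<Rightarrow> 'v \<Rightarrow> 'v) \<Rightarrow> 'v set \<Rightarrow> ('v \<Rightarrow> real) \<Rightarrow> bool"
  where "strong_representation H D Q T E D' Q' \<longleftrightarrow>
    self_adjoint_op H T \<and> resolution_of_identity H T E \<and>
    hermitian_quadratic_form H D' Q' \<and> D \<subseteq> D' \<and> (\<forall>x\<in>D. Q' x = Q x) \<and>
    Domain T \<subseteq> D' \<and> D \<subseteq> Domain (sqrt_abs_op H E) \<and>
    D' = closure_in (spectral_norm_sq H E) (Domain (sqrt_abs_op H E)) D \<and>
    (\<forall>x\<in>D'. Q' x = (\<integral>t. t \<partial>spectral_measure H E x))"

definition strongly_representable ::
    "('v::complex_vector) hspace \<Rightarrow> 'v set \<Rightarrow> ('v \<Rightarrow> real) \<Rightarrow> ('v \<times> 'v) set \<Rightarrow>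
      (real set \<Rightarrow> 'v \<Rightarrow> 'v) \<Rightarrow> bool"
  where "strongly_representable H D Q T E \<longleftrightarrow> (\<exists>D' Q'. strong_representation H D Q T E D' Q')"

section \<open>Direct integrals\<close>

text \<open>
  A measurable field of Hilbert spaces over \<open>M\<close>, given by its space \<open>S\<close> of measurable sections.
  Sections are normalised to vanish outside \<open>space M\<close>.
\<close>

definition field_sections :: "'a measure \<Rightarrow> ('a \<Rightarrow> 'v::complex_vector hspace) \<Rightarrow> ('a \<Rightarrow> 'v) set"
  where "field_sections M H =
    {s. (\<forall>\<alpha>\<in>space M. s \<alpha> \<in> hcarrier (H \<alpha>)) \<and> (\<forall>\<alpha>. \<alpha> \<notin> space M \<longrightarrow> s \<alpha> = 0)}"

locale measurable_field =
  fixes M :: "'a measure" and H :: "'a \<Rightarrow> 'v::complex_vector hspace" and S :: "('a \<Rightarrow> 'v) set"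
  assumes fibre_hilbert: "\<alpha> \<in> space M \<Longrightarrow> hilbert_space (H \<alpha>)"
    and sections_subset: "S \<subseteq> field_sections M H"
    and sections_subspace: "csubspace S"
    and norm_measurable: "s \<in> S \<Longrightarrow> (\<lambda>\<alpha>. hnorm (H \<alpha>) (s \<alpha>)) \<in> borel_measurable M"
    and sections_maximal:
      "\<lbrakk>t \<in> field_sections M H; \<And>s. s \<in> S \<Longrightarrow> (\<lambda>\<alpha>. hinner (H \<alpha>) (s \<alpha>) (t \<alpha>)) \<in> borel_measurable M\<rbrakk>
        \<Longrightarrow> t \<in> S"
    and fundamental_sequence:
      "\<exists>s :: nat \<Rightarrow> 'a \<Rightarrow> 'v. range s \<subseteq> S \<and>
        (\<forall>\<alpha>\<in>space M. hdense (H \<alpha>) (cspan (range (\<lambda>n. s n \<alpha>))))"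

text \<open>
  The direct integral, presented by the square-integrable measurable sections with the inner
  product \<open>\<integral> \<langle>s(\<alpha>), t(\<alpha>)\<rangle> d\<mu>(\<alpha>)\<close>.  For a general measure, sections that agree almost everywhere have to be
  identified.  The definition performs no such identification and is meant for measures all
  of whose points have positive mass: there the empty set is the only null set, so that
  almost everywhere equality is equality and the value \<open>s(\<alpha>)\<close> of a vector is well defined.
\<close>

definition direct_integral ::
    "'a measure \<Rightarrow> ('a \<Rightarrow> 'v::complex_vector hspace) \<Rightarrow> ('a \<Rightarrow> 'v) set \<Rightarrow> ('a \<Rightarrow> 'v) hspace"
  where "direct_integral M H S =
    \<lparr>hcarrier = {s \<in> S. integrable M (\<lambda>\<alpha>. (hnorm (H \<alpha>) (s \<alpha>))\<^sup>2)},
     hinner = (\<lambda>s t. \<integral>\<alpha>. hinner (H \<alpha>) (s \<alpha>) (t \<alpha>) \<partial>M)\<rparr>"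

text \<open>\<open>P\<^sub>\<Delta>\<close>, the orthogonal projection onto the sections supported in \<open>\<Delta>\<close>; see
  \<open>block_proj_projection\<close> below.\<close>

definition block_proj :: "'a set \<Rightarrow> ('a \<Rightarrow> 'v::complex_vector) \<Rightarrow> 'a \<Rightarrow> 'v"
  where "block_proj \<Delta> s = (\<lambda>\<alpha>. if \<alpha> \<in> \<Delta> then s \<alpha> else 0)"

text \<open>The decomposable operator valued set function \<open>E(\<sigma>) = \<integral>\<^sup>\<oplus> E\<^sup>\<alpha>(\<sigma>) d\<mu>(\<alpha>)\<close>.\<close>

definition direct_integral_pvm ::
    "'a measure \<Rightarrow> ('a \<Rightarrow> real set \<Rightarrow> 'v \<Rightarrow> 'v) \<Rightarrow> real set \<Rightarrow> ('a \<Rightarrow> 'v::complex_vector) \<Rightarrow> 'a \<Rightarrow> 'v"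
  where "direct_integral_pvm M E \<sigma> s = (\<lambda>\<alpha>. if \<alpha> \<in> space M then E \<alpha> \<sigma> (s \<alpha>) else 0)"

definition orthogonally_additive ::
    "'a measure \<Rightarrow> ('a \<Rightarrow> 'v::complex_vector) set \<Rightarrow> (('a \<Rightarrow> 'v) \<Rightarrow> real) \<Rightarrow> bool"
  where "orthogonally_additive M D Q \<longleftrightarrow>
    (\<forall>\<Delta>\<in>sets M. block_proj \<Delta> ` D \<subseteq> D) \<and>
    (\<forall>\<Phi>\<in>D. \<exists>m>0. \<forall>\<Delta>\<in>sets M. \<bar>Q (block_proj \<Delta> \<Phi>)\<bar> < m) \<and>
    (\<forall>\<Delta>\<in>sets M. \<forall>(N::nat) d. (\<forall>i<N. d i \<in> sets M) \<longrightarrow> disjoint_family_on d {..<N} \<longrightarrow>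
      (\<Union>i<N. d i) = \<Delta> \<longrightarrow>
      (\<forall>\<Phi>\<in>D. Q (block_proj \<Delta> \<Phi>) = (\<Sum>i<N. Q (block_proj (d i) \<Phi>))))"

definition point_supported :: "'a measure \<Rightarrow> bool"
  where "point_supported M \<longleftrightarrow>
    countable (space M) \<and> sets M = Pow (space M) \<and>
    (\<forall>\<Delta>\<subseteq>space M. emeasure M \<Delta> = (\<Sum>\<^sub>\<infinity>x\<in>\<Delta>. emeasure M {x}))"

text \<open>
  \<open>P\<^sub>\<alpha> D\<close>, identified with a subspace of the fibre, and the form \<open>q\<^sub>\<alpha>\<close> on it.  The section
  \<open>P\<^sub>\<alpha> \<Phi>\<close> only depends on \<open>u = \<Phi>(\<alpha>)\<close> and equals \<open>P\<^sub>\<alpha>\<close> applied to the constant function \<open>u\<close>.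
\<close>

definition fibre_dom :: "('a \<Rightarrow> 'v) set \<Rightarrow> 'a \<Rightarrow> 'v set"
  where "fibre_dom D \<alpha> = {\<Phi> \<alpha> | \<Phi>. \<Phi> \<in> D}"

definition fibre_form ::
    "'a measure \<Rightarrow> (('a \<Rightarrow> 'v::complex_vector) \<Rightarrow> real) \<Rightarrow> 'a \<Rightarrow> 'v \<Rightarrow> real"
  where "fibre_form M Q \<alpha> u = Q (block_proj {\<alpha>} (\<lambda>_. u)) / measure M {\<alpha>}"

definition D_Fin ::
    "'a measure \<Rightarrow> ('a \<Rightarrow> 'v::complex_vector) set \<Rightarrow> ('a \<Rightarrow> real set \<Rightarrow> 'v \<Rightarrow> 'v) \<Rightarrow> ('a \<Rightarrow> 'v) set"
  where "D_Fin M D E =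
    {direct_integral_pvm M E \<sigma> (block_proj \<Delta> \<Phi>) | \<sigma> \<Delta> \<Phi>.
      \<Phi> \<in> D \<and> \<Delta> \<in> sets M \<and> emeasure M \<Delta> < \<infinity> \<and> compact \<sigma>}"

definition field_norm_sq ::
    "'a measure \<Rightarrow> ('a \<Rightarrow> 'v::complex_vector hspace) \<Rightarrow> ('a \<Rightarrow> 'v) set \<Rightarrow>
      ('a \<Rightarrow> real set \<Rightarrow> 'v \<Rightarrow> 'v) \<Rightarrow> ('a \<Rightarrow> 'v) \<Rightarrow> ennreal"
  where "field_norm_sq M H S E \<Phi> =
    ennreal ((hnorm (direct_integral M H S) \<Phi>)\<^sup>2) +
    (\<integral>\<^sup>+\<alpha>. (\<integral>\<^sup>+t. ennreal \<bar>t\<bar> \<partial>spectral_measure (H \<alpha>) (E \<alpha>) (\<Phi> \<alpha>)) \<partial>M)"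

text \<open>
  \<open>block_proj \<Delta>\<close> is the orthogonal projection of the direct integral whose range consists of the
  vectors that vanish outside \<open>\<Delta>\<close>.
\<close>

lemma (in hilbert_space) inner_zero_right: "x \<in> hcarrier H \<Longrightarrow> hinner H x 0 = 0"
  using inner_scale_right[of x x 0] by simp

lemma (in hilbert_space) inner_zero_left: "x \<in> hcarrier H \<Longrightarrow> hinner H 0 x = 0"
  using inner_zero_right inner_commute[of 0 x] complex_vector.subspace_0[OF subspace] by simp

lemma (in hilbert_space) hnorm_sq:
  assumes "x \<in> hcarrier H"
  shows "(hnorm H x)\<^sup>2 = Re (hinner H x x)"
  using assms inner_pos[of x] inner_zero_right[of x]
  by (cases "x = 0") (simp_all add: hnorm_def)

lemma (in hilbert_space) Re_inner_polarisation:
  assumes x: "x \<in> hcarrier H" and y: "y \<in> hcarrier H"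
  shows "Re (hinner H x y) = ((hnorm H (x + y))\<^sup>2 - (hnorm H x)\<^sup>2 - (hnorm H y)\<^sup>2) / 2"
proof -
  have xy: "x + y \<in> hcarrier H"
    using x y subspace by (rule complex_vector.subspace_add[rotated])
  have "hinner H (x + y) (x + y) = hinner H (x + y) x + hinner H (x + y) y"
    using inner_add_right[OF xy x y] .
  also have "\<dots> = cnj (hinner H x (x + y)) + cnj (hinner H y (x + y))"
    using inner_commute xy x y by metis
  also have "\<dots> = cnj (hinner H x x + hinner H x y) + cnj (hinner H y x + hinner H y y)"
    using inner_add_right x y by simp
  finally have "Re (hinner H (x + y) (x + y)) =
      Re (hinner H x x) + Re (hinner H x y) + Re (hinner H y x) + Re (hinner H y y)"
    by simp
  moreover have "Re (hinner H y x) = Re (hinner H x y)"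
    using inner_commute[OF x y] by simp
  ultimately show ?thesis
    using x y xy by (simp add: hnorm_sq)
qed

context measurable_field
begin

lemma section_in_fibre: "\<lbrakk>s \<in> S; \<alpha> \<in> space M\<rbrakk> \<Longrightarrow> s \<alpha> \<in> hcarrier (H \<alpha>)"
  using sections_subset by (auto simp: field_sections_def)

lemma Re_inner_measurable:
  assumes "s \<in> S" "t \<in> S"
  shows "(\<lambda>\<alpha>. Re (hinner (H \<alpha>) (s \<alpha>) (t \<alpha>))) \<in> borel_measurable M"
proof -
  have st: "s + t \<in> S"
    using assms sections_subspace by (metis complex_vector.subspace_add)
  have "(\<lambda>\<alpha>. ((hnorm (H \<alpha>) ((s + t) \<alpha>))\<^sup>2 - (hnorm (H \<alpha>) (s \<alpha>))\<^sup>2 - (hnorm (H \<alpha>) (t \<alpha>))\<^sup>2) / 2)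
      \<in> borel_measurable M"
    using norm_measurable[OF st] norm_measurable[OF assms(1)] norm_measurable[OF assms(2)]
    by measurable
  then show ?thesis
    by (rule measurable_cong[THEN iffD1, rotated])
      (simp add: hilbert_space.Re_inner_polarisation fibre_hilbert section_in_fibre assms)
qed

lemma inner_measurable:
  assumes "s \<in> S" "t \<in> S"
  shows "(\<lambda>\<alpha>. hinner (H \<alpha>) (s \<alpha>) (t \<alpha>)) \<in> borel_measurable M"
proof -
  have it: "\<i> *\<^sub>C t \<in> S"
    using assms sections_subspace by (metis complex_vector.subspace_scale)
  have "(\<lambda>\<alpha>. Complex (Re (hinner (H \<alpha>) (s \<alpha>) (t \<alpha>))) (- Re (hinner (H \<alpha>) (s \<alpha>) ((\<i> *\<^sub>C t) \<alpha>))))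
      \<in> borel_measurable M"
    unfolding Complex_eq
    using Re_inner_measurable[OF assms] Re_inner_measurable[OF assms(1) it] by measurable
  then show ?thesis
    by (rule measurable_cong[THEN iffD1, rotated])
      (simp add: scaleC_fun_def hilbert_space.inner_scale_right fibre_hilbert section_in_fibre assms
        complex_eq_iff)
qed

lemma block_proj_section:
  assumes \<Delta>: "\<Delta> \<in> sets M" and t: "t \<in> S"
  shows "block_proj \<Delta> t \<in> S"
proof (rule sections_maximal)
  show "block_proj \<Delta> t \<in> field_sections M H"
    using t sections_subset complex_vector.subspace_0[OF hilbert_space.subspace[OF fibre_hilbert]]
    by (auto simp: field_sections_def block_proj_def)
next
  fix s assume s: "s \<in> S"
  have "(\<lambda>\<alpha>. if \<alpha> \<in> \<Delta> then hinner (H \<alpha>) (s \<alpha>) (t \<alpha>) else 0) \<in> borel_measurable M"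
    using inner_measurable[OF s t] \<Delta> by measurable
  then show "(\<lambda>\<alpha>. hinner (H \<alpha>) (s \<alpha>) (block_proj \<Delta> t \<alpha>)) \<in> borel_measurable M"
    by (rule measurable_cong[THEN iffD1, rotated])
      (simp add: block_proj_def hilbert_space.inner_zero_right fibre_hilbert section_in_fibre s)
qed

lemma block_proj_projection:
  assumes \<Delta>: "\<Delta> \<in> sets M"
  shows "orthogonal_projection (direct_integral M H S) (block_proj \<Delta>)"
proof -
  have "integrable M (\<lambda>\<alpha>. (hnorm (H \<alpha>) (block_proj \<Delta> s \<alpha>))\<^sup>2)"
    if "s \<in> S" "integrable M (\<lambda>\<alpha>. (hnorm (H \<alpha>) (s \<alpha>))\<^sup>2)" for s
  proof (rule Bochner_Integration.integrable_bound[OF that(2)])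
    show "(\<lambda>\<alpha>. (hnorm (H \<alpha>) (block_proj \<Delta> s \<alpha>))\<^sup>2) \<in> borel_measurable M"
      using norm_measurable[OF block_proj_section[OF \<Delta> that(1)]] by measurable
    show "AE \<alpha> in M. norm ((hnorm (H \<alpha>) (block_proj \<Delta> s \<alpha>))\<^sup>2) \<le> norm ((hnorm (H \<alpha>) (s \<alpha>))\<^sup>2)"
    proof (rule AE_I2)
      fix \<alpha> assume \<alpha>: "\<alpha> \<in> space M"
      interpret hilbert_space "H \<alpha>" using fibre_hilbert \<alpha> .
      show "norm ((hnorm (H \<alpha>) (block_proj \<Delta> s \<alpha>))\<^sup>2) \<le> norm ((hnorm (H \<alpha>) (s \<alpha>))\<^sup>2)"
        using inner_zero_right complex_vector.subspace_0[OF subspace]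
        by (simp add: block_proj_def hnorm_def)
    qed
  qed
  moreover have "(\<integral>\<alpha>. hinner (H \<alpha>) (block_proj \<Delta> s \<alpha>) (t \<alpha>) \<partial>M) =
      (\<integral>\<alpha>. hinner (H \<alpha>) (s \<alpha>) (block_proj \<Delta> t \<alpha>) \<partial>M)" if "s \<in> S" "t \<in> S" for s t
    by (rule Bochner_Integration.integral_cong)
      (simp_all add: block_proj_def hilbert_space.inner_zero_right hilbert_space.inner_zero_left
        fibre_hilbert section_in_fibre that)
  ultimately show ?thesis
    by (simp add: orthogonal_projection_def direct_integral_def block_proj_section[OF \<Delta>])
      (simp add: block_proj_def scaleC_fun_def fun_eq_iff)
qed

lemma block_proj_fixed_iff: "block_proj \<Delta> \<Phi> = \<Phi> \<longleftrightarrow> (\<forall>\<alpha>. \<alpha> \<notin> \<Delta> \<longrightarrow> \<Phi> \<alpha> = 0)"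
  by (auto simp: block_proj_def fun_eq_iff)

end

end

theory Submission
  imports Defs
begin

text \<open>Nothing makes E(\<sigma>) map D into itself, so vectors of \<open>D_Fin\<close> need not
  lie in D, and Q is not assumed continuous for the spectral norm. The formula for Q can therefore
  not be extended by density from truncated vectors. Closability is applied to the tails of one
  fixed vector instead, because orthogonal additivity turns differences of tails into finite blocks
  on which Q is already known. A second obstacle is that \<open>spectral_integral\<close> describes
  an operator by a weak polarised formula, in which neither existence of values, nor additivity, nor
  self-adjointness is visible. Values are built as limits of step functions of E, linearity is
  recovered from symmetry, and self-adjointness from spectral cut-offs. Closeness is measured by
  squared norms in [0, \<infinity>]. They obey N(x + y) \<le> 2 N(x) + 2 N(y) in place of the
  triangle inequality, which is the source of the factors 2 and of the thresholds e / 4.\<close>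

text \<open>
  On a space of atoms the spectral measure of the decomposable resolution of the identity is
  \<open>\<nu>\<^sub>\<Phi> = \<integral> \<nu>\<^sup>\<alpha>\<^sub>\<Phi> d\<mu>(\<alpha>)\<close>, so the spectral norm of \<open>T\<close> is the field norm and membership in the closure of
  \<open>D_Fin\<close> puts \<open>D\<close> into the domain of \<open>|T|\<^sup>1\<^sup>/\<^sup>2\<close>.  In each fibre \<open>D(T\<^sub>\<alpha>)\<close> is a core for \<open>|T\<^sub>\<alpha>|\<^sup>1\<^sup>/\<^sup>2\<close>,
  hence strong representability forces the fibre of \<open>D\<close> to be dense in \<open>D(|T\<^sub>\<alpha>|\<^sup>1\<^sup>/\<^sup>2)\<close>; cutting a vector
  down to finitely many atoms and approximating there gives density of \<open>D\<close> in \<open>D(|T|\<^sup>1\<^sup>/\<^sup>2)\<close>.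
  The same core argument for \<open>T\<close> shows that every representing extension lives on \<open>D(|T|\<^sup>1\<^sup>/\<^sup>2)\<close>.
  Finally \<open>Q(P\<^sub>F \<Phi>) = \<integral>\<^sub>F \<integral> \<lambda> d\<nu>\<^sup>\<alpha>\<^sub>\<Phi>(\<lambda>) d\<mu>(\<alpha>)\<close> for finite \<open>F\<close>; as \<open>F\<close> exhausts the space, the tails \<open>\<Phi> - P\<^sub>F \<Phi>\<close> tend
  to \<open>0\<close> and are Cauchy for \<open>Q\<close>, so closability yields \<open>Q(\<Phi>) = \<integral> \<lambda> d\<nu>\<^sub>\<Phi>(\<lambda>)\<close>.
\<close>

section \<open>Inner product spaces carried by a subspace\<close>

text \<open>The locale \<open>hilbert_space\<close> without separability, which is never needed for the direct integral.\<close>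

locale complete_inner_space =
  fixes H :: "('v::complex_vector) hspace"
  assumes carrier_subspace: "csubspace (hcarrier H)"
    and inner_add_right:
      "\<lbrakk>x \<in> hcarrier H; y \<in> hcarrier H; z \<in> hcarrier H\<rbrakk>
        \<Longrightarrow> hinner H x (y + z) = hinner H x y + hinner H x z"
    and inner_scale_right:
      "\<lbrakk>x \<in> hcarrier H; y \<in> hcarrier H\<rbrakk> \<Longrightarrow> hinner H x (c *\<^sub>C y) = c * hinner H x y"
    and inner_commute:
      "\<lbrakk>x \<in> hcarrier H; y \<in> hcarrier H\<rbrakk> \<Longrightarrow> hinner H x y = cnj (hinner H y x)"
    and inner_pos: "\<lbrakk>x \<in> hcarrier H; x \<noteq> 0\<rbrakk> \<Longrightarrow> 0 < Re (hinner H x x)"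
    and complete:
      "\<lbrakk>\<And>n. s n \<in> hcarrier H; \<forall>e>0. \<exists>N. \<forall>m\<ge>N. \<forall>n\<ge>N. hnorm H (s m - s n) < e\<rbrakk>
        \<Longrightarrow> \<exists>x\<in>hcarrier H. hlim H s x"

lemma (in hilbert_space) complete_inner_space: "complete_inner_space H"
  by (rule complete_inner_space.intro)
    (use subspace inner_add_right inner_scale_right inner_commute inner_pos complete in blast)+

context complete_inner_space
begin

abbreviation "C \<equiv> hcarrier H"
abbreviation "ip \<equiv> hinner H"
abbreviation "nm \<equiv> hnorm H"

lemma zero_C [simp, intro]: "0 \<in> C"
  by (rule complex_vector.subspace_0[OF carrier_subspace])
lemma add_C [simp, intro]: "x \<in> C \<Longrightarrow> y \<in> C \<Longrightarrow> x + y \<in> C"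
  by (rule complex_vector.subspace_add[OF carrier_subspace])
lemma scale_C [simp, intro]: "x \<in> C \<Longrightarrow> c *\<^sub>C x \<in> C"
  by (rule complex_vector.subspace_scale[OF carrier_subspace])
lemma diff_C [simp, intro]: "x \<in> C \<Longrightarrow> y \<in> C \<Longrightarrow> x - y \<in> C"
  by (rule complex_vector.subspace_diff[OF carrier_subspace])
lemma sum_C: "(\<And>i. i \<in> I \<Longrightarrow> f i \<in> C) \<Longrightarrow> sum f I \<in> C"
  by (rule complex_vector.subspace_sum[OF carrier_subspace])

lemma ip_diff_right:
  assumes "x \<in> C" "y \<in> C" "z \<in> C" shows "ip x (y - z) = ip x y - ip x z"
  using inner_add_right[OF assms(1) diff_C[OF assms(2,3)] assms(3)] by simp

lemma ip_add_left:
  assumes "x \<in> C" "y \<in> C" "z \<in> C" shows "ip (x + y) z = ip x z + ip y z"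
  using inner_commute[of "x + y" z] inner_commute[of x z] inner_commute[of y z]
    inner_add_right[of z x y] assms by simp

lemma ip_diff_left:
  assumes "x \<in> C" "y \<in> C" "z \<in> C" shows "ip (x - y) z = ip x z - ip y z"
  using inner_commute[of "x - y" z] inner_commute[of x z] inner_commute[of y z]
    ip_diff_right[of z x y] assms by simp

lemma ip_scale_left:
  assumes "x \<in> C" "y \<in> C" shows "ip (c *\<^sub>C x) y = cnj c * ip x y"
  using inner_commute[of "c *\<^sub>C x" y] inner_commute[of x y] inner_scale_right[of y x c] assms
  by simp

lemma ip_zero_right [simp]: "x \<in> C \<Longrightarrow> ip x 0 = 0"
  using inner_scale_right[of x x 0] by simp

lemmas ip_simps = inner_add_right ip_add_left ip_diff_right ip_diff_left inner_scale_right ip_scale_left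

lemma ip_self: "x \<in> C \<Longrightarrow> ip x x = complex_of_real ((nm x)\<^sup>2)"
  using inner_commute[of x x] inner_pos[of x]
  by (cases "x = 0") (auto simp: hnorm_def complex_eq_iff)

lemma nm_sq: "x \<in> C \<Longrightarrow> (nm x)\<^sup>2 = Re (ip x x)"
  by (simp add: ip_self)

text \<open>The function \<open>sqrt\<close> is odd, so outside the carrier \<open>hnorm\<close> may
  be negative; even the sign needs membership.\<close>

lemma nm_nonneg [simp]: "x \<in> C \<Longrightarrow> 0 \<le> nm x"
  using inner_pos[of x] by (cases "x = 0") (auto simp: hnorm_def)

lemma nm_zero [simp]: "nm 0 = 0"
  by (simp add: hnorm_def)

lemma nm_eq_0: "x \<in> C \<Longrightarrow> nm x = 0 \<longleftrightarrow> x = 0"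
  using inner_pos[of x] by (cases "x = 0") (auto simp: hnorm_def)

lemma nm_sq_add:
  assumes "x \<in> C" "y \<in> C"
  shows "(nm (x + y))\<^sup>2 = (nm x)\<^sup>2 + (nm y)\<^sup>2 + 2 * Re (ip x y)"
  using inner_commute[OF assms] assms by (simp add: nm_sq ip_simps)

lemma nm_sq_diff:
  assumes "x \<in> C" "y \<in> C"
  shows "(nm (x - y))\<^sup>2 = (nm x)\<^sup>2 + (nm y)\<^sup>2 - 2 * Re (ip x y)"
  using inner_commute[OF assms] assms by (simp add: nm_sq ip_simps)

lemma nm_scale: "x \<in> C \<Longrightarrow> nm (c *\<^sub>C x) = cmod c * nm x"
proof -
  assume x: "x \<in> C"
  have "ip (c *\<^sub>C x) (c *\<^sub>C x) = c * cnj c * ip x x"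
    using x by (simp add: ip_simps)
  also have "\<dots> = complex_of_real ((cmod c * nm x)\<^sup>2)"
    using x by (simp add: ip_self complex_norm_square[symmetric] power_mult_distrib)
  finally have "(nm (c *\<^sub>C x))\<^sup>2 = (cmod c * nm x)\<^sup>2"
    using x by (simp add: ip_self del: of_real_power of_real_mult)
  then show ?thesis
    using x by (metis mult_nonneg_nonneg nm_nonneg norm_ge_zero power2_eq_iff_nonneg scale_C)
qed

lemma nm_minus_commute: "x \<in> C \<Longrightarrow> y \<in> C \<Longrightarrow> nm (x - y) = nm (y - x)"
  using nm_scale[of "x - y" "-1"] by (simp add: complex_vector.scale_minus_left scaleC_one)

text \<open>The parallelogram law with one square dropped. Being linear in squared norms, it can be
  integrated, unlike the triangle inequality; applied to \<open>E A x\<close> and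
  \<open>E A y\<close> it compares spectral measures.\<close>

lemma nm_sq_add_le:
  assumes "x \<in> C" "y \<in> C" shows "(nm (x + y))\<^sup>2 \<le> 2 * (nm x)\<^sup>2 + 2 * (nm y)\<^sup>2"
  using nm_sq_add[OF assms] nm_sq_diff[OF assms] zero_le_power2[of "nm (x - y)"] by linarith

lemma Cauchy_Schwarz:
  assumes x: "x \<in> C" and y: "y \<in> C" shows "cmod (ip x y) \<le> nm x * nm y"
proof (cases "y = 0")
  case False
  \<comment> \<open>The multiple of y nearest to x; expanding the squared distance gives the
    inequality.\<close>
  define c where "c = ip y x / complex_of_real ((nm y)\<^sup>2)"
  have ny: "nm y > 0" using False nm_eq_0[OF y] nm_nonneg[OF y] by linarith
  have "Re (ip x (c *\<^sub>C y)) = (cmod (ip x y))\<^sup>2 / (nm y)\<^sup>2"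
    using x y inner_commute[OF y x]
    by (simp add: c_def ip_simps cmod_power2) (simp add: power2_eq_square)
  moreover have "(nm (c *\<^sub>C y))\<^sup>2 = (cmod (ip x y))\<^sup>2 / (nm y)\<^sup>2"
    using x y ny inner_commute[OF y x]
    by (simp add: c_def nm_scale norm_divide norm_mult power2_eq_square)
  ultimately have "0 \<le> (nm x)\<^sup>2 - (cmod (ip x y))\<^sup>2 / (nm y)\<^sup>2"
    using nm_sq_diff[OF x scale_C[OF y, of c]] zero_le_power2[of "nm (x - c *\<^sub>C y)"] by simp
  then have "(cmod (ip x y))\<^sup>2 \<le> (nm x * nm y)\<^sup>2"
    using ny by (simp add: field_simps)
  then show ?thesis
    using x y by (meson mult_nonneg_nonneg nm_nonneg power2_le_imp_le)
qed (use x in simp)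

lemma nm_triangle:
  assumes x: "x \<in> C" and y: "y \<in> C" shows "nm (x + y) \<le> nm x + nm y"
proof (rule power2_le_imp_le)
  have "Re (ip x y) \<le> nm x * nm y"
    using Cauchy_Schwarz[OF x y] complex_Re_le_cmod order_trans by blast
  then show "(nm (x + y))\<^sup>2 \<le> (nm x + nm y)\<^sup>2"
    using nm_sq_add[OF x y] by (simp add: power2_sum)
qed (use x y in simp)

text \<open>Summing over the four powers of \<i> cancels every term except the one containing
  \<open>ip v u\<close>, which occurs four times. Weights and order of arguments are those of
  \<open>spectral_integral\<close>.\<close>

lemma polarisation:
  assumes u: "u \<in> C" and v: "v \<in> C"
  shows "ip v u = (1/4) * (\<Sum>k<4::nat. \<i> ^ k * complex_of_real ((nm (u + \<i> ^ k *\<^sub>C v))\<^sup>2))"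
proof -
  have "complex_of_real ((nm (u + \<i> ^ k *\<^sub>C v))\<^sup>2) =
     ip u u + \<i>^k * ip u v + cnj (\<i>^k) * ip v u + cnj (\<i>^k) * \<i>^k * ip v v" for k
    using u v ip_self[of "u + \<i> ^ k *\<^sub>C v"] by (simp add: ip_simps algebra_simps)
  then show ?thesis
    by (simp only:) (simp add: eval_nat_numeral algebra_simps)
qed

lemma hlim_ip:
  assumes s: "\<And>n. s n \<in> C" and x: "x \<in> C" and z: "z \<in> C" and l: "hlim H s x"
  shows "(\<lambda>n. ip z (s n)) \<longlonglongrightarrow> ip z x"
proof (rule LIM_zero_cancel, rule Lim_null_comparison)
  show "\<forall>\<^sub>F n in sequentially. norm (ip z (s n) - ip z x) \<le> nm z * nm (s n - x)"
    using Cauchy_Schwarz[OF z diff_C[OF s x]] ip_diff_right[OF z s x] by simp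
  show "(\<lambda>n. nm z * nm (s n - x)) \<longlonglongrightarrow> 0"
    using l tendsto_mult_right_zero unfolding hlim_def by blast
qed

lemma hlim_ip_left:
  assumes "\<And>n. s n \<in> C" "x \<in> C" "z \<in> C" "hlim H s x"
  shows "(\<lambda>n. ip (s n) z) \<longlonglongrightarrow> ip x z"
  using tendsto_cnj[OF hlim_ip[OF assms]] inner_commute[of _ z] assms by simp

lemma hlim_nm:
  assumes s: "\<And>n. s n \<in> C" and x: "x \<in> C" and l: "hlim H s x"
  shows "(\<lambda>n. nm (s n)) \<longlonglongrightarrow> nm x"
proof (rule LIM_zero_cancel, rule Lim_null_comparison)
  show "\<forall>\<^sub>F n in sequentially. norm (nm (s n) - nm x) \<le> nm (s n - x)"
  proof (rule always_eventually, rule allI)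
    fix n
    show "norm (nm (s n) - nm x) \<le> nm (s n - x)"
      using nm_triangle[OF diff_C[OF s x] x, of n] nm_triangle[OF diff_C[OF x s] s, of n n]
        nm_minus_commute[OF x s, of n]
      by simp
  qed
qed (use l in \<open>simp add: hlim_def\<close>)

lemma C_dense: "hdense H C"
  unfolding hdense_def by (metis diff_self nm_zero order_refl)

text \<open>The difference w of the two vectors is orthogonal to K, so by Pythagoras no point of K
  is closer to w than 0 is; density then forces w = 0. This is how vectors given only by weak
  formulas are identified later.\<close>

lemma ip_dense_eq:
  assumes K: "K \<subseteq> C" "hdense H K" and x: "x \<in> C" and y: "y \<in> C"
    and eq: "\<And>z. z \<in> K \<Longrightarrow> ip z x = ip z y"
  shows "x = y"
proof (rule ccontr)
  assume "x \<noteq> y"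
  define w where "w = x - y"
  have w: "w \<in> C" "nm w > 0"
    using x y \<open>x \<noteq> y\<close> nm_eq_0[of w] nm_nonneg[of w] by (auto simp: w_def order_less_le)
  obtain d where d: "d \<in> K" "nm (w - d) < nm w"
    using K w unfolding hdense_def by blast
  then have dC: "d \<in> C" using K by blast
  have "ip d w = 0" using eq[OF d(1)] ip_diff_right[OF dC x y] by (simp add: w_def)
  then have "ip w d = 0" using inner_commute[OF w(1) dC] by simp
  then have "(nm (w - d))\<^sup>2 \<ge> (nm w)\<^sup>2"
    using nm_sq_diff[OF w(1) dC] by simp
  moreover have "(nm (w - d))\<^sup>2 < (nm w)\<^sup>2"
    using d(2) nm_nonneg[OF diff_C[OF w(1) dC]] by (intro power_strict_mono) auto
  ultimately show False by simp
qed

end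

section \<open>Projection valued measures\<close>

text \<open>Carries a comparison of measures over to integrals by induction on the integrand,
  without forming the sum of \<open>M1\<close> and \<open>M2\<close>. It is meant for the spectral
  measures of x + y, x and y.\<close>

lemma nn_integral_le_if_emeasure_le:
  assumes sets: "sets M1 = sets N" "sets M2 = sets N"
    and le: "\<And>A. A \<in> sets N \<Longrightarrow> emeasure N A \<le> c * emeasure M1 A + c * emeasure M2 A"
    and f: "f \<in> borel_measurable N"
  shows "(\<integral>\<^sup>+x. f x \<partial>N) \<le> c * (\<integral>\<^sup>+x. f x \<partial>M1) + c * (\<integral>\<^sup>+x. f x \<partial>M2)"
  using f
proof (induction rule: borel_measurable_induct)
  case (cong f g)
  have "(\<integral>\<^sup>+x. f x \<partial>K) = (\<integral>\<^sup>+x. g x \<partial>K)" if "sets K = sets N" for K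
    using cong(3) sets_eq_imp_space_eq[OF that] by (intro nn_integral_cong) auto
  then show ?case using cong(4) sets by simp
next
  case (set A)
  then show ?case using le sets by simp
next
  case (mult u d)
  have "(\<integral>\<^sup>+x. d * u x \<partial>K) = d * (\<integral>\<^sup>+x. u x \<partial>K)" if "sets K = sets N" for K
    using mult(2) that measurable_cong_sets[OF that refl] by (intro nn_integral_cmult) auto
  then show ?case using mult_left_mono[OF mult(4), of d] sets by (simp add: algebra_simps)
next
  case (add u v)
  have "(\<integral>\<^sup>+x. v x + u x \<partial>K) = (\<integral>\<^sup>+x. v x \<partial>K) + (\<integral>\<^sup>+x. u x \<partial>K)" if "sets K = sets N" for K
    using add.hyps that measurable_cong_sets[OF that refl] by (intro nn_integral_add) auto
  moreover have "(\<integral>\<^sup>+x. v x \<partial>N) + (\<integral>\<^sup>+x. u x \<partial>N) \<le> (c * (\<integral>\<^sup>+x. v x \<partial>M1) + c * (\<integral>\<^sup>+x. v x \<partial>M2))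
      + (c * (\<integral>\<^sup>+x. u x \<partial>M1) + c * (\<integral>\<^sup>+x. u x \<partial>M2))"
    by (rule add_mono; fact)
  ultimately show ?case using sets by (simp add: algebra_simps)
next
  case (seq U)
  have "(\<integral>\<^sup>+x. (SUP i. U i) x \<partial>N) = (SUP i. \<integral>\<^sup>+x. U i x \<partial>N)"
    using seq by (simp add: nn_integral_monotone_convergence_SUP image_comp)
  also have "\<dots> \<le> c * (\<integral>\<^sup>+x. (SUP i. U i) x \<partial>M1) + c * (\<integral>\<^sup>+x. (SUP i. U i) x \<partial>M2)"
  proof (rule SUP_least)
    fix i
    have "(\<integral>\<^sup>+x. U i x \<partial>K) \<le> (\<integral>\<^sup>+x. (SUP i. U i) x \<partial>K)" for K
      by (intro nn_integral_mono) (metis SUP_apply SUP_upper UNIV_I)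
    moreover have "(\<integral>\<^sup>+x. U i x \<partial>N) \<le> c * (\<integral>\<^sup>+x. U i x \<partial>M1) + c * (\<integral>\<^sup>+x. U i x \<partial>M2)"
      by fact
    ultimately show "(\<integral>\<^sup>+x. U i x \<partial>N) \<le> c * (\<integral>\<^sup>+x. (SUP i. U i) x \<partial>M1) + c * (\<integral>\<^sup>+x. (SUP i. U i) x \<partial>M2)"
      by (meson add_mono mult_left_mono order_trans zero_le)
  qed
  finally show ?case .
qed

locale pvm = complete_inner_space H
  for H :: "('v::complex_vector) hspace" +
  fixes E :: "real set \<Rightarrow> 'v \<Rightarrow> 'v"
  assumes pvm: "projection_valued_measure H E"
begin

abbreviation "\<nu> \<equiv> spectral_measure H E"

lemma E_projection: "A \<in> sets borel \<Longrightarrow> orthogonal_projection H (E A)"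
  using pvm by (auto simp: projection_valued_measure_def)

lemma
  assumes "A \<in> sets borel" "x \<in> C"
  shows E_C [simp, intro]: "E A x \<in> C"
    and E_idem: "E A (E A x) = E A x"
    and E_scale: "E A (c *\<^sub>C x) = c *\<^sub>C E A x"
    and E_add: "y \<in> C \<Longrightarrow> E A (x + y) = E A x + E A y"
    and E_sym: "y \<in> C \<Longrightarrow> ip (E A x) y = ip x (E A y)"
    and E_Int: "B \<in> sets borel \<Longrightarrow> E (A \<inter> B) x = E A (E B x)"
  using E_projection[OF assms(1)] assms pvm
  by (auto simp: orthogonal_projection_def projection_valued_measure_def)

lemma E_UNIV: "x \<in> C \<Longrightarrow> E UNIV x = x"
  using pvm by (auto simp: projection_valued_measure_def)

lemma E_countably_additive:
  assumes "range \<sigma> \<subseteq> sets borel" "disjoint_family \<sigma>" "x \<in> C"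
  shows "hlim H (\<lambda>n. \<Sum>i<n. E (\<sigma> i) x) (E (\<Union>i. \<sigma> i) x)"
  using pvm assms by (auto simp: projection_valued_measure_def)

lemma nm_E_sq:
  assumes "A \<in> sets borel" "x \<in> C" shows "(nm (E A x))\<^sup>2 = Re (ip x (E A x))"
  using E_sym[of A x "E A x"] assms by (simp add: nm_sq E_idem)

lemma ip_sum_right:
  assumes "z \<in> C" "\<And>i. i \<in> I \<Longrightarrow> f i \<in> C"
  shows "ip z (sum f I) = (\<Sum>i\<in>I. ip z (f i))"
  using assms(2)
proof (induction I rule: infinite_finite_induct)
  case (insert i I)
  then show ?case using sum_C[of I f] assms(1) by (simp add: inner_add_right)
qed (use assms(1) in auto)

text \<open>Countable additivity for the constant family of empty sets says that the multiples n e
  of e = \<open>E {} x\<close> converge. Consecutive multiples differ by e, so the limit forces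
  \<open>ip e e = 0\<close>.\<close>

lemma E_empty: "x \<in> C \<Longrightarrow> E {} x = 0"
proof -
  assume x: "x \<in> C"
  define e where "e = E {} x"
  have e: "e \<in> C" using x by (simp add: e_def)
  have "hlim H (\<lambda>n. \<Sum>i<n. e) e"
    using E_countably_additive[of "\<lambda>_. {}" x] x by (simp add: disjoint_family_on_def e_def)
  then have "(\<lambda>n. ip e (\<Sum>i<n. e)) \<longlonglongrightarrow> ip e e"
    by (intro hlim_ip) (auto intro: sum_C e)
  then have "(\<lambda>n. of_nat n * ip e e) \<longlonglongrightarrow> ip e e"
    using e by (simp add: ip_sum_right del: sum_constant) simp
  then have "(\<lambda>n. of_nat (Suc n) * ip e e - of_nat n * ip e e) \<longlonglongrightarrow> ip e e - ip e e"
    by (intro tendsto_diff LIMSEQ_Suc) 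
  then have "ip e e = 0"
    by (simp add: algebra_simps LIMSEQ_const_iff)
  then have "nm e = 0" using ip_self[OF e] by simp
  then show ?thesis using e nm_eq_0 by (simp add: e_def)
qed

lemma sets_\<nu> [simp, measurable_cong]: "sets (\<nu> x) = sets borel"
  using sets.sigma_sets_eq[of "borel :: real measure"]
  by (simp add: spectral_measure_def sets_measure_of_conv)

lemma space_\<nu> [simp]: "space (\<nu> x) = UNIV"
  using sets_eq_imp_space_eq[OF sets_\<nu>] by simp

text \<open>\<open>measure_of\<close> takes the intended values only once the set function is known
  to be countably additive. Since the squared norm of \<open>E A x\<close> is
  \<open>ip x (E A x)\<close>, this is strong convergence of the partial sums tested against
  x.\<close>

lemma emeasure_\<nu>:
  assumes A: "A \<in> sets borel" and x: "x \<in> C"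
  shows "emeasure (\<nu> x) A = ennreal ((nm (E A x))\<^sup>2)"
proof (rule emeasure_measure_of[OF spectral_measure_def])
  show "positive (sets (\<nu> x)) (\<lambda>\<sigma>. ennreal ((nm (E \<sigma> x))\<^sup>2))"
    using E_empty[OF x] by (simp add: positive_def)
  show "countably_additive (sets (\<nu> x)) (\<lambda>\<sigma>. ennreal ((nm (E \<sigma> x))\<^sup>2))"
  proof (rule countably_additiveI)
    fix F :: "nat \<Rightarrow> real set"
    assume F: "range F \<subseteq> sets (\<nu> x)" "disjoint_family F"
    have F': "F i \<in> sets borel" for i using F(1) by auto
    have U: "(\<Union>i. F i) \<in> sets borel" using F' by blast
    have "(\<lambda>n. ip x (\<Sum>i<n. E (F i) x)) \<longlonglongrightarrow> ip x (E (\<Union>i. F i) x)"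
      using F F' U x by (intro hlim_ip E_countably_additive) (auto intro!: sum_C)
    then have "(\<lambda>n. \<Sum>i<n. (nm (E (F i) x))\<^sup>2) \<longlonglongrightarrow> (nm (E (\<Union>i. F i) x))\<^sup>2"
      using tendsto_Re x F' U by (fastforce simp: ip_sum_right nm_E_sq)
    then have "(\<lambda>i. (nm (E (F i) x))\<^sup>2) sums (nm (E (\<Union>i. F i) x))\<^sup>2"
      by (simp add: sums_def)
    then show "(\<Sum>i. ennreal ((nm (E (F i) x))\<^sup>2)) = ennreal ((nm (E (\<Union>i. F i) x))\<^sup>2)"
      by (intro suminf_ennreal_eq) auto
  qed
qed (use A in auto)

lemma finite_\<nu>: "x \<in> C \<Longrightarrow> finite_measure (\<nu> x)"
  by (rule finite_measureI) (simp add: emeasure_\<nu>)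

lemma measure_\<nu>: "A \<in> sets borel \<Longrightarrow> x \<in> C \<Longrightarrow> measure (\<nu> x) A = (nm (E A x))\<^sup>2"
  by (simp add: measure_def emeasure_\<nu>)

lemma \<nu>_E:
  assumes B: "B \<in> sets borel" and x: "x \<in> C"
  shows "\<nu> (E B x) = density (\<nu> x) (indicator B)"
proof (rule measure_eqI)
  fix A assume "A \<in> sets (\<nu> (E B x))"
  then have A: "A \<in> sets borel" by simp
  then show "emeasure (\<nu> (E B x)) A = emeasure (density (\<nu> x) (indicator B)) A"
    using B x by (subst emeasure_density)
      (auto simp: emeasure_\<nu> E_Int[symmetric] indicator_inter_arith[symmetric] Int_commute
        simp flip: indicator_inter_arith)
qed simp

lemma \<nu>_scale:
  assumes x: "x \<in> C"
  shows "\<nu> (c *\<^sub>C x) = density (\<nu> x) (\<lambda>_. ennreal ((cmod c)\<^sup>2))"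
proof (rule measure_eqI)
  fix A assume "A \<in> sets (\<nu> (c *\<^sub>C x))"
  then have A: "A \<in> sets borel" by simp
  then show "emeasure (\<nu> (c *\<^sub>C x)) A = emeasure (density (\<nu> x) (\<lambda>_. ennreal ((cmod c)\<^sup>2))) A"
    using x by (simp add: emeasure_density nn_integral_cmult_indicator emeasure_\<nu> E_scale nm_scale
        power_mult_distrib ennreal_mult)
qed simp

lemma nn_integral_\<nu>_add:
  assumes x: "x \<in> C" and y: "y \<in> C" and f: "f \<in> borel_measurable borel"
  shows "(\<integral>\<^sup>+t. f t \<partial>\<nu> (x + y)) \<le> 2 * (\<integral>\<^sup>+t. f t \<partial>\<nu> x) + 2 * (\<integral>\<^sup>+t. f t \<partial>\<nu> y)"
proof (rule nn_integral_le_if_emeasure_le)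
  fix A assume "A \<in> sets (\<nu> (x + y))"
  then have A: "A \<in> sets borel" by simp
  have "ennreal ((nm (E A x + E A y))\<^sup>2) \<le> ennreal (2 * (nm (E A x))\<^sup>2 + 2 * (nm (E A y))\<^sup>2)"
    using nm_sq_add_le[of "E A x" "E A y"] A x y by (intro ennreal_leI) auto
  then show "emeasure (\<nu> (x + y)) A \<le> 2 * emeasure (\<nu> x) A + 2 * emeasure (\<nu> y) A"
    using A x y by (simp add: emeasure_\<nu> E_add ennreal_plus ennreal_mult)
qed (use f in auto)

lemma nn_integral_\<nu>_scale:
  assumes "x \<in> C" "f \<in> borel_measurable borel"
  shows "(\<integral>\<^sup>+t. f t \<partial>\<nu> (c *\<^sub>C x)) = ennreal ((cmod c)\<^sup>2) * (\<integral>\<^sup>+t. f t \<partial>\<nu> x)"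
  using assms by (simp add: \<nu>_scale nn_integral_density nn_integral_cmult)

lemma nn_integral_\<nu>_E:
  assumes "x \<in> C" "B \<in> sets borel" "f \<in> borel_measurable borel"
  shows "(\<integral>\<^sup>+t. f t \<partial>\<nu> (E B x)) = (\<integral>\<^sup>+t. f t * indicator B t \<partial>\<nu> x)"
  using assms by (simp add: \<nu>_E nn_integral_density mult.commute)

lemma nn_integral_\<nu>_zero: "(\<integral>\<^sup>+t. f t \<partial>\<nu> 0) = 0"
proof -
  have "emeasure (\<nu> 0) UNIV = 0" by (simp add: emeasure_\<nu> E_UNIV)
  then have "AE t in \<nu> 0. False" by (subst AE_iff_null) (auto simp: null_sets_def)
  then have "(\<integral>\<^sup>+t. f t \<partial>\<nu> 0) = (\<integral>\<^sup>+t. 0 \<partial>\<nu> 0)" by (intro nn_integral_cong_AE) auto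
  then show ?thesis by simp
qed

section \<open>Domains of spectral integrals and spectral cut-offs\<close>

abbreviation "dm \<equiv> spectral_dom H E"

lemma dm_iff:
  assumes f: "f \<in> borel_measurable borel"
  shows "x \<in> dm f \<longleftrightarrow> x \<in> C \<and> (\<integral>\<^sup>+t. ennreal ((f t)\<^sup>2) \<partial>\<nu> x) < \<infinity>"
  using f by (auto simp: spectral_dom_def integrable_iff_bounded)

lemma dm_C: "x \<in> dm f \<Longrightarrow> x \<in> C"
  by (simp add: spectral_dom_def)

lemma dm_subspace:
  assumes [measurable]: "f \<in> borel_measurable borel"
  shows "csubspace (dm f)"
proof (rule complex_vector.subspaceI)
  show "0 \<in> dm f" by (simp add: dm_iff nn_integral_\<nu>_zero)
next
  fix x y assume "x \<in> dm f" "y \<in> dm f"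
  moreover then have "(\<integral>\<^sup>+t. ennreal ((f t)\<^sup>2) \<partial>\<nu> (x + y)) < \<infinity>"
    by (intro order_le_less_trans[OF nn_integral_\<nu>_add])
       (auto simp: dm_iff ennreal_mult_less_top)
  ultimately show "x + y \<in> dm f" by (simp add: dm_iff)
next
  fix c x assume "x \<in> dm f"
  then show "c *\<^sub>C x \<in> dm f"
    by (auto simp: dm_iff nn_integral_\<nu>_scale ennreal_mult_less_top)
qed

lemma dm_E:
  assumes [measurable]: "f \<in> borel_measurable borel" "B \<in> sets borel" and x: "x \<in> dm f"
  shows "E B x \<in> dm f"
proof -
  have "(\<integral>\<^sup>+t. ennreal ((f t)\<^sup>2) * indicator B t \<partial>\<nu> x) \<le> (\<integral>\<^sup>+t. ennreal ((f t)\<^sup>2) \<partial>\<nu> x)"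
    by (intro nn_integral_mono) (auto simp: indicator_def)
  then show ?thesis
    using x by (auto simp: dm_iff nn_integral_\<nu>_E intro: order_le_less_trans)
qed

text \<open>On the range of \<open>E (cut f n)\<close> the operator of f is bounded by n, and these
  sets increase to the whole line. They serve for density of the domain, for the adjoint, and for
  the core argument.\<close>

definition cut :: "(real \<Rightarrow> real) \<Rightarrow> nat \<Rightarrow> real set"
  where "cut f n = {t. \<bar>f t\<bar> \<le> real n}"

lemma cut_borel [measurable]: "f \<in> borel_measurable borel \<Longrightarrow> cut f n \<in> sets borel"
  unfolding cut_def by measurable

lemma cut_dm:
  assumes [measurable]: "f \<in> borel_measurable borel" and x: "x \<in> C"
  shows "E (cut f n) x \<in> dm f"
proof -
  interpret finite_measure "\<nu> x" using x by (rule finite_\<nu>)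
  have "(\<integral>\<^sup>+t. ennreal ((f t)\<^sup>2) * indicator (cut f n) t \<partial>\<nu> x)
     \<le> (\<integral>\<^sup>+t. ennreal ((real n)\<^sup>2) \<partial>\<nu> x)"
    by (intro nn_integral_mono) (auto simp: indicator_def cut_def power2_le_iff_abs_le)
  also have "\<dots> < \<infinity>"
    using x by (simp add: ennreal_mult_less_top emeasure_\<nu>)
  finally show ?thesis using x by (simp add: dm_iff nn_integral_\<nu>_E)
qed

text \<open>Finite additivity of E is recovered from the scalar measure: \<open>E A x\<close> and
  \<open>E (- A) x\<close> are orthogonal, so the squared norm of the defect can be expressed by
  values of \<open>\<nu> x\<close>, where it cancels.\<close>

lemma E_compl:
  assumes [measurable]: "A \<in> sets borel" and x: "x \<in> C"
  shows "x - E A x = E (- A) x"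
proof -
  have A': "- A \<in> sets borel" by measurable
  have "E A (E (-A) x) = 0" using E_Int[of A x "-A"] x A' E_empty by simp
  then have "ip (E A x) (E (-A) x) = 0" using x A' E_sym[of A x "E (-A) x"] by simp
  interpret finite_measure "\<nu> x" using x by (rule finite_\<nu>)
  have m: "measure (\<nu> x) A + measure (\<nu> x) (-A) = measure (\<nu> x) UNIV"
    using finite_measure_compl[of A] by (simp add: Compl_eq_Diff_UNIV)
  have "(nm (x - E A x - E (-A) x))\<^sup>2 =
     (nm (x - E A x))\<^sup>2 + (nm (E (-A) x))\<^sup>2 - 2 * Re (ip x (E (-A) x) - ip (E A x) (E (-A) x))"
    using x A' nm_sq_diff[of "x - E A x" "E (-A) x"] by (simp add: ip_simps)
  also have "\<dots> = (nm x)\<^sup>2 + (nm (E A x))\<^sup>2 - 2 * (nm (E A x))\<^sup>2 + (nm (E (-A) x))\<^sup>2 - 2 * (nm (E (-A) x))\<^sup>2"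
    using x A' \<open>ip (E A x) (E (-A) x) = 0\<close> by (simp add: nm_sq_diff nm_E_sq)
  also have "\<dots> = 0"
    using m x A' by (simp add: measure_\<nu> E_UNIV)
  finally have "nm (x - E A x - E (-A) x) = 0" by simp
  then show ?thesis using x A' nm_eq_0[of "x - E A x - E (-A) x"] by simp
qed

lemma E_Un:
  assumes A: "A \<in> sets borel" and B: "B \<in> sets borel" and dis: "A \<inter> B = {}" and x: "x \<in> C"
  shows "E (A \<union> B) x = E A x + E B x"
proof -
  have AB: "A \<union> B \<in> sets borel" and A': "- A \<in> sets borel" using A B by auto
  have "E (A \<union> B) x - E A (E (A \<union> B) x) = E (- A) (E (A \<union> B) x)"
    using A AB x by (intro E_compl) auto
  moreover have "E A (E (A \<union> B) x) = E A x"
    using E_Int[OF A x AB] by (simp add: Int_absorb2)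
  moreover have "E (- A) (E (A \<union> B) x) = E B x"
    using E_Int[OF A' x AB] dis by (simp add: Int_Un_distrib) (metis Diff_eq Diff_triv Int_commute)
  ultimately show ?thesis by (simp add: algebra_simps)
qed

lemma E_sum:
  fixes \<sigma> :: "nat \<Rightarrow> real set"
  assumes "\<And>i. \<sigma> i \<in> sets borel" "disjoint_family \<sigma>" "x \<in> C"
  shows "(\<Sum>i<n. E (\<sigma> i) x) = E (\<Union>i<n. \<sigma> i) x"
proof (induction n)
  case (Suc n)
  have "\<sigma> i \<inter> \<sigma> n = {}" if "i < n" for i
    using assms(2) that by (simp add: disjoint_family_on_def)
  then have "(\<Union>i<n. \<sigma> i) \<inter> \<sigma> n = {}"
    by blast
  then show ?case
    using E_Un[of "\<Union>i<n. \<sigma> i" "\<sigma> n" x] assms Suc by (simp add: lessThan_Suc Un_commute)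
qed (use assms(3) in \<open>simp add: E_empty\<close>)

text \<open>The remainder is \<open>E (- cut f n) x\<close>, so this is dominated convergence with
  majorant g. The weight g is independent of f: g = 1 gives convergence in the Hilbert norm, g = 1 +
  |t| convergence in the spectral norm.\<close>

lemma cut_tail:
  assumes [measurable]: "f \<in> borel_measurable borel" "g \<in> borel_measurable borel" and x: "x \<in> C"
    and fin: "(\<integral>\<^sup>+t. g t \<partial>\<nu> x) < \<infinity>"
  shows "(\<lambda>n. \<integral>\<^sup>+t. g t \<partial>\<nu> (x - E (cut f n) x)) \<longlonglongrightarrow> 0"
proof -
  have [measurable]: "- cut f n \<in> sets borel" for n by measurable
  have "(\<lambda>n. \<integral>\<^sup>+t. g t * indicator (- cut f n) t \<partial>\<nu> x) \<longlonglongrightarrow> (\<integral>\<^sup>+t. 0 \<partial>\<nu> x)"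
  proof (rule nn_integral_dominated_convergence[where w = g])
    show "AE t in \<nu> x. (\<lambda>n. g t * indicator (- cut f n) t) \<longlonglongrightarrow> 0"
    proof (rule AE_I2, rule tendsto_eventually)
      fix t
      obtain N where "\<bar>f t\<bar> \<le> real N" using real_arch_simple by blast
      then show "\<forall>\<^sub>F n in sequentially. g t * indicator (- cut f n) t = 0"
        by (intro eventually_sequentiallyI[of N]) (auto simp: cut_def indicator_def)
    qed
    show "AE t in \<nu> x. g t * indicator (- cut f n) t \<le> g t" for n
      by (auto simp: indicator_def)
  qed (use fin in auto)
  then show ?thesis
    using x by (simp add: E_compl nn_integral_\<nu>_E)
qed

lemma nn_integral_\<nu>_1: "x \<in> C \<Longrightarrow> (\<integral>\<^sup>+t. 1 \<partial>\<nu> x) = ennreal ((nm x)\<^sup>2)"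
  by (simp add: emeasure_\<nu> E_UNIV)

lemma cut_tendsto:
  assumes [measurable]: "f \<in> borel_measurable borel" and x: "x \<in> C"
  shows "hlim H (\<lambda>n. E (cut f n) x) x"
proof -
  have "(\<lambda>n. \<integral>\<^sup>+t. 1 \<partial>\<nu> (x - E (cut f n) x)) \<longlonglongrightarrow> 0"
    using x by (intro cut_tail) (auto simp: emeasure_\<nu>)
  then have "(\<lambda>n. ennreal ((nm (x - E (cut f n) x))\<^sup>2)) \<longlonglongrightarrow> ennreal 0"
    using x by (simp add: nn_integral_\<nu>_1 del: nn_integral_const)
  then have "(\<lambda>n. (nm (x - E (cut f n) x))\<^sup>2) \<longlonglongrightarrow> 0"
    by (subst (asm) tendsto_ennreal_iff) auto
  then have "(\<lambda>n. sqrt ((nm (x - E (cut f n) x))\<^sup>2)) \<longlonglongrightarrow> sqrt 0"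
    by (rule tendsto_real_sqrt)
  then show ?thesis
    using x by (simp add: hlim_def nm_minus_commute)
qed

lemma dm_dense:
  assumes f [measurable]: "f \<in> borel_measurable borel"
  shows "hdense H (dm f)"
  unfolding hdense_def
proof (intro conjI ballI allI impI)
  fix x and e :: real assume x: "x \<in> C" and e: "e > 0"
  have "\<forall>\<^sub>F n in sequentially. nm (E (cut f n) x - x) < e"
    using cut_tendsto[OF f x] e unfolding hlim_def by (rule order_tendstoD)
  then obtain n where "nm (E (cut f n) x - x) < e"
    by (auto simp: eventually_sequentially)
  then show "\<exists>d\<in>dm f. nm (x - d) < e"
    using x cut_dm[OF f x, of n] nm_minus_commute[of x "E (cut f n) x"]
    by (intro bexI[of _ "E (cut f n) x"]) auto
qed (auto simp: dm_C)

end

section \<open>Step functions and their operators\<close>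

context pvm
begin

text \<open>
  The sets \<open>A\<close> need not be disjoint: \<open>\<langle>E(A) x, E(B) x\<rangle> = \<nu>\<^sub>x(A \<inter> B)\<close> makes \<open>g \<mapsto> G x\<close> isometric anyway.
\<close>

inductive step_op :: "(real \<Rightarrow> real) \<Rightarrow> ('v \<Rightarrow> 'v) \<Rightarrow> bool"
  where
    base: "A \<in> sets borel \<Longrightarrow> step_op (indicator A) (E A)"
  | add: "step_op g G \<Longrightarrow> step_op h K \<Longrightarrow> step_op (\<lambda>t. g t + h t) (\<lambda>x. G x + K x)"
  | scale: "step_op g G \<Longrightarrow> step_op (\<lambda>t. c * g t) (\<lambda>x. complex_of_real c *\<^sub>C G x)"

lemma step_op_measurable [measurable_dest]: "step_op g G \<Longrightarrow> g \<in> borel_measurable borel"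
  by (induction rule: step_op.induct) auto

lemma step_op_bounded: "step_op g G \<Longrightarrow> \<exists>b. \<forall>t. \<bar>g t\<bar> \<le> b"
proof (induction rule: step_op.induct)
  case (base A)
  show ?case by (intro exI[of _ 1]) (auto simp: indicator_def)
next
  case (add g G h K)
  then obtain b c where "\<forall>t. \<bar>g t\<bar> \<le> b" "\<forall>t. \<bar>h t\<bar> \<le> c" by blast
  then show ?case by (intro exI[of _ "b + c"]) (metis abs_triangle_ineq add_mono order_trans)
next
  case (scale g G c)
  then obtain b where "\<forall>t. \<bar>g t\<bar> \<le> b" by blast
  then show ?case by (intro exI[of _ "\<bar>c\<bar> * b"]) (auto simp: abs_mult mult_left_mono)
qed

lemma integrable_\<nu>_bounded:
  assumes "x \<in> C" "g \<in> borel_measurable borel" "\<forall>t. \<bar>g t\<bar> \<le> b"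
  shows "integrable (\<nu> x) (g :: real \<Rightarrow> real)"
proof -
  interpret finite_measure "\<nu> x" using assms(1) by (rule finite_\<nu>)
  show ?thesis using assms(2,3) by (intro integrable_const_bound[of _ b]) auto
qed

lemma step_op_integrable:
  assumes "step_op g G" "x \<in> C" shows "integrable (\<nu> x) g"
proof -
  obtain b where "\<forall>t. \<bar>g t\<bar> \<le> b" using step_op_bounded[OF assms(1)] by blast
  then show ?thesis
    by (rule integrable_\<nu>_bounded[OF assms(2) step_op_measurable[OF assms(1)]])
qed

lemma step_op_integrable_mult:
  assumes "step_op g G" "step_op h K" "x \<in> C" shows "integrable (\<nu> x) (\<lambda>t. g t * h t)"
proof -
  obtain b where b: "\<forall>t. \<bar>g t\<bar> \<le> b" using step_op_bounded assms by blast
  obtain c where c: "\<forall>t. \<bar>h t\<bar> \<le> c" using step_op_bounded assms by blast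
  have "(\<lambda>t. g t * h t) \<in> borel_measurable borel"
    using assms(1,2) by measurable
  moreover have "\<forall>t. \<bar>g t * h t\<bar> \<le> b * c"
    using b c by (auto simp: abs_mult intro!: mult_mono order_trans[OF abs_ge_zero])
  ultimately show ?thesis
    by (rule integrable_\<nu>_bounded[OF assms(3)])
qed

lemma step_op_C: "step_op g G \<Longrightarrow> x \<in> C \<Longrightarrow> G x \<in> C"
  by (induction rule: step_op.induct) auto

lemma step_op_sym:
  "step_op g G \<Longrightarrow> x \<in> C \<Longrightarrow> y \<in> C \<Longrightarrow> ip (G x) y = ip x (G y)"
  by (induction rule: step_op.induct) (auto simp: E_sym ip_simps step_op_C)

lemma step_op_E:
  "step_op g G \<Longrightarrow> B \<in> sets borel \<Longrightarrow> x \<in> C \<Longrightarrow> E B (G x) = G (E B x)"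
proof (induction rule: step_op.induct)
  case (base A)
  then show ?case using E_Int[of A x B] E_Int[of B x A] by (simp add: Int_commute)
qed (auto simp: E_add E_scale step_op_C)

text \<open>Both sides are real bilinear in the two step functions, hence an induction nested in an
  induction. Equal arguments give the isometry; the real part loses nothing there.\<close>

lemma step_op_inner:
  assumes "step_op g G" "step_op h K" "x \<in> C"
  shows "Re (ip (G x) (K x)) = (\<integral>t. g t * h t \<partial>\<nu> x)"
  using assms
proof (induction arbitrary: h K rule: step_op.induct)
  case (base A)
  have "Re (ip (E A x) (K x)) = (\<integral>t. indicator A t * h t \<partial>\<nu> x)"
    using base(2,3,1)
  proof (induction rule: step_op.induct)
    case (base B)
    have "ip (E A x) (E B x) = ip x (E (A \<inter> B) x)"
      using base by (simp add: E_sym E_Int)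
    then show ?case using base nm_E_sq[of "A \<inter> B" x]
      by (simp add: measure_\<nu> flip: indicator_inter_arith)
  next
    case (add g G h K)
    then show ?case
      using step_op_integrable_mult[OF step_op.base[OF add(6)]]
      by (simp add: ip_simps step_op_C distrib_left)
  next
    case (scale g G c)
    then show ?case by (simp add: ip_simps step_op_C mult.left_commute)
  qed
  then show ?case .
next
  case (add g G h' K')
  then show ?case
    using step_op_integrable_mult by (simp add: ip_simps step_op_C distrib_right)
next
  case (scale g G c)
  then show ?case by (simp add: ip_simps step_op_C mult.assoc)
qed

text \<open>Step operators satisfy the defining formula of \<open>spectral_integral\<close>; both
  sides of it pass to the limit in \<open>spectral_op_exists\<close>.\<close>

lemma step_op_polar:
  assumes "step_op g G" "x \<in> C" "z \<in> C"
  shows "ip z (G x) = (1/4) * (\<Sum>k<4::nat. \<i> ^ k *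
          complex_of_real (\<integral>t. g t \<partial>\<nu> (x + \<i> ^ k *\<^sub>C z)))"
  using assms
proof (induction rule: step_op.induct)
  case (base A)
  have "ip z (E A x) = ip (E A z) (E A x)" using base by (simp add: E_sym E_idem)
  then show ?case
    using base polarisation[of "E A x" "E A z"] by (simp add: measure_\<nu> E_add E_scale)
next
  case (add g G h K)
  then show ?case
    by (simp add: ip_simps step_op_C step_op_integrable[OF add(1)] step_op_integrable[OF add(2)]
        ring_distribs sum.distrib) (simp add: field_simps)
next
  case (scale g G c)
  then show ?case
    by (simp add: ip_simps step_op_C sum_distrib_left algebra_simps)
qed

lemma step_op_zero: "step_op (\<lambda>t. 0) (\<lambda>x. 0)"
  using step_op.scale[OF step_op.base, of UNIV 0] by simp

lemma step_op_sum:
  assumes "finite I" "\<And>i. i \<in> I \<Longrightarrow> A i \<in> sets borel"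
  shows "step_op (\<lambda>t. \<Sum>i\<in>I. c i * indicator (A i) t) (\<lambda>x. \<Sum>i\<in>I. complex_of_real (c i) *\<^sub>C E (A i) x)"
  using assms
proof (induction I rule: finite_induct)
  case (insert i I)
  then show ?case
    using step_op.add[OF step_op.scale[OF step_op.base, of "A i" "c i"] insert.IH] insert.prems
    by (simp only: sum.insert[OF insert.hyps] insertI1 insertI2)
qed (use step_op_zero in simp)

lemma step_op_simple:
  assumes "simple_function borel (g :: real \<Rightarrow> real)"
  shows "\<exists>G. step_op g G"
proof -
  have fin: "finite (range g)" and m: "\<And>c. g -` {c} \<in> sets borel"
    using assms by (auto simp: simple_function_def)
      (metis Int_UNIV_right assms simple_functionD(2) space_borel)
  have "g t = (\<Sum>c\<in>range g. c * indicator (g -` {c}) t)" for t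
  proof -
    have "(\<Sum>c\<in>range g. c * indicator (g -` {c}) t) = (\<Sum>c\<in>range g. if c = g t then c else 0)"
      by (intro sum.cong) (auto simp: indicator_def)
    then show ?thesis using fin by (simp add: sum.delta)
  qed
  then show ?thesis
    using step_op_sum[OF fin, of "\<lambda>c. g -` {c}" "\<lambda>c. c"] m by (metis (no_types, lifting) ext)
qed

text \<open>The bound by 2 |f| makes a multiple of f^2 a majorant for every spectral measure at
  once, so a single sequence serves all x in \<open>dm f\<close>.\<close>

lemma step_op_approx:
  assumes "f \<in> borel_measurable borel"
  obtains g G where "\<And>n. step_op (g n) (G n)" "\<And>t. (\<lambda>n. g n t) \<longlonglongrightarrow> f t"
    "\<And>n t. \<bar>g n t\<bar> \<le> 2 * \<bar>f t\<bar>"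
proof -
  obtain g where g: "\<And>i. simple_function borel (g i)" "\<And>t. (\<lambda>i. g i t) \<longlonglongrightarrow> f t"
      "\<And>i t. dist (g i t) 0 \<le> 2 * dist (f t) 0"
    using borel_measurable_implies_sequence_metric[OF assms, of 0] by auto
  obtain G where "\<And>i. step_op (g i) (G i)"
    using step_op_simple[OF g(1)] by metis
  then show ?thesis using that g by (auto simp: dist_real_def)
qed

lemma step_op_diff:
  assumes "step_op g G" "step_op h K"
  shows "step_op (\<lambda>t. g t - h t) (\<lambda>x. G x - K x)"
  using step_op.add[OF assms(1) step_op.scale[OF assms(2), of "-1"]]
  by (simp add: complex_vector.scale_minus_left scaleC_one)

section \<open>Limits of step operators on the domain of f\<close>

lemma dm_integrable:
  assumes "x \<in> dm f" shows "integrable (\<nu> x) (\<lambda>t. (f t)\<^sup>2)"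
  using assms by (simp add: spectral_dom_def)

text \<open>Spectral measures are finite, so square-integrable functions are integrable, here by |s|
  \<le> 1 + s^2. This keeps the Bochner integrals in \<open>spectral_integral\<close> away from
  their default value 0.\<close>

lemma integrable_from_dm:
  assumes [measurable]: "f \<in> borel_measurable borel" and x: "x \<in> dm f"
  shows "integrable (\<nu> x) f"
proof -
  interpret finite_measure "\<nu> x" using dm_C[OF x] by (rule finite_\<nu>)
  show ?thesis
  proof (rule Bochner_Integration.integrable_bound[of _ "\<lambda>t. 1 + (f t)\<^sup>2"])
    show "AE t in \<nu> x. norm (f t) \<le> norm (1 + (f t)\<^sup>2)"
    proof (rule AE_I2)
      fix t
      have "0 \<le> (\<bar>f t\<bar> - 1)\<^sup>2" "0 \<le> (f t)\<^sup>2" by auto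
      then show "norm (f t) \<le> norm (1 + (f t)\<^sup>2)"
        by (simp add: power2_eq_square algebra_simps)
    qed
  qed (use dm_integrable[OF x] in auto)
qed

text \<open>J x is the limit of \<open>G n x\<close>: since g n tends to f in the square mean for
  \<open>\<nu> x\<close>, the isometry of step operators makes this sequence Cauchy. Each of the
  five properties holds for step operators in a form that survives the limit.\<close>

lemma spectral_op_exists:
  assumes f [measurable]: "f \<in> borel_measurable borel"
  obtains J where
    "\<And>x. x \<in> dm f \<Longrightarrow> J x \<in> C"
    "\<And>x. x \<in> dm f \<Longrightarrow> (nm (J x))\<^sup>2 = (\<integral>t. (f t)\<^sup>2 \<partial>\<nu> x)"
    "\<And>x z. x \<in> dm f \<Longrightarrow> z \<in> dm f \<Longrightarrow> ip z (J x) = (1/4) * (\<Sum>k<4::nat. \<i> ^ k *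
          complex_of_real (\<integral>t. f t \<partial>\<nu> (x + \<i> ^ k *\<^sub>C z)))"
    "\<And>x A. x \<in> dm f \<Longrightarrow> A \<in> sets borel \<Longrightarrow> E A (J x) = J (E A x)"
    "\<And>x y. x \<in> dm f \<Longrightarrow> y \<in> dm f \<Longrightarrow> ip (J x) y = ip x (J y)"
proof -
  obtain g G where g: "\<And>n. step_op (g n) (G n)" and gf: "\<And>t. (\<lambda>n. g n t) \<longlonglongrightarrow> f t"
    and gb: "\<And>n t. \<bar>g n t\<bar> \<le> 2 * \<bar>f t\<bar>"
    using step_op_approx[OF f] by blast
  have gm [measurable]: "g n \<in> borel_measurable borel" for n
    using g step_op_measurable by blast
  have "\<exists>y\<in>C. hlim H (\<lambda>n. G n x) y" if x: "x \<in> dm f" for x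
  proof (rule complete)
    show "G n x \<in> C" for n using step_op_C[OF g dm_C[OF x]] .
    define a where "a n = (\<integral>t. (g n t - f t)\<^sup>2 \<partial>\<nu> x)" for n
    \<comment> \<open>The constant 9 is (2 + 1)^2, from |g n| \<le> 2 |f|.\<close>
    have sqb: "(g n t - f t)\<^sup>2 \<le> 9 * (f t)\<^sup>2" for n t
    proof -
      have "\<bar>g n t - f t\<bar> \<le> 3 * \<bar>f t\<bar>" using gb[of n t] by linarith
      then have "\<bar>g n t - f t\<bar>\<^sup>2 \<le> (3 * \<bar>f t\<bar>)\<^sup>2" by (intro power_mono) auto
      then show ?thesis by (simp add: power_mult_distrib)
    qed
    have int: "integrable (\<nu> x) (\<lambda>t. (g n t - f t)\<^sup>2)" for n
      by (rule Bochner_Integration.integrable_bound[of _ "\<lambda>t. 9 * (f t)\<^sup>2"])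
        (use dm_integrable[OF x] sqb in auto)
    have "(\<lambda>n. \<integral>t. (g n t - f t)\<^sup>2 \<partial>\<nu> x) \<longlonglongrightarrow> (\<integral>t. 0 \<partial>\<nu> x)"
    proof (rule integral_dominated_convergence[where w = "\<lambda>t. 9 * (f t)\<^sup>2"])
      have "(\<lambda>n. (g n t - f t)\<^sup>2) \<longlonglongrightarrow> (f t - f t)\<^sup>2" for t
        by (intro tendsto_intros gf)
      then show "AE t in \<nu> x. (\<lambda>n. (g n t - f t)\<^sup>2) \<longlonglongrightarrow> 0" by simp
      show "AE t in \<nu> x. norm ((g n t - f t)\<^sup>2) \<le> 9 * (f t)\<^sup>2" for n
        using sqb by simp
    qed (use dm_integrable[OF x] in simp_all)
    then have a0: "a \<longlonglongrightarrow> 0" by (simp add: a_def[abs_def])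
    have le: "(nm (G m x - G n x))\<^sup>2 \<le> 2 * a m + 2 * a n" for m n
    proof -
      have d: "step_op (\<lambda>t. g m t - g n t) (\<lambda>x. G m x - G n x)"
        by (rule step_op_diff[OF g g])
      have "(nm (G m x - G n x))\<^sup>2 = (\<integral>t. (g m t - g n t) * (g m t - g n t) \<partial>\<nu> x)"
        using step_op_inner[OF d d dm_C[OF x]] nm_sq[OF step_op_C[OF d dm_C[OF x]]] by simp
      also have "\<dots> \<le> (\<integral>t. 2 * (g m t - f t)\<^sup>2 + 2 * (g n t - f t)\<^sup>2 \<partial>\<nu> x)"
      proof (rule integral_mono)
        show "integrable (\<nu> x) (\<lambda>t. (g m t - g n t) * (g m t - g n t))"
          using step_op_integrable_mult[OF d d dm_C[OF x]] .
        fix t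
        \<comment> \<open>With p = g m t - f t and q = g n t - f t, dropping (p + q)^2 from the
          parallelogram identity leaves (p - q)^2 \<le> 2 p^2 + 2 q^2.\<close>
        have "0 \<le> ((g m t - f t) + (g n t - f t))\<^sup>2" by simp
        then show "(g m t - g n t) * (g m t - g n t) \<le> 2 * (g m t - f t)\<^sup>2 + 2 * (g n t - f t)\<^sup>2"
          by (simp add: power2_eq_square algebra_simps)
      qed (use int in auto)
      also have "\<dots> = 2 * a m + 2 * a n"
        using int by (simp add: a_def)
      finally show ?thesis .
    qed
    show "\<forall>e>0. \<exists>N. \<forall>m\<ge>N. \<forall>n\<ge>N. nm (G m x - G n x) < e"
    proof (intro allI impI)
      \<comment> \<open>Each a n is pushed below e^2 / 4, so that the bound 2 a m + 2 a n in
        \<open>le\<close> is below e^2.\<close>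
      fix e :: real assume e: "e > 0"
      have "\<forall>\<^sub>F n in sequentially. a n < e\<^sup>2 / 4"
        using a0 e by (intro order_tendstoD) auto
      then obtain N where N: "\<And>n. n \<ge> N \<Longrightarrow> a n < e\<^sup>2 / 4"
        by (auto simp: eventually_sequentially)
      have "nm (G m x - G n x) < e" if "m \<ge> N" "n \<ge> N" for m n
        using le[of m n] N[OF that(1)] N[OF that(2)] e
        by (intro power2_less_imp_less[of _ e]) auto
      then show "\<exists>N. \<forall>m\<ge>N. \<forall>n\<ge>N. nm (G m x - G n x) < e" by blast
    qed
  qed
  then obtain J where J: "\<And>x. x \<in> dm f \<Longrightarrow> J x \<in> C"
    and lim: "\<And>x. x \<in> dm f \<Longrightarrow> hlim H (\<lambda>n. G n x) (J x)"
    by metis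
  have GC: "G n x \<in> C" if "x \<in> dm f" for n x using step_op_C[OF g dm_C[OF that]] .
  show ?thesis
  proof (rule that[of J])
    fix x assume x: "x \<in> dm f"
    show "J x \<in> C" using J[OF x] .
    have "(\<lambda>n. (nm (G n x))\<^sup>2) \<longlonglongrightarrow> (nm (J x))\<^sup>2"
      by (intro tendsto_intros hlim_nm lim GC J x)
    moreover have "(nm (G n x))\<^sup>2 = (\<integral>t. (g n t)\<^sup>2 \<partial>\<nu> x)" for n
      using step_op_inner[OF g g dm_C[OF x]] nm_sq[OF GC[OF x]] by (simp add: power2_eq_square)
    moreover have "(\<lambda>n. \<integral>t. (g n t)\<^sup>2 \<partial>\<nu> x) \<longlonglongrightarrow> (\<integral>t. (f t)\<^sup>2 \<partial>\<nu> x)"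
    proof (rule integral_dominated_convergence[where w = "\<lambda>t. 4 * (f t)\<^sup>2"])
      show "AE t in \<nu> x. (\<lambda>n. (g n t)\<^sup>2) \<longlonglongrightarrow> (f t)\<^sup>2"
        by (rule AE_I2) (intro tendsto_intros gf)
      have "(g n t)\<^sup>2 \<le> 4 * (f t)\<^sup>2" for n t
        using power_mono[OF gb[of n t], of 2] by (simp add: power_mult_distrib)
      then show "AE t in \<nu> x. norm ((g n t)\<^sup>2) \<le> 4 * (f t)\<^sup>2" for n by simp
    qed (use dm_integrable[OF x] in simp_all)
    ultimately show "(nm (J x))\<^sup>2 = (\<integral>t. (f t)\<^sup>2 \<partial>\<nu> x)"
      by (simp only:) (rule LIMSEQ_unique)
  next
    fix x z assume x: "x \<in> dm f" and z: "z \<in> dm f"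
    \<comment> \<open>The four polarised vectors must lie in the domain as well, for f has to be
      integrable against each of their spectral measures before dominated convergence
      applies.\<close>
    have w: "x + \<i> ^ k *\<^sub>C z \<in> dm f" for k
      using x z dm_subspace[OF f] by (simp add: complex_vector.subspace_add complex_vector.subspace_scale)
    have "(\<lambda>n. \<integral>t. g n t \<partial>\<nu> (x + \<i> ^ k *\<^sub>C z)) \<longlonglongrightarrow> (\<integral>t. f t \<partial>\<nu> (x + \<i> ^ k *\<^sub>C z))" for k
      by (rule integral_dominated_convergence[where w = "\<lambda>t. 2 * \<bar>f t\<bar>"])
        (use integrable_from_dm[OF f w] gf gb in simp_all)
    then have "(\<lambda>n. (1/4) * (\<Sum>k<4::nat. \<i> ^ k * complex_of_real (\<integral>t. g n t \<partial>\<nu> (x + \<i> ^ k *\<^sub>C z))))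
       \<longlonglongrightarrow> (1/4) * (\<Sum>k<4::nat. \<i> ^ k * complex_of_real (\<integral>t. f t \<partial>\<nu> (x + \<i> ^ k *\<^sub>C z)))"
      by (intro tendsto_intros)
    then have "(\<lambda>n. ip z (G n x))
       \<longlonglongrightarrow> (1/4) * (\<Sum>k<4::nat. \<i> ^ k * complex_of_real (\<integral>t. f t \<partial>\<nu> (x + \<i> ^ k *\<^sub>C z)))"
      by (simp add: step_op_polar[OF g dm_C[OF x] dm_C[OF z]])
    then show "ip z (J x) = (1/4) * (\<Sum>k<4::nat. \<i> ^ k *
          complex_of_real (\<integral>t. f t \<partial>\<nu> (x + \<i> ^ k *\<^sub>C z)))"
      by (rule LIMSEQ_unique[OF hlim_ip[OF GC[OF x] J[OF x] dm_C[OF z] lim[OF x]]])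
    show "ip (J x) z = ip x (J z)"
      using hlim_ip_left[OF GC[OF x] J[OF x] dm_C[OF z] lim[OF x]]
        hlim_ip[OF GC[OF z] J[OF z] dm_C[OF x] lim[OF z]]
      unfolding step_op_sym[OF g dm_C[OF x] dm_C[OF z]] by (rule LIMSEQ_unique)
  next
    fix x and A :: "real set" assume x: "x \<in> dm f" and A: "A \<in> sets borel"
    have Ax: "E A x \<in> dm f" using dm_E[OF f A x] .
    \<comment> \<open>Symmetry moves \<open>E A\<close> onto the test vector z, so weak convergence
      of \<open>G n x\<close> suffices and no continuity of \<open>E A\<close> is used.\<close>
    have "ip z (E A (J x)) = ip z (J (E A x))" if z: "z \<in> C" for z
    proof -
      have "(\<lambda>n. ip (E A z) (G n x)) \<longlonglongrightarrow> ip (E A z) (J x)"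
        using hlim_ip[OF GC[OF x] J[OF x] _ lim[OF x]] A z by simp
      moreover have "ip (E A z) (G n x) = ip z (G n (E A x))" for n
        using step_op_E[OF g A dm_C[OF x]] E_sym[OF A z GC[OF x]] by simp
      moreover have "(\<lambda>n. ip z (G n (E A x))) \<longlonglongrightarrow> ip z (J (E A x))"
        using hlim_ip[OF GC[OF Ax] J[OF Ax] z lim[OF Ax]] .
      ultimately have "ip (E A z) (J x) = ip z (J (E A x))"
        by (simp only:) (rule LIMSEQ_unique)
      then show ?thesis using E_sym[OF A z J[OF x]] by simp
    qed
    then show "E A (J x) = J (E A x)"
      using ip_dense_eq[OF order_refl C_dense E_C[OF A J[OF x]] J[OF Ax]] by blast
  qed
qed

end

section \<open>Spectral integrals\<close>

text \<open>The companion of N(x + y) \<le> 2 N(x) + 2 N(y). The radius e may be \<infinity>, since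
  \<open>closure_in\<close> quantifies over all positive extended numbers.\<close>

lemma ennreal_sum_less_of_quarters:
  fixes a b e :: ennreal
  assumes "a < e / 4" "b < e / 4"
  shows "2 * a + 2 * b < e"
proof -
  have "a < top" "b < top"
    using assms by (auto intro: less_le_trans[OF _ top_greatest])
  then obtain x y where xy: "a = ennreal x" "x \<ge> 0" "b = ennreal y" "y \<ge> 0"
    by (metis ennreal_cases less_irrefl)
  have s: "2 * a + 2 * b = ennreal (2 * x + 2 * y)"
    using xy by (simp add: ennreal_plus ennreal_mult)
  show ?thesis
  proof (cases e)
    case (real r)
    have "ennreal r / 4 = ennreal (r / 4)"
      using real divide_ennreal[of r 4] by simp
    then have "x < r / 4" "y < r / 4"
      using assms real xy by (auto simp: ennreal_less_iff)
    then show ?thesis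
      using s real xy by (simp add: ennreal_less_iff del: ennreal_plus)
  next
    case top
    then show ?thesis by (simp add: s del: ennreal_plus)
  qed
qed

context pvm
begin

definition spectral_op :: "(real \<Rightarrow> real) \<Rightarrow> 'v \<Rightarrow> 'v"
  where "spectral_op f x = op_app (spectral_integral H E f) x"

lemma dm_subset: "dm f \<subseteq> C"
  using dm_C by blast

text \<open>Density of the domain makes the vector y in the weak formula unique, so the graph
  \<open>spectral_integral H E f\<close> is that of the limit operator J, and the properties of J
  transfer to the operator read off from the graph.\<close>

lemma
  assumes f [measurable]: "f \<in> borel_measurable borel"
  shows spectral_integral_eq: "spectral_integral H E f = {(x, spectral_op f x) | x. x \<in> dm f}"
    and spectral_op_C: "x \<in> dm f \<Longrightarrow> spectral_op f x \<in> C"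
    and nm_spectral_op: "x \<in> dm f \<Longrightarrow> (nm (spectral_op f x))\<^sup>2 = (\<integral>t. (f t)\<^sup>2 \<partial>\<nu> x)"
    and E_spectral_op: "x \<in> dm f \<Longrightarrow> A \<in> sets borel \<Longrightarrow> E A (spectral_op f x) = spectral_op f (E A x)"
    and spectral_op_sym:
      "x \<in> dm f \<Longrightarrow> y \<in> dm f \<Longrightarrow> ip (spectral_op f x) y = ip x (spectral_op f y)"
proof -
  obtain J where J: "\<And>x. x \<in> dm f \<Longrightarrow> J x \<in> C"
    "\<And>x. x \<in> dm f \<Longrightarrow> (nm (J x))\<^sup>2 = (\<integral>t. (f t)\<^sup>2 \<partial>\<nu> x)"
    "\<And>x z. x \<in> dm f \<Longrightarrow> z \<in> dm f \<Longrightarrow> ip z (J x) = (1/4) * (\<Sum>k<4::nat. \<i> ^ k *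
          complex_of_real (\<integral>t. f t \<partial>\<nu> (x + \<i> ^ k *\<^sub>C z)))"
    "\<And>x A. x \<in> dm f \<Longrightarrow> A \<in> sets borel \<Longrightarrow> E A (J x) = J (E A x)"
    "\<And>x y. x \<in> dm f \<Longrightarrow> y \<in> dm f \<Longrightarrow> ip (J x) y = ip x (J y)"
    by (rule spectral_op_exists[OF f]) (rule that)
  have graph: "(x, y) \<in> spectral_integral H E f \<longleftrightarrow> x \<in> dm f \<and> y = J x" for x y
  proof
    assume xy: "(x, y) \<in> spectral_integral H E f"
    then have x: "x \<in> dm f" and y: "y \<in> C"
      by (auto simp: spectral_integral_def)
    have eq: "ip z y = ip z (J x)" if "z \<in> dm f" for z
      unfolding J(3)[OF x that] using xy that
      by (auto simp only: spectral_integral_def mem_Collect_eq prod.case)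
    show "x \<in> dm f \<and> y = J x"
      using ip_dense_eq[OF dm_subset dm_dense[OF f] y J(1)[OF x] eq] x by simp
  next
    assume "x \<in> dm f \<and> y = J x"
    then show "(x, y) \<in> spectral_integral H E f"
      using J(1,3) by (simp add: spectral_integral_def)
  qed
  have op: "spectral_op f x = J x" if "x \<in> dm f" for x
    using that by (simp add: spectral_op_def op_app_def graph)
  show "spectral_integral H E f = {(x, spectral_op f x) | x. x \<in> dm f}"
    using graph op by auto
  show "spectral_op f x \<in> C" if "x \<in> dm f"
    using J(1) op that by simp
  show "(nm (spectral_op f x))\<^sup>2 = (\<integral>t. (f t)\<^sup>2 \<partial>\<nu> x)" if "x \<in> dm f"
    using J(2) op that by simp
  show "E A (spectral_op f x) = spectral_op f (E A x)" if "x \<in> dm f" "A \<in> sets borel"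
    using J(4)[OF that] op[OF that(1)] op[OF dm_E[OF f that(2,1)]] by simp
  show "ip (spectral_op f x) y = ip x (spectral_op f y)" if "x \<in> dm f" "y \<in> dm f"
    using J(5)[OF that] op that by simp
qed

lemma Domain_spectral_integral:
  "f \<in> borel_measurable borel \<Longrightarrow> Domain (spectral_integral H E f) = dm f"
  by (auto simp: spectral_integral_eq)

lemma dm_add: "f \<in> borel_measurable borel \<Longrightarrow> x \<in> dm f \<Longrightarrow> y \<in> dm f \<Longrightarrow> x + y \<in> dm f"
  using dm_subspace complex_vector.subspace_add by blast

lemma dm_scale: "f \<in> borel_measurable borel \<Longrightarrow> x \<in> dm f \<Longrightarrow> c *\<^sub>C x \<in> dm f"
  using dm_subspace complex_vector.subspace_scale by blast

text \<open>The polarised integrals are not visibly additive in x. Symmetry moves the operator to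
  the test vector, where additivity of the inner product is enough.\<close>

lemma spectral_op_add:
  assumes f: "f \<in> borel_measurable borel" and x: "x \<in> dm f" and y: "y \<in> dm f"
  shows "spectral_op f (x + y) = spectral_op f x + spectral_op f y"
proof (rule ip_dense_eq[OF dm_subset dm_dense[OF f]])
  have xy: "x + y \<in> dm f" using dm_add[OF f x y] .
  then show "spectral_op f (x + y) \<in> C" "spectral_op f x + spectral_op f y \<in> C"
    using spectral_op_C[OF f] x y by auto
  fix z assume z: "z \<in> dm f"
  show "ip z (spectral_op f (x + y)) = ip z (spectral_op f x + spectral_op f y)"
    using spectral_op_sym[OF f z, symmetric] spectral_op_C[OF f] x y xy z
    by (simp add: ip_simps dm_C)
qed

lemma spectral_op_scale:
  assumes f: "f \<in> borel_measurable borel" and x: "x \<in> dm f"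
  shows "spectral_op f (c *\<^sub>C x) = c *\<^sub>C spectral_op f x"
proof (rule ip_dense_eq[OF dm_subset dm_dense[OF f]])
  have cx: "c *\<^sub>C x \<in> dm f" using dm_scale[OF f x] .
  then show "spectral_op f (c *\<^sub>C x) \<in> C" "c *\<^sub>C spectral_op f x \<in> C"
    using spectral_op_C[OF f] x by auto
  fix z assume z: "z \<in> dm f"
  show "ip z (spectral_op f (c *\<^sub>C x)) = ip z (c *\<^sub>C spectral_op f x)"
    using spectral_op_sym[OF f z, symmetric] spectral_op_C[OF f] x cx z
    by (simp add: ip_simps dm_C)
qed

section \<open>Self-adjointness of spectral integrals\<close>

lemma nm_E_le:
  assumes "A \<in> sets borel" "x \<in> C" shows "nm (E A x) \<le> nm x"
proof (rule power2_le_imp_le)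
  interpret finite_measure "\<nu> x" using assms(2) by (rule finite_\<nu>)
  show "(nm (E A x))\<^sup>2 \<le> (nm x)\<^sup>2"
    using bounded_measure[of A] assms by (simp add: measure_\<nu> E_UNIV)
qed (use assms in simp)

text \<open>Cut-offs make the adjoint relation explicit: the operator sends
  \<open>E (cut f n) x\<close> to \<open>E (cut f n) y\<close>, so the integrals of f^2 over
  \<open>cut f n\<close> are bounded by the squared norm of y. Monotone convergence puts x into the
  domain, and symmetry identifies y.\<close>

lemma adjoint_subset:
  assumes f [measurable]: "f \<in> borel_measurable borel"
    and xy: "(x, y) \<in> adjoint_op H (spectral_integral H E f)"
  shows "x \<in> dm f" "y = spectral_op f x"
proof -
  have x: "x \<in> C" and y: "y \<in> C"
    and adj: "\<And>u. u \<in> dm f \<Longrightarrow> ip (spectral_op f u) x = ip u y"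
    using xy by (auto simp: adjoint_op_def spectral_integral_eq[OF f])
  have cutop: "spectral_op f (E (cut f n) x) = E (cut f n) y" for n
  proof (rule ip_dense_eq[OF order_refl C_dense])
    have xn: "E (cut f n) x \<in> dm f" using cut_dm[OF f x] .
    show "spectral_op f (E (cut f n) x) \<in> C" "E (cut f n) y \<in> C"
      using spectral_op_C[OF f xn] y by auto
    \<comment> \<open>The image of a cut-off vector stays in the range of the cut-off projection,
      which may therefore be moved across the inner product.\<close>
    have idem: "spectral_op f (E (cut f n) v) = E (cut f n) (spectral_op f (E (cut f n) v))"
      if "v \<in> C" for v
      using E_spectral_op[OF f cut_dm[OF f that], of "cut f n" n] that by (simp add: E_idem)
    fix w assume w: "w \<in> C"
    have wn: "E (cut f n) w \<in> dm f" using cut_dm[OF f w] .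
    have "ip w (E (cut f n) y) = ip (E (cut f n) w) y"
      using w y by (simp add: E_sym)
    also have "\<dots> = ip (spectral_op f (E (cut f n) w)) x"
      using adj[OF wn] by simp
    also have "\<dots> = ip (spectral_op f (E (cut f n) w)) (E (cut f n) x)"
      using idem[OF w] E_sym[of "cut f n" "spectral_op f (E (cut f n) w)" x] x spectral_op_C[OF f wn]
      by simp
    also have "\<dots> = ip (E (cut f n) w) (spectral_op f (E (cut f n) x))"
      by (rule spectral_op_sym[OF f wn xn])
    also have "\<dots> = ip w (spectral_op f (E (cut f n) x))"
      using idem[OF x] E_sym[of "cut f n" w "spectral_op f (E (cut f n) x)"] w spectral_op_C[OF f xn]
      by simp
    finally show "ip w (spectral_op f (E (cut f n) x)) = ip w (E (cut f n) y)" by simp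
  qed
  have bound: "(\<integral>\<^sup>+t. ennreal ((f t)\<^sup>2) * indicator (cut f n) t \<partial>\<nu> x) \<le> ennreal ((nm y)\<^sup>2)" for n
  proof -
    have xn: "E (cut f n) x \<in> dm f" using cut_dm[OF f x] .
    have "(\<integral>\<^sup>+t. ennreal ((f t)\<^sup>2) * indicator (cut f n) t \<partial>\<nu> x)
        = (\<integral>\<^sup>+t. ennreal ((f t)\<^sup>2) \<partial>\<nu> (E (cut f n) x))"
      using x by (simp add: nn_integral_\<nu>_E)
    also have "\<dots> = ennreal (\<integral>t. (f t)\<^sup>2 \<partial>\<nu> (E (cut f n) x))"
      using dm_integrable[OF xn] by (intro nn_integral_eq_integral) auto
    also have "\<dots> = ennreal ((nm (E (cut f n) y))\<^sup>2)"
      using nm_spectral_op[OF f xn] cutop by simp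
    also have "\<dots> \<le> ennreal ((nm y)\<^sup>2)"
      using y by (intro ennreal_leI power_mono nm_E_le) auto
    finally show ?thesis .
  qed
  have "(\<lambda>n. \<integral>\<^sup>+t. ennreal ((f t)\<^sup>2) * indicator (cut f n) t \<partial>\<nu> x) \<longlonglongrightarrow> (\<integral>\<^sup>+t. ennreal ((f t)\<^sup>2) \<partial>\<nu> x)"
  proof (rule nn_integral_LIMSEQ)
    show "incseq (\<lambda>n t. ennreal ((f t)\<^sup>2) * indicator (cut f n) t)"
      by (auto simp: incseq_def le_fun_def cut_def indicator_def)
    fix t
    obtain N where "\<bar>f t\<bar> \<le> real N" using real_arch_simple by blast
    then show "(\<lambda>n. ennreal ((f t)\<^sup>2) * indicator (cut f n) t) \<longlonglongrightarrow> ennreal ((f t)\<^sup>2)"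
      by (intro tendsto_eventually eventually_sequentiallyI[of N]) (auto simp: cut_def indicator_def)
  qed measurable
  then have "(\<integral>\<^sup>+t. ennreal ((f t)\<^sup>2) \<partial>\<nu> x) \<le> ennreal ((nm y)\<^sup>2)"
    by (rule LIMSEQ_le_const2) (use bound in blast)
  then show xd: "x \<in> dm f"
    using x by (auto simp: dm_iff intro: order_le_less_trans)
  show "y = spectral_op f x"
  proof (rule ip_dense_eq[OF dm_subset dm_dense[OF f] y spectral_op_C[OF f xd]])
    fix z assume z: "z \<in> dm f"
    show "ip z y = ip z (spectral_op f x)"
      using adj[OF z] spectral_op_sym[OF f z xd] by simp
  qed
qed

lemma self_adjoint_spectral_integral:
  assumes f [measurable]: "f \<in> borel_measurable borel"
  shows "self_adjoint_op H (spectral_integral H E f)"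
  unfolding self_adjoint_op_def
proof
  have mem: "(x, y) \<in> spectral_integral H E f \<longleftrightarrow> x \<in> dm f \<and> y = spectral_op f x" for x y
    by (auto simp: spectral_integral_eq[OF f])
  show "densely_defined_operator H (spectral_integral H E f)"
    unfolding densely_defined_operator_def Domain_spectral_integral[OF f]
  proof (intro conjI allI)
    show "spectral_integral H E f \<subseteq> C \<times> C"
      using spectral_op_C[OF f] by (auto simp: mem dm_C)
    show "single_valued (spectral_integral H E f)"
      by (simp add: single_valued_def mem)
    show "\<forall>(x, y)\<in>spectral_integral H E f. \<forall>(x', y')\<in>spectral_integral H E f.
        (x + x', y + y') \<in> spectral_integral H E f"
      by (clarsimp simp: mem dm_add[OF f] spectral_op_add[OF f])
    show "\<forall>(x, y)\<in>spectral_integral H E f. (c *\<^sub>C x, c *\<^sub>C y) \<in> spectral_integral H E f" for c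
      by (clarsimp simp: mem dm_scale[OF f] spectral_op_scale[OF f])
  qed (rule dm_dense[OF f])
  show "adjoint_op H (spectral_integral H E f) = spectral_integral H E f"
  proof (rule equalityI; rule subrelI)
    fix x y assume "(x, y) \<in> adjoint_op H (spectral_integral H E f)"
    then show "(x, y) \<in> spectral_integral H E f"
      using adjoint_subset[OF f, of x y] by (simp add: mem)
  next
    fix x y assume "(x, y) \<in> spectral_integral H E f"
    then have "x \<in> dm f" "y = spectral_op f x" by (simp_all add: mem)
    then show "(x, y) \<in> adjoint_op H (spectral_integral H E f)"
      using spectral_op_C[OF f] spectral_op_sym[OF f]
      by (clarsimp simp: adjoint_op_def mem dm_C)
  qed
qed

section \<open>The form domain of T, its norm and its quadratic form\<close>

abbreviation "sq \<equiv> \<lambda>t::real. sqrt \<bar>t\<bar>"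

lemma sq_measurable [measurable]: "sq \<in> borel_measurable borel"
  by measurable

lemma Domain_sqrt_abs_op: "Domain (sqrt_abs_op H E) = dm sq"
  by (simp add: sqrt_abs_op_def Domain_spectral_integral)

lemma op_app_sqrt_abs_op: "op_app (sqrt_abs_op H E) = spectral_op sq"
  by (simp add: sqrt_abs_op_def spectral_op_def fun_eq_iff)

lemma dm_sq_integrable_abs: "x \<in> dm sq \<Longrightarrow> integrable (\<nu> x) (\<lambda>t. \<bar>t\<bar>)"
  by (simp add: spectral_dom_def)

lemma spectral_norm_sq_alt:
  assumes "x \<in> C"
  shows "spectral_norm_sq H E x = ennreal ((nm x)\<^sup>2) + (\<integral>\<^sup>+t. ennreal \<bar>t\<bar> \<partial>\<nu> x)"
  using assms by (simp add: spectral_norm_sq_def ennreal_plus nn_integral_add nn_integral_\<nu>_1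
    del: nn_integral_const)

lemma dm_sq_iff: "x \<in> dm sq \<longleftrightarrow> x \<in> C \<and> spectral_norm_sq H E x < \<infinity>"
  by (auto simp: dm_iff spectral_norm_sq_alt)

lemma dm_id_subset: "dm (\<lambda>t. t) \<subseteq> dm sq"
proof
  fix x assume x: "x \<in> dm (\<lambda>t. t)"
  then show "x \<in> dm sq"
    using Bochner_Integration.integrable_abs[OF integrable_from_dm[OF _ x]]
    by (simp add: spectral_dom_def)
qed

lemma spectral_norm_sq_add:
  "x \<in> C \<Longrightarrow> y \<in> C \<Longrightarrow>
    spectral_norm_sq H E (x + y) \<le> 2 * spectral_norm_sq H E x + 2 * spectral_norm_sq H E y"
  unfolding spectral_norm_sq_def by (rule nn_integral_\<nu>_add) auto

lemma spectral_norm_sq_triangle: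
  assumes "x \<in> C" "y \<in> C" "z \<in> C"
    and "spectral_norm_sq H E (x - y) < e / 4" "spectral_norm_sq H E (y - z) < e / 4"
  shows "spectral_norm_sq H E (x - z) < e"
proof -
  have "spectral_norm_sq H E (x - z) \<le> 2 * spectral_norm_sq H E (x - y) + 2 * spectral_norm_sq H E (y - z)"
    using spectral_norm_sq_add[of "x - y" "y - z"] assms by simp
  also have "\<dots> < e"
    using assms(4,5) by (rule ennreal_sum_less_of_quarters)
  finally show ?thesis .
qed

text \<open>
  The domain of \<open>T\<close> is a core for \<open>|T|\<^sup>1\<^sup>/\<^sup>2\<close>, since the cut-offs \<open>E([-n, n]) x\<close> converge in the spectral norm.
\<close>

lemma closure_eq_dm:
  assumes D': "D' = closure_in (spectral_norm_sq H E) (Domain (sqrt_abs_op H E)) D"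
    and sub: "Domain (spectral_integral H E (\<lambda>t. t)) \<subseteq> D'" and D: "D \<subseteq> C"
  shows "D' = dm sq"
proof
  show "D' \<subseteq> dm sq" by (auto simp: D' closure_in_def Domain_sqrt_abs_op)
  show "dm sq \<subseteq> D'"
  proof
    fix x assume x: "x \<in> dm sq"
    then have xC: "x \<in> C" by (rule dm_C)
    have "\<exists>y\<in>D. spectral_norm_sq H E (x - y) < e" if e: "e > 0" for e
    proof -
      have e4: "e / 4 > 0" using e by (simp add: ennreal_zero_less_divide)
      have "(\<lambda>n. spectral_norm_sq H E (x - E (cut (\<lambda>t. t) n) x)) \<longlonglongrightarrow> 0"
        unfolding spectral_norm_sq_def
        using x by (intro cut_tail) (auto simp: dm_sq_iff spectral_norm_sq_def)
      then have "\<forall>\<^sub>F n in sequentially. spectral_norm_sq H E (x - E (cut (\<lambda>t. t) n) x) < e / 4"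
        using e4 by (rule order_tendstoD)
      then obtain n where n: "spectral_norm_sq H E (x - E (cut (\<lambda>t. t) n) x) < e / 4"
        by (auto simp: eventually_sequentially)
      have "E (cut (\<lambda>t. t) n) x \<in> D'"
        using sub cut_dm[of "\<lambda>t. t" x n] xC by (auto simp: Domain_spectral_integral)
      then obtain y where y: "y \<in> D" "spectral_norm_sq H E (E (cut (\<lambda>t. t) n) x - y) < e / 4"
        using e4 by (auto simp: D' closure_in_def)
      then show ?thesis
        using spectral_norm_sq_triangle[OF xC _ _ n y(2)] D xC by auto
    qed
    then show "x \<in> D'" using x by (simp add: D' closure_in_def Domain_sqrt_abs_op)
  qed
qed

lemma integral_\<nu>_E:
  fixes f :: "real \<Rightarrow> real"
  assumes "x \<in> C" "B \<in> sets borel" and [measurable]: "f \<in> borel_measurable borel"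
  shows "(\<integral>t. f t \<partial>\<nu> (E B x)) = (\<integral>t. indicator B t * f t \<partial>\<nu> x)"
proof -
  have "\<nu> (E B x) = density (\<nu> x) (\<lambda>t. ennreal (indicator B t))"
    using assms \<nu>_E[of B x] by (simp add: ennreal_indicator)
  then show ?thesis using assms by (simp add: integral_density)
qed

text \<open>E commutes with the square root operator, so for y = \<open>spectral_op sq x\<close> the
  number \<open>ip y (E B y)\<close> is the integral of |t| over B. Subtracting the negative half
  line from the positive one turns |t| into t; the point 0 contributes nothing.\<close>

lemma sgn_form:
  assumes x: "x \<in> dm sq"
  shows "ip (spectral_op sq x) (sgn_op E (spectral_op sq x)) = complex_of_real (\<integral>t. t \<partial>\<nu> x)"
proof -
  define y where "y = spectral_op sq x"
  have y: "y \<in> C" using x by (simp add: y_def spectral_op_C)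
  have part: "ip y (E B y) = complex_of_real (\<integral>t. indicator B t * \<bar>t\<bar> \<partial>\<nu> x)"
    if B: "B \<in> sets borel" for B
  proof -
    have "E B y = spectral_op sq (E B x)"
      using E_spectral_op[OF sq_measurable x B] by (simp add: y_def)
    then have "(nm (E B y))\<^sup>2 = (\<integral>t. (sq t)\<^sup>2 \<partial>\<nu> (E B x))"
      using nm_spectral_op[OF sq_measurable dm_E[OF sq_measurable B x]] by simp
    also have "\<dots> = (\<integral>t. indicator B t * (sq t)\<^sup>2 \<partial>\<nu> x)"
      using dm_C[OF x] B by (rule integral_\<nu>_E) measurable
    finally show ?thesis
      using E_sym[OF B y E_C[OF B y]] ip_self[OF E_C[OF B y]] E_idem[OF B y] by simp
  qed
  have int: "integrable (\<nu> x) (\<lambda>t. indicator B t * \<bar>t\<bar>)" if "B \<in> sets borel" for B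
    using integrable_mult_indicator[OF _ dm_sq_integrable_abs[OF x], of B] that by simp
  have "ip y (sgn_op E y) = ip y (E {0<..} y) - ip y (E {..<0} y)"
    using y by (simp add: sgn_op_def ip_simps)
  also have "\<dots> = complex_of_real ((\<integral>t. indicator {0<..} t * \<bar>t\<bar> \<partial>\<nu> x) - (\<integral>t. indicator {..<0} t * \<bar>t\<bar> \<partial>\<nu> x))"
    by (simp only: part borel_open[OF open_greaterThan] borel_open[OF open_lessThan] of_real_diff)
  also have "\<dots> = complex_of_real (\<integral>t. indicator {0<..} t * \<bar>t\<bar> - indicator {..<0} t * \<bar>t\<bar> \<partial>\<nu> x)"
    using int by simp
  also have "\<dots> = complex_of_real (\<integral>t. t \<partial>\<nu> x)"
    by (intro arg_cong[where f = complex_of_real] Bochner_Integration.integral_cong)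
      (auto simp: indicator_def)
  finally show ?thesis by (simp add: y_def)
qed

text \<open>The integral provides only the diagonal. The sesquilinear form behind it is the inner
  product of \<open>spectral_op sq x\<close> with the sign operator applied to
  \<open>spectral_op sq y\<close>, which \<open>sgn_form\<close> relates to the integral.\<close>

lemma hermitian_spectral_form:
  "hermitian_quadratic_form H (dm sq) (\<lambda>x. \<integral>t. t \<partial>\<nu> x)"
  unfolding hermitian_quadratic_form_def
proof (intro conjI exI[of _ "\<lambda>x y. ip (spectral_op sq x) (sgn_op E (spectral_op sq y))"] ballI allI)
  note [simp] = spectral_op_add[OF sq_measurable] spectral_op_scale[OF sq_measurable]
    spectral_op_C[OF sq_measurable] E_add E_scale
  show "csubspace (dm sq)" "hdense H (dm sq)"
    by (simp_all add: dm_subspace dm_dense)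
  fix x y assume x: "x \<in> dm sq" and y: "y \<in> dm sq"
  show "ip (spectral_op sq x) (sgn_op E (spectral_op sq (y + z))) =
    ip (spectral_op sq x) (sgn_op E (spectral_op sq y)) + ip (spectral_op sq x) (sgn_op E (spectral_op sq z))"
    if "z \<in> dm sq" for z
    using x y that by (simp add: sgn_op_def ip_simps)
  show "ip (spectral_op sq x) (sgn_op E (spectral_op sq (c *\<^sub>C y))) =
    c * ip (spectral_op sq x) (sgn_op E (spectral_op sq y))" for c
    using x y by (simp add: sgn_op_def ip_simps algebra_simps)
  have "ip (spectral_op sq x) (E A (spectral_op sq y)) = cnj (ip (spectral_op sq y) (E A (spectral_op sq x)))"
    if "A \<in> sets borel" for A
    using E_sym[OF that, of "spectral_op sq x" "spectral_op sq y"]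
      inner_commute[of "E A (spectral_op sq x)" "spectral_op sq y"] that x y by simp
  then show "ip (spectral_op sq x) (sgn_op E (spectral_op sq y)) =
    cnj (ip (spectral_op sq y) (sgn_op E (spectral_op sq x)))"
    using x y by (simp add: sgn_op_def ip_simps)
qed (simp add: sgn_form)

end

text \<open>Formulated over \<open>complete_inner_space\<close> so that it applies to the given
  fibre representations as well as to an arbitrary representation on the direct integral.\<close>

lemma strong_representation_unique:
  assumes "complete_inner_space H"
    and rep: "strong_representation H D Q T E D' Q'"
  shows "pvm H E" "D' = spectral_dom H E (\<lambda>t. sqrt \<bar>t\<bar>)"
    "\<And>x. x \<in> D' \<Longrightarrow> Q' x = (\<integral>t. t \<partial>spectral_measure H E x)"
proof -
  interpret complete_inner_space H by fact
  show p: "pvm H E"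
    using rep assms(1)
    by (simp add: pvm_def pvm_axioms_def strong_representation_def resolution_of_identity_def)
  then interpret pvm H E .
  show "D' = dm sq"
  proof (rule closure_eq_dm)
    show "D' = closure_in (spectral_norm_sq H E) (Domain (sqrt_abs_op H E)) D"
      using rep unfolding strong_representation_def by blast
    show "Domain (spectral_integral H E (\<lambda>t. t)) \<subseteq> D'"
      using rep unfolding strong_representation_def resolution_of_identity_def by blast
    have "D \<subseteq> Domain (sqrt_abs_op H E)"
      using rep unfolding strong_representation_def by blast
    then show "D \<subseteq> C"
      using dm_subset unfolding Domain_sqrt_abs_op by blast
  qed
  show "\<And>x. x \<in> D' \<Longrightarrow> Q' x = (\<integral>t. t \<partial>\<nu> x)"
    using rep by (simp add: strong_representation_def)
qed

section \<open>Direct integrals over countable atomic spaces\<close>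

text \<open>Positive point masses make the norm of the direct integral definite on functions,
  without equivalence classes. Finite point masses keep integrals over finite sets of atoms finite,
  and countability provides an exhaustion by such sets.\<close>

locale atomic_field = measurable_field M H S
  for M :: "'a measure" and H :: "'a \<Rightarrow> 'v::complex_vector hspace" and S :: "('a \<Rightarrow> 'v) set" +
  assumes countable_space: "countable (space M)"
    and sets_Pow: "sets M = Pow (space M)"
    and atom_pos: "\<alpha> \<in> space M \<Longrightarrow> 0 < emeasure M {\<alpha>}"
    and atom_finite: "\<alpha> \<in> space M \<Longrightarrow> emeasure M {\<alpha>} < \<infinity>"
begin

abbreviation "HH \<equiv> direct_integral M H S"

lemma measurable_any [simp, measurable]: "f \<in> borel_measurable M"
  by (simp add: measurable_def sets_Pow)

text \<open>Every function on M is measurable, so the maximality axiom admits all sections.\<close>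

lemma S_eq: "S = field_sections M H"
  using sections_subset sections_maximal by auto

lemma fibre: "\<alpha> \<in> space M \<Longrightarrow> complete_inner_space (H \<alpha>)"
  by (rule hilbert_space.complete_inner_space[OF fibre_hilbert])

lemma fibre_simps [simp]:
  assumes "\<alpha> \<in> space M"
  shows "0 \<in> hcarrier (H \<alpha>)" "hnorm (H \<alpha>) 0 = 0"
    "x \<in> hcarrier (H \<alpha>) \<Longrightarrow> 0 \<le> hnorm (H \<alpha>) x"
    "x \<in> hcarrier (H \<alpha>) \<Longrightarrow> y \<in> hcarrier (H \<alpha>) \<Longrightarrow> x + y \<in> hcarrier (H \<alpha>)"
    "x \<in> hcarrier (H \<alpha>) \<Longrightarrow> y \<in> hcarrier (H \<alpha>) \<Longrightarrow> x - y \<in> hcarrier (H \<alpha>)"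
    "x \<in> hcarrier (H \<alpha>) \<Longrightarrow> c *\<^sub>C x \<in> hcarrier (H \<alpha>)"
proof -
  interpret complete_inner_space "H \<alpha>" using fibre[OF assms] .
  show "0 \<in> C" "nm 0 = 0" by auto
  show "0 \<le> nm x" if "x \<in> C" using that by auto
  show "x + y \<in> C" "x - y \<in> C" if "x \<in> C" "y \<in> C" using that by auto
  show "c *\<^sub>C x \<in> C" if "x \<in> C" using that by auto
qed

section \<open>Square-integrable sections and completeness\<close>

abbreviation "w \<Phi> \<alpha> \<equiv> (hnorm (H \<alpha>) (\<Phi> \<alpha>))\<^sup>2"

lemma HC_iff: "\<Phi> \<in> hcarrier HH \<longleftrightarrow> \<Phi> \<in> field_sections M H \<and> (\<integral>\<^sup>+\<alpha>. ennreal (w \<Phi> \<alpha>) \<partial>M) < \<infinity>"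
  by (simp add: direct_integral_def S_eq integrable_iff_bounded)

lemma HC_integrable: "\<Phi> \<in> hcarrier HH \<Longrightarrow> integrable M (w \<Phi>)"
  by (simp add: direct_integral_def)

lemma HC_I:
  assumes "\<And>\<alpha>. \<alpha> \<in> space M \<Longrightarrow> \<Phi> \<alpha> \<in> hcarrier (H \<alpha>)" "\<And>\<alpha>. \<alpha> \<notin> space M \<Longrightarrow> \<Phi> \<alpha> = 0"
    and "(\<integral>\<^sup>+\<alpha>. ennreal (w \<Phi> \<alpha>) \<partial>M) < \<infinity>"
  shows "\<Phi> \<in> hcarrier HH"
  using assms by (simp add: HC_iff field_sections_def)

lemma
  assumes "\<Phi> \<in> hcarrier HH"
  shows HC_fibre: "\<alpha> \<in> space M \<Longrightarrow> \<Phi> \<alpha> \<in> hcarrier (H \<alpha>)"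
    and HC_outside: "\<alpha> \<notin> space M \<Longrightarrow> \<Phi> \<alpha> = 0"
    and HC_finite: "(\<integral>\<^sup>+\<alpha>. ennreal (w \<Phi> \<alpha>) \<partial>M) < top"
  using assms by (simp_all add: HC_iff field_sections_def)

lemmas HC_simps [simp] = HC_fibre HC_finite

lemma hnorm_HH_eq_sqrt:
  assumes "\<Phi> \<in> hcarrier HH"
  shows "hnorm HH \<Phi> = sqrt (\<integral>\<alpha>. w \<Phi> \<alpha> \<partial>M)"
proof -
  have "(\<integral>\<alpha>. hinner (H \<alpha>) (\<Phi> \<alpha>) (\<Phi> \<alpha>) \<partial>M) = (\<integral>\<alpha>. complex_of_real (w \<Phi> \<alpha>) \<partial>M)"
    using assms by (intro Bochner_Integration.integral_cong)
      (auto simp: complete_inner_space.ip_self[OF fibre])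
  then have "Re (hinner HH \<Phi> \<Phi>) = (\<integral>\<alpha>. w \<Phi> \<alpha> \<partial>M)"
    by (simp add: direct_integral_def del: of_real_power)
  then show ?thesis by (simp add: hnorm_def)
qed

lemma hnorm_HH: "\<Phi> \<in> hcarrier HH \<Longrightarrow> (hnorm HH \<Phi>)\<^sup>2 = (\<integral>\<alpha>. w \<Phi> \<alpha> \<partial>M)"
  by (simp add: hnorm_HH_eq_sqrt)

lemma hnorm_HH_nonneg: "\<Phi> \<in> hcarrier HH \<Longrightarrow> 0 \<le> hnorm HH \<Phi>"
  by (simp add: hnorm_HH_eq_sqrt)

lemma ennreal_hnorm_HH:
  assumes "\<Phi> \<in> hcarrier HH"
  shows "ennreal ((hnorm HH \<Phi>)\<^sup>2) = (\<integral>\<^sup>+\<alpha>. ennreal (w \<Phi> \<alpha>) \<partial>M)"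
  using HC_integrable[OF assms] by (simp add: hnorm_HH[OF assms] nn_integral_eq_integral)

text \<open>Controls the value at one atom by a global integral at the price of the mass of the
  atom; this is how finiteness and Cauchy estimates descend to the fibres.\<close>

lemma point_le: "\<alpha> \<in> space M \<Longrightarrow> f \<alpha> * emeasure M {\<alpha>} \<le> (\<integral>\<^sup>+\<beta>. f \<beta> \<partial>M)"
proof -
  assume "\<alpha> \<in> space M"
  then have "f \<alpha> * emeasure M {\<alpha>} = (\<integral>\<^sup>+\<beta>. f \<alpha> * indicator {\<alpha>} \<beta> \<partial>M)"
    by (simp add: nn_integral_cmult_indicator sets_Pow)
  also have "\<dots> \<le> (\<integral>\<^sup>+\<beta>. f \<beta> \<partial>M)"
    by (intro nn_integral_mono) (auto simp: indicator_def)
  finally show ?thesis .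
qed

lemma HC_add:
  assumes "\<Phi> \<in> hcarrier HH" "\<Psi> \<in> hcarrier HH"
  shows "\<Phi> + \<Psi> \<in> hcarrier HH"
proof -
  have "(\<integral>\<^sup>+\<alpha>. ennreal (w (\<Phi> + \<Psi>) \<alpha>) \<partial>M) \<le> (\<integral>\<^sup>+\<alpha>. 2 * ennreal (w \<Phi> \<alpha>) + 2 * ennreal (w \<Psi> \<alpha>) \<partial>M)"
  proof (rule nn_integral_mono)
    fix \<alpha> assume \<alpha>: "\<alpha> \<in> space M"
    have "ennreal (w (\<Phi> + \<Psi>) \<alpha>) \<le> ennreal (2 * w \<Phi> \<alpha> + 2 * w \<Psi> \<alpha>)"
      using complete_inner_space.nm_sq_add_le[OF fibre[OF \<alpha>], of "\<Phi> \<alpha>" "\<Psi> \<alpha>"] assms \<alpha>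
      by (intro ennreal_leI) simp
    then show "ennreal (w (\<Phi> + \<Psi>) \<alpha>) \<le> 2 * ennreal (w \<Phi> \<alpha>) + 2 * ennreal (w \<Psi> \<alpha>)"
      by (simp add: ennreal_plus ennreal_mult)
  qed
  also have "\<dots> < \<infinity>"
    using assms by (simp add: nn_integral_add nn_integral_cmult ennreal_mult_less_top)
  finally show ?thesis using assms by (intro HC_I) (simp_all add: HC_outside[OF assms(1)] HC_outside[OF assms(2)])
qed

lemma HC_scale:
  assumes "\<Phi> \<in> hcarrier HH" shows "c *\<^sub>C \<Phi> \<in> hcarrier HH"
proof -
  have "(\<integral>\<^sup>+\<alpha>. ennreal (w (c *\<^sub>C \<Phi>) \<alpha>) \<partial>M) = (\<integral>\<^sup>+\<alpha>. ennreal ((cmod c)\<^sup>2) * ennreal (w \<Phi> \<alpha>) \<partial>M)"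
    using assms by (intro nn_integral_cong)
      (auto simp: scaleC_fun_def complete_inner_space.nm_scale[OF fibre] power_mult_distrib ennreal_mult)
  also have "\<dots> < \<infinity>"
    using assms by (simp add: nn_integral_cmult ennreal_mult_less_top)
  finally show ?thesis using assms by (intro HC_I) (simp_all add: scaleC_fun_def HC_outside[OF assms])
qed

lemma HC_zero: "0 \<in> hcarrier HH"
  by (rule HC_I) (simp_all cong: nn_integral_cong)

lemma HC_subspace: "csubspace (hcarrier HH)"
  using HC_add HC_scale HC_zero by (intro complex_vector.subspaceI) auto

lemma HC_diff: "\<Phi> \<in> hcarrier HH \<Longrightarrow> \<Psi> \<in> hcarrier HH \<Longrightarrow> \<Phi> - \<Psi> \<in> hcarrier HH"
  by (rule complex_vector.subspace_diff[OF HC_subspace])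

lemma inner_integrable:
  assumes "\<Phi> \<in> hcarrier HH" "\<Psi> \<in> hcarrier HH"
  shows "integrable M (\<lambda>\<alpha>. hinner (H \<alpha>) (\<Phi> \<alpha>) (\<Psi> \<alpha>))"
proof (rule Bochner_Integration.integrable_bound)
  show "integrable M (\<lambda>\<alpha>. w \<Phi> \<alpha> + w \<Psi> \<alpha>)"
    using assms HC_integrable by simp
  show "AE \<alpha> in M. norm (hinner (H \<alpha>) (\<Phi> \<alpha>) (\<Psi> \<alpha>)) \<le> norm (w \<Phi> \<alpha> + w \<Psi> \<alpha>)"
  proof (rule AE_I2)
    fix \<alpha> assume \<alpha>: "\<alpha> \<in> space M"
    have "norm (hinner (H \<alpha>) (\<Phi> \<alpha>) (\<Psi> \<alpha>)) \<le> hnorm (H \<alpha>) (\<Phi> \<alpha>) * hnorm (H \<alpha>) (\<Psi> \<alpha>)"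
      using complete_inner_space.Cauchy_Schwarz[OF fibre[OF \<alpha>]] assms \<alpha> by simp
    also have "\<dots> \<le> w \<Phi> \<alpha> + w \<Psi> \<alpha>"
    proof -
      have "0 \<le> hnorm (H \<alpha>) (\<Phi> \<alpha>) * hnorm (H \<alpha>) (\<Psi> \<alpha>)" using assms \<alpha> by simp
      then show ?thesis
        using sum_squares_bound[of "hnorm (H \<alpha>) (\<Phi> \<alpha>)" "hnorm (H \<alpha>) (\<Psi> \<alpha>)"] by linarith
    qed
    finally show "norm (hinner (H \<alpha>) (\<Phi> \<alpha>) (\<Psi> \<alpha>)) \<le> norm (w \<Phi> \<alpha> + w \<Psi> \<alpha>)" by simp
  qed
qed simp

text \<open>At an atom the fibre norm is at most the global norm divided by the square root of the
  mass, so a Cauchy sequence converges in every fibre without passing to a subsequence. Fatou's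
  lemma then upgrades the pointwise limit to a limit in the direct integral.\<close>

lemma HH_complete:
  assumes s: "\<And>n. s n \<in> hcarrier HH"
    and cauchy: "\<forall>e>0. \<exists>N. \<forall>m\<ge>N. \<forall>n\<ge>N. hnorm HH (s m - s n) < e"
  shows "\<exists>x\<in>hcarrier HH. hlim HH s x"
proof -
  have "\<exists>x\<in>hcarrier (H \<alpha>). hlim (H \<alpha>) (\<lambda>n. s n \<alpha>) x" if \<alpha>: "\<alpha> \<in> space M" for \<alpha>
  proof (rule complete_inner_space.complete[OF fibre[OF \<alpha>]])
    show "s n \<alpha> \<in> hcarrier (H \<alpha>)" for n using s \<alpha> by simp
    define m where "m = measure M {\<alpha>}"
    have em: "emeasure M {\<alpha>} = ennreal m"
      using atom_finite[OF \<alpha>] by (simp add: m_def emeasure_eq_ennreal_measure)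
    then have m: "m > 0" using atom_pos[OF \<alpha>] by simp
    have le: "(hnorm (H \<alpha>) (s k \<alpha> - s n \<alpha>))\<^sup>2 * m \<le> (hnorm HH (s k - s n))\<^sup>2" for k n
    proof -
      have "ennreal (w (s k - s n) \<alpha>) * ennreal m \<le> ennreal ((hnorm HH (s k - s n))\<^sup>2)"
        unfolding ennreal_hnorm_HH[OF HC_diff[OF s s]] em[symmetric]
        by (rule point_le[OF \<alpha>])
      then show ?thesis using m by (simp add: ennreal_mult[symmetric])
    qed
    show "\<forall>e>0. \<exists>N. \<forall>k\<ge>N. \<forall>n\<ge>N. hnorm (H \<alpha>) (s k \<alpha> - s n \<alpha>) < e"
    proof (intro allI impI)
      fix e :: real assume e: "e > 0"
      \<comment> \<open>The factor \<open>sqrt m\<close> compensates the mass lost in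
        \<open>le\<close>.\<close>
      then have "e * sqrt m > 0" using m by simp
      then obtain N where N: "\<And>k n. k \<ge> N \<Longrightarrow> n \<ge> N \<Longrightarrow> hnorm HH (s k - s n) < e * sqrt m"
        using cauchy by meson
      have "hnorm (H \<alpha>) (s k \<alpha> - s n \<alpha>) < e" if "k \<ge> N" "n \<ge> N" for k n
      proof (rule power2_less_imp_less)
        have "(hnorm HH (s k - s n))\<^sup>2 < (e * sqrt m)\<^sup>2"
          by (rule power_strict_mono[OF N[OF that] hnorm_HH_nonneg[OF HC_diff[OF s s]]]) simp
        then have "(hnorm (H \<alpha>) (s k \<alpha> - s n \<alpha>))\<^sup>2 * m < e\<^sup>2 * m"
          using m by (intro order_le_less_trans[OF le[of k n]]) (simp add: power_mult_distrib)
        then show "(hnorm (H \<alpha>) (s k \<alpha> - s n \<alpha>))\<^sup>2 < e\<^sup>2" using m by simp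
      qed (use e in simp)
      then show "\<exists>N. \<forall>k\<ge>N. \<forall>n\<ge>N. hnorm (H \<alpha>) (s k \<alpha> - s n \<alpha>) < e" by blast
    qed
  qed
  then obtain x0 where x0: "\<And>\<alpha>. \<alpha> \<in> space M \<Longrightarrow> x0 \<alpha> \<in> hcarrier (H \<alpha>)"
    "\<And>\<alpha>. \<alpha> \<in> space M \<Longrightarrow> hlim (H \<alpha>) (\<lambda>n. s n \<alpha>) (x0 \<alpha>)" by metis
  \<comment> \<open>The chosen x0 is arbitrary off \<open>space M\<close>, whereas sections have to
    vanish there.\<close>
  define x where "x \<alpha> = (if \<alpha> \<in> space M then x0 \<alpha> else 0)" for \<alpha>
  have x: "\<And>\<alpha>. \<alpha> \<in> space M \<Longrightarrow> x \<alpha> \<in> hcarrier (H \<alpha>)" "\<And>\<alpha>. \<alpha> \<notin> space M \<Longrightarrow> x \<alpha> = 0"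
    using x0 by (simp_all add: x_def)
  \<comment> \<open>The nonnegative integral is used because x is not yet known to be
    square-integrable. Radius 1 shows that s N1 - x, and hence x, lies in the direct integral; small
    radii give convergence.\<close>
  have fatou: "(\<integral>\<^sup>+\<alpha>. ennreal (w (s n - x) \<alpha>) \<partial>M) \<le> ennreal (e\<^sup>2)"
    if N: "\<And>m n. m \<ge> N \<Longrightarrow> n \<ge> N \<Longrightarrow> hnorm HH (s n - s m) < e" and n: "n \<ge> N" and e: "e > 0" for N n e
  proof -
    have lim: "(\<lambda>m. ennreal (w (s n - s m) \<alpha>)) \<longlonglongrightarrow> ennreal (w (s n - x) \<alpha>)" if \<alpha>: "\<alpha> \<in> space M" for \<alpha>
    proof -
      interpret F: complete_inner_space "H \<alpha>" using fibre[OF \<alpha>] .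
      have "hlim (H \<alpha>) (\<lambda>m. s n \<alpha> - s m \<alpha>) (s n \<alpha> - x \<alpha>)"
        using x0[OF \<alpha>] \<alpha> s F.nm_minus_commute[of "x \<alpha>" "s _ \<alpha>"]
        by (simp add: hlim_def x_def algebra_simps)
      then have "(\<lambda>m. hnorm (H \<alpha>) (s n \<alpha> - s m \<alpha>)) \<longlonglongrightarrow> hnorm (H \<alpha>) (s n \<alpha> - x \<alpha>)"
        using x0[OF \<alpha>] \<alpha> s by (intro F.hlim_nm) (auto simp: x_def)
      then show ?thesis by (auto intro!: tendsto_intros)
    qed
    have "(\<integral>\<^sup>+\<alpha>. ennreal (w (s n - x) \<alpha>) \<partial>M) = (\<integral>\<^sup>+\<alpha>. liminf (\<lambda>m. ennreal (w (s n - s m) \<alpha>)) \<partial>M)"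
      by (intro nn_integral_cong lim_imp_Liminf[OF _ lim, symmetric]) auto
    also have "\<dots> \<le> liminf (\<lambda>m. \<integral>\<^sup>+\<alpha>. ennreal (w (s n - s m) \<alpha>) \<partial>M)"
      by (rule nn_integral_liminf) simp
    also have "\<dots> \<le> liminf (\<lambda>m::nat. ennreal (e\<^sup>2))"
    proof (rule Liminf_mono, rule eventually_sequentiallyI[of N])
      fix m assume "m \<ge> N"
      then have "hnorm HH (s n - s m) < e" using N n by blast
      then have "(hnorm HH (s n - s m))\<^sup>2 \<le> e\<^sup>2"
        by (intro power_mono hnorm_HH_nonneg HC_diff s) simp
      then show "(\<integral>\<^sup>+\<alpha>. ennreal (w (s n - s m) \<alpha>) \<partial>M) \<le> ennreal (e\<^sup>2)"
        unfolding ennreal_hnorm_HH[OF HC_diff[OF s s], symmetric] by (rule ennreal_leI)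
    qed
    finally show ?thesis by (simp add: Liminf_const)
  qed
  obtain N1 where N1: "\<And>m n. m \<ge> N1 \<Longrightarrow> n \<ge> N1 \<Longrightarrow> hnorm HH (s n - s m) < 1"
    using cauchy by (meson zero_less_one)
  have "s N1 - x \<in> hcarrier HH"
  proof (rule HC_I)
    show "(\<integral>\<^sup>+\<alpha>. ennreal (w (s N1 - x) \<alpha>) \<partial>M) < \<infinity>"
      using order_le_less_trans[OF fatou[OF N1 order_refl zero_less_one] ennreal_less_top] by simp
  qed (use s x HC_outside[OF s] in auto)
  then have xH: "x \<in> hcarrier HH"
    using HC_diff[OF s[of N1], of "s N1 - x"] by simp
  have "hlim HH s x"
    unfolding hlim_def
  proof (rule LIMSEQ_I)
    fix r :: real assume r: "0 < r"
    then have r2: "r / 2 > 0" by simp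
    obtain N where N: "\<And>m n. m \<ge> N \<Longrightarrow> n \<ge> N \<Longrightarrow> hnorm HH (s n - s m) < r / 2"
      using cauchy r2 by meson
    have "norm (hnorm HH (s n - x) - 0) < r" if "n \<ge> N" for n
    proof -
      have "ennreal ((hnorm HH (s n - x))\<^sup>2) \<le> ennreal ((r/2)\<^sup>2)"
        using fatou[OF N that r2] ennreal_hnorm_HH[OF HC_diff[OF s xH], of n] by simp
      then have "(hnorm HH (s n - x))\<^sup>2 \<le> (r/2)\<^sup>2" by simp
      then have "\<bar>hnorm HH (s n - x)\<bar> \<le> \<bar>r/2\<bar>" by (simp only: abs_le_square_iff)
      then show ?thesis using r by simp
    qed
    then show "\<exists>N. \<forall>n\<ge>N. norm (hnorm HH (s n - x) - 0) < r" by blast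
  qed
  then show ?thesis using xH by blast
qed

lemma HH_complete_inner_space: "complete_inner_space HH"
proof
  have ip: "hinner HH \<Phi> \<Psi> = (\<integral>\<alpha>. hinner (H \<alpha>) (\<Phi> \<alpha>) (\<Psi> \<alpha>) \<partial>M)" for \<Phi> \<Psi>
    by (simp add: direct_integral_def)
  show "csubspace (hcarrier HH)" by (rule HC_subspace)
  fix x y assume x: "x \<in> hcarrier HH" and y: "y \<in> hcarrier HH"
  show "hinner HH x (y + z) = hinner HH x y + hinner HH x z" if z: "z \<in> hcarrier HH" for z
  proof -
    have "(\<integral>\<alpha>. hinner (H \<alpha>) (x \<alpha>) ((y + z) \<alpha>) \<partial>M)
       = (\<integral>\<alpha>. hinner (H \<alpha>) (x \<alpha>) (y \<alpha>) + hinner (H \<alpha>) (x \<alpha>) (z \<alpha>) \<partial>M)"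
      using x y z by (intro Bochner_Integration.integral_cong)
        (auto simp: complete_inner_space.inner_add_right[OF fibre])
    then show ?thesis using inner_integrable x y z by (simp add: ip)
  qed
  show "hinner HH x (c *\<^sub>C y) = c * hinner HH x y" for c
  proof -
    have "(\<integral>\<alpha>. hinner (H \<alpha>) (x \<alpha>) ((c *\<^sub>C y) \<alpha>) \<partial>M) = (\<integral>\<alpha>. c * hinner (H \<alpha>) (x \<alpha>) (y \<alpha>) \<partial>M)"
      using x y by (intro Bochner_Integration.integral_cong)
        (auto simp: scaleC_fun_def complete_inner_space.inner_scale_right[OF fibre])
    then show ?thesis by (simp add: ip)
  qed
  show "hinner HH x y = cnj (hinner HH y x)"
  proof -
    have "(\<integral>\<alpha>. hinner (H \<alpha>) (x \<alpha>) (y \<alpha>) \<partial>M) = (\<integral>\<alpha>. cnj (hinner (H \<alpha>) (y \<alpha>) (x \<alpha>)) \<partial>M)"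
      using x y by (intro Bochner_Integration.integral_cong refl complete_inner_space.inner_commute[OF fibre]) auto
    then show ?thesis by (simp add: ip)
  qed
next
  fix x assume x: "x \<in> hcarrier HH" and nz: "x \<noteq> 0"
  \<comment> \<open>Definiteness rests on atoms having positive mass: a section that is nonzero at
    one point already has positive norm.\<close>
  obtain \<alpha> where \<alpha>: "x \<alpha> \<noteq> 0" using nz by (auto simp: fun_eq_iff)
  then have sp: "\<alpha> \<in> space M" using HC_outside[OF x] by blast
  interpret F: complete_inner_space "H \<alpha>" using fibre[OF sp] .
  have "w x \<alpha> > 0" using F.nm_eq_0[of "x \<alpha>"] \<alpha> x sp by simp
  then have "0 < ennreal (w x \<alpha>) * emeasure M {\<alpha>}"
    using atom_pos[OF sp] by (simp add: ennreal_zero_less_mult_iff)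
  also have "\<dots> \<le> ennreal ((hnorm HH x)\<^sup>2)"
    unfolding ennreal_hnorm_HH[OF x] by (rule point_le[OF sp])
  finally have "0 < (hnorm HH x)\<^sup>2" by simp
  then have "0 < hnorm HH x"
    using hnorm_HH_nonneg[OF x] by (cases "hnorm HH x = 0") auto
  then show "0 < Re (hinner HH x x)"
    by (simp add: hnorm_def)
qed (use HH_complete in blast)

end

lemma sum_fun_apply: "(\<Sum>i\<in>I. f i) x = (\<Sum>i\<in>I. (f i x :: 'b::comm_monoid_add))"
  by (induction I rule: infinite_finite_induct) auto

locale atomic_pvm = atomic_field M H S
  for M :: "'a measure" and H :: "'a \<Rightarrow> 'v::complex_vector hspace" and S :: "('a \<Rightarrow> 'v) set" +
  fixes E :: "'a \<Rightarrow> real set \<Rightarrow> 'v \<Rightarrow> 'v"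
  assumes fibre_pvm: "\<alpha> \<in> space M \<Longrightarrow> pvm (H \<alpha>) (E \<alpha>)"
begin

section \<open>The decomposable resolution of the identity\<close>

abbreviation "EE \<equiv> direct_integral_pvm M E"

lemma EE_apply: "\<alpha> \<in> space M \<Longrightarrow> EE A \<Phi> \<alpha> = E \<alpha> A (\<Phi> \<alpha>)"
  and EE_outside: "\<alpha> \<notin> space M \<Longrightarrow> EE A \<Phi> \<alpha> = 0"
  by (simp_all add: direct_integral_pvm_def)

lemma EE_C:
  assumes A: "A \<in> sets borel" and \<Phi>: "\<Phi> \<in> hcarrier HH"
  shows "EE A \<Phi> \<in> hcarrier HH"
proof (rule HC_I)
  fix \<alpha> assume \<alpha>: "\<alpha> \<in> space M"
  then show "EE A \<Phi> \<alpha> \<in> hcarrier (H \<alpha>)"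
    using pvm.E_C[OF fibre_pvm[OF \<alpha>] A] \<Phi> by (simp add: EE_apply)
next
  have "(\<integral>\<^sup>+\<alpha>. ennreal (w (EE A \<Phi>) \<alpha>) \<partial>M) \<le> (\<integral>\<^sup>+\<alpha>. ennreal (w \<Phi> \<alpha>) \<partial>M)"
    using pvm.nm_E_le[OF fibre_pvm A] pvm.E_C[OF fibre_pvm A] \<Phi>
    by (intro nn_integral_mono ennreal_leI power_mono) (auto simp: EE_apply)
  also have "\<dots> < \<infinity>" using \<Phi> by simp
  finally show "(\<integral>\<^sup>+\<alpha>. ennreal (w (EE A \<Phi>) \<alpha>) \<partial>M) < \<infinity>" .
qed (simp add: EE_outside)

lemma EE_projection:
  assumes A: "A \<in> sets borel"
  shows "orthogonal_projection HH (EE A)"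
  unfolding orthogonal_projection_def
proof (intro conjI ballI allI)
  fix x y c assume x: "x \<in> hcarrier HH" and y: "y \<in> hcarrier HH"
  show "EE A (x + y) = EE A x + EE A y"
    using x y pvm.E_add[OF fibre_pvm A] by (auto simp: direct_integral_pvm_def fun_eq_iff)
  have "(\<integral>\<alpha>. hinner (H \<alpha>) (EE A x \<alpha>) (y \<alpha>) \<partial>M) = (\<integral>\<alpha>. hinner (H \<alpha>) (x \<alpha>) (EE A y \<alpha>) \<partial>M)"
    using x y pvm.E_sym[OF fibre_pvm A]
    by (intro Bochner_Integration.integral_cong) (auto simp: EE_apply)
  then show "hinner HH (EE A x) y = hinner HH x (EE A y)"
    by (simp add: direct_integral_def)
next
  fix x c assume x: "x \<in> hcarrier HH"
  show "EE A x \<in> hcarrier HH" by (rule EE_C[OF A x])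
  show "EE A (EE A x) = EE A x"
    using x pvm.E_idem[OF fibre_pvm A] by (auto simp: direct_integral_pvm_def fun_eq_iff)
  show "EE A (c *\<^sub>C x) = c *\<^sub>C EE A x"
    using x pvm.E_scale[OF fibre_pvm A] by (auto simp: direct_integral_pvm_def fun_eq_iff scaleC_fun_def)
qed

text \<open>Countable additivity in each fibre makes the defect d n tend to 0 at every atom; a
  majorant independent of n lets dominated convergence integrate this over M.\<close>

lemma EE_countably_additive:
  assumes \<sigma>: "range \<sigma> \<subseteq> sets borel" "disjoint_family \<sigma>" and x: "x \<in> hcarrier HH"
  shows "hlim HH (\<lambda>n. \<Sum>i<n. EE (\<sigma> i) x) (EE (\<Union>i. \<sigma> i) x)"
proof -
  interpret di: complete_inner_space HH by (rule HH_complete_inner_space)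
  have \<sigma>': "\<sigma> i \<in> sets borel" for i using \<sigma>(1) by auto
  have U: "(\<Union>i. \<sigma> i) \<in> sets borel" "(\<Union>i<n. \<sigma> i) \<in> sets borel" for n
    using \<sigma>' by auto
  define d where "d n = (\<Sum>i<n. EE (\<sigma> i) x) - EE (\<Union>i. \<sigma> i) x" for n :: nat
  have d: "d n \<in> hcarrier HH" for n
    unfolding d_def using EE_C \<sigma>' U x by (intro HC_diff di.sum_C) auto
  have d_apply: "d n \<alpha> = (\<Sum>i<n. E \<alpha> (\<sigma> i) (x \<alpha>)) - E \<alpha> (\<Union>i. \<sigma> i) (x \<alpha>)" if "\<alpha> \<in> space M" for n \<alpha>
    using that by (simp add: d_def sum_fun_apply EE_apply)
  have "(\<lambda>n. \<integral>\<alpha>. w (d n) \<alpha> \<partial>M) \<longlonglongrightarrow> (\<integral>\<alpha>. 0 \<partial>M)"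
  \<comment> \<open>In a fibre the defect is a difference of two projections of x \<alpha>, so its
    norm is at most twice that of x \<alpha>; squaring gives 4.\<close>
  proof (rule integral_dominated_convergence[where w = "\<lambda>\<alpha>. 4 * w x \<alpha>"])
    show "AE \<alpha> in M. (\<lambda>n. w (d n) \<alpha>) \<longlonglongrightarrow> 0"
    proof (rule AE_I2)
      fix \<alpha> assume \<alpha>: "\<alpha> \<in> space M"
      have "(\<lambda>n. hnorm (H \<alpha>) (d n \<alpha>)) \<longlonglongrightarrow> 0"
        using pvm.E_countably_additive[OF fibre_pvm[OF \<alpha>] \<sigma> HC_fibre[OF x \<alpha>]] \<alpha>
        by (simp add: hlim_def d_apply)
      from tendsto_power[OF this, of 2] show "(\<lambda>n. w (d n) \<alpha>) \<longlonglongrightarrow> 0" by simp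
    qed
    show "AE \<alpha> in M. norm (w (d n) \<alpha>) \<le> 4 * w x \<alpha>" for n
    proof (rule AE_I2)
      fix \<alpha> assume \<alpha>: "\<alpha> \<in> space M"
      interpret F: pvm "H \<alpha>" "E \<alpha>" using fibre_pvm[OF \<alpha>] .
      have xa: "x \<alpha> \<in> hcarrier (H \<alpha>)" using x \<alpha> by simp
      \<comment> \<open>By finite additivity the partial sum is a single projection, so its norm
        does not grow with n.\<close>
      have eq: "d n \<alpha> = E \<alpha> (\<Union>i<n. \<sigma> i) (x \<alpha>) + (- 1) *\<^sub>C E \<alpha> (\<Union>i. \<sigma> i) (x \<alpha>)"
        using d_apply[OF \<alpha>] F.E_sum[OF \<sigma>' \<sigma>(2) xa]
        by (simp add: complex_vector.scale_minus_left scaleC_one)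
      have "hnorm (H \<alpha>) (d n \<alpha>) \<le> hnorm (H \<alpha>) (E \<alpha> (\<Union>i<n. \<sigma> i) (x \<alpha>)) + hnorm (H \<alpha>) (E \<alpha> (\<Union>i. \<sigma> i) (x \<alpha>))"
        unfolding eq using F.nm_triangle[OF F.E_C[OF U(2)[of n] xa] F.scale_C[OF F.E_C[OF U(1) xa], of "- 1"]]
          F.nm_scale[OF F.E_C[OF U(1) xa], of "- 1"] by simp
      also have "\<dots> \<le> 2 * hnorm (H \<alpha>) (x \<alpha>)"
        using F.nm_E_le[OF U(1) xa] F.nm_E_le[OF U(2) xa, of n] by simp
      finally have "w (d n) \<alpha> \<le> (2 * hnorm (H \<alpha>) (x \<alpha>))\<^sup>2"
        using d \<alpha> by (intro power_mono) auto
      then show "norm (w (d n) \<alpha>) \<le> 4 * w x \<alpha>" by (simp add: power_mult_distrib)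
    qed
  qed (use HC_integrable[OF x] in simp_all)
  then have "(\<lambda>n. (hnorm HH (d n))\<^sup>2) \<longlonglongrightarrow> 0"
    by (simp add: hnorm_HH[OF d])
  then have "(\<lambda>n. sqrt ((hnorm HH (d n))\<^sup>2)) \<longlonglongrightarrow> sqrt 0"
    by (rule tendsto_real_sqrt)
  then have "(\<lambda>n. hnorm HH (d n)) \<longlonglongrightarrow> 0"
    using hnorm_HH_nonneg[OF d] by simp
  then show ?thesis by (simp add: hlim_def d_def)
qed

lemma pvm_EE: "pvm HH EE"
proof -
  interpret di: complete_inner_space HH by (rule HH_complete_inner_space)
  show ?thesis
  proof
    show "projection_valued_measure HH EE"
      unfolding projection_valued_measure_def
    proof (intro conjI ballI allI impI)
      fix A :: "real set" assume A: "A \<in> sets borel"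
      show "orthogonal_projection HH (EE A)" using A by (rule EE_projection)
      fix B :: "real set" and x assume B: "B \<in> sets borel" and x: "x \<in> hcarrier HH"
      show "EE (A \<inter> B) x = EE A (EE B x)"
        using x pvm.E_Int[OF fibre_pvm A _ B]
        by (auto simp: direct_integral_pvm_def fun_eq_iff)
    next
      fix x assume x: "x \<in> hcarrier HH"
      show "EE UNIV x = x"
        using x pvm.E_UNIV[OF fibre_pvm] HC_outside[OF x]
        by (auto simp: direct_integral_pvm_def fun_eq_iff)
      fix \<sigma> :: "nat \<Rightarrow> real set" assume "range \<sigma> \<subseteq> sets borel" "disjoint_family \<sigma>"
      then show "hlim HH (\<lambda>n. \<Sum>i<n. EE (\<sigma> i) x) (EE (\<Union>i. \<sigma> i) x)"
        using x by (rule EE_countably_additive)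
    qed
  qed
qed

sublocale di: pvm HH EE
  by (rule pvm_EE)

section \<open>Integrals against the spectral measures of the direct integral\<close>

abbreviation "\<nu> \<alpha> \<Phi> \<equiv> spectral_measure (H \<alpha>) (E \<alpha>) (\<Phi> \<alpha>)"

lemma fibre_measurable:
  assumes "\<alpha> \<in> space M" "u \<in> borel_measurable borel"
  shows "u \<in> borel_measurable (\<nu> \<alpha> \<Phi>)"
  by (subst measurable_cong_sets[OF pvm.sets_\<nu>[OF fibre_pvm[OF assms(1)]] refl]) (rule assms(2))

lemma emeasure_di_\<nu>:
  assumes A: "A \<in> sets borel" and \<Phi>: "\<Phi> \<in> hcarrier HH"
  shows "emeasure (di.\<nu> \<Phi>) A = (\<integral>\<^sup>+\<alpha>. emeasure (\<nu> \<alpha> \<Phi>) A \<partial>M)"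
proof -
  have "emeasure (di.\<nu> \<Phi>) A = (\<integral>\<^sup>+\<alpha>. ennreal (w (EE A \<Phi>) \<alpha>) \<partial>M)"
    using ennreal_hnorm_HH[OF EE_C[OF A \<Phi>]] by (simp add: di.emeasure_\<nu>[OF A \<Phi>])
  also have "\<dots> = (\<integral>\<^sup>+\<alpha>. emeasure (\<nu> \<alpha> \<Phi>) A \<partial>M)"
    using pvm.emeasure_\<nu>[OF fibre_pvm A] \<Phi> by (intro nn_integral_cong) (simp add: EE_apply)
  finally show ?thesis .
qed

text \<open>For indicators this is \<open>emeasure_di_\<nu>\<close>. The inner integrals are
  measurable in \<alpha> because every function on M is, so linearity and monotone convergence can
  be applied at both levels.\<close>

lemma nn_integral_di_\<nu>:
  fixes f :: "real \<Rightarrow> ennreal"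
  assumes f: "f \<in> borel_measurable borel" and \<Phi>: "\<Phi> \<in> hcarrier HH"
  shows "(\<integral>\<^sup>+t. f t \<partial>di.\<nu> \<Phi>) = (\<integral>\<^sup>+\<alpha>. \<integral>\<^sup>+t. f t \<partial>\<nu> \<alpha> \<Phi> \<partial>M)"
  using f
proof (induction rule: borel_measurable_induct)
  case (cong f g)
  then have "f = g" by auto
  with cong show ?case by simp
next
  case (set A)
  then have "(\<integral>\<^sup>+t. indicator A t \<partial>\<nu> \<alpha> \<Phi>) = emeasure (\<nu> \<alpha> \<Phi>) A" if "\<alpha> \<in> space M" for \<alpha>
    using pvm.sets_\<nu>[OF fibre_pvm[OF that]] by (intro nn_integral_indicator) simp
  then show ?case
    using set \<Phi> by (simp add: emeasure_di_\<nu> cong: nn_integral_cong)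
next
  case (mult u c)
  have "(\<integral>\<^sup>+t. c * u t \<partial>\<nu> \<alpha> \<Phi>) = c * (\<integral>\<^sup>+t. u t \<partial>\<nu> \<alpha> \<Phi>)" if "\<alpha> \<in> space M" for \<alpha>
    using mult(2) that by (intro nn_integral_cmult fibre_measurable)
  moreover have "(\<integral>\<^sup>+t. c * u t \<partial>di.\<nu> \<Phi>) = c * (\<integral>\<^sup>+t. u t \<partial>di.\<nu> \<Phi>)"
    using mult(2) by (intro nn_integral_cmult) simp
  moreover have "(\<integral>\<^sup>+t. u t \<partial>di.\<nu> \<Phi>) = (\<integral>\<^sup>+\<alpha>. \<integral>\<^sup>+t. u t \<partial>\<nu> \<alpha> \<Phi> \<partial>M)" by fact
  ultimately show ?case
    by (simp add: nn_integral_cmult[symmetric] cong: nn_integral_cong)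
next
  case (add u v)
  have "(\<integral>\<^sup>+t. v t + u t \<partial>\<nu> \<alpha> \<Phi>) = (\<integral>\<^sup>+t. v t \<partial>\<nu> \<alpha> \<Phi>) + (\<integral>\<^sup>+t. u t \<partial>\<nu> \<alpha> \<Phi>)"
    if "\<alpha> \<in> space M" for \<alpha>
    using add.hyps that by (intro nn_integral_add fibre_measurable)
  moreover have "(\<integral>\<^sup>+t. v t + u t \<partial>di.\<nu> \<Phi>) = (\<integral>\<^sup>+t. v t \<partial>di.\<nu> \<Phi>) + (\<integral>\<^sup>+t. u t \<partial>di.\<nu> \<Phi>)"
    using add.hyps by (intro nn_integral_add) simp_all
  moreover have "(\<integral>\<^sup>+t. u t \<partial>di.\<nu> \<Phi>) = (\<integral>\<^sup>+\<alpha>. \<integral>\<^sup>+t. u t \<partial>\<nu> \<alpha> \<Phi> \<partial>M)" by fact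
  moreover have "(\<integral>\<^sup>+t. v t \<partial>di.\<nu> \<Phi>) = (\<integral>\<^sup>+\<alpha>. \<integral>\<^sup>+t. v t \<partial>\<nu> \<alpha> \<Phi> \<partial>M)" by fact
  ultimately show ?case
    by (simp add: nn_integral_add[symmetric] cong: nn_integral_cong)
next
  case (seq U)
  have U: "U i \<in> borel_measurable borel" for i by fact
  have inc: "incseq U" by fact
  have "(\<integral>\<^sup>+t. (SUP i. U i) t \<partial>\<nu> \<alpha> \<Phi>) = (SUP i. \<integral>\<^sup>+t. U i t \<partial>\<nu> \<alpha> \<Phi>)"
    if "\<alpha> \<in> space M" for \<alpha>
    by (simp add: image_comp nn_integral_monotone_convergence_SUP[OF inc] fibre_measurable[OF that U])
  then have "(\<integral>\<^sup>+\<alpha>. \<integral>\<^sup>+t. (SUP i. U i) t \<partial>\<nu> \<alpha> \<Phi> \<partial>M) = (\<integral>\<^sup>+\<alpha>. (SUP i. \<integral>\<^sup>+t. U i t \<partial>\<nu> \<alpha> \<Phi>) \<partial>M)"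
    by (intro nn_integral_cong)
  also have "\<dots> = (SUP i. \<integral>\<^sup>+\<alpha>. \<integral>\<^sup>+t. U i t \<partial>\<nu> \<alpha> \<Phi> \<partial>M)"
    using inc by (intro nn_integral_monotone_convergence_SUP)
      (auto simp: incseq_def le_fun_def intro!: nn_integral_mono)
  also have "\<dots> = (SUP i. \<integral>\<^sup>+t. U i t \<partial>di.\<nu> \<Phi>)"
  proof -
    have "(\<integral>\<^sup>+t. U i t \<partial>di.\<nu> \<Phi>) = (\<integral>\<^sup>+\<alpha>. \<integral>\<^sup>+t. U i t \<partial>\<nu> \<alpha> \<Phi> \<partial>M)" for i by fact
    then show ?thesis by simp
  qed
  also have "\<dots> = (\<integral>\<^sup>+t. (SUP i. U i) t \<partial>di.\<nu> \<Phi>)"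
    using nn_integral_monotone_convergence_SUP[OF inc, of "di.\<nu> \<Phi>"] U by (simp add: image_comp)
  finally show ?case by simp
qed

lemma spectral_norm_sq_di:
  "\<Phi> \<in> hcarrier HH \<Longrightarrow> spectral_norm_sq HH EE \<Phi> = (\<integral>\<^sup>+\<alpha>. spectral_norm_sq (H \<alpha>) (E \<alpha>) (\<Phi> \<alpha>) \<partial>M)"
  unfolding spectral_norm_sq_def by (rule nn_integral_di_\<nu>) auto

lemma field_norm_sq_di:
  "\<Phi> \<in> hcarrier HH \<Longrightarrow> field_norm_sq M H S E \<Phi> = spectral_norm_sq HH EE \<Phi>"
  by (simp add: field_norm_sq_def di.spectral_norm_sq_alt nn_integral_di_\<nu>)

text \<open>Bochner integrals have no finiteness built in, so the disintegration is read through
  nonnegative integrals, where it is unconditional.\<close>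

lemma integral_di_\<nu>_nonneg:
  fixes g :: "real \<Rightarrow> real"
  assumes g: "g \<in> borel_measurable borel" "\<And>t. 0 \<le> g t" and \<Phi>: "\<Phi> \<in> hcarrier HH"
    and fin: "(\<integral>\<^sup>+t. ennreal (g t) \<partial>di.\<nu> \<Phi>) < \<infinity>"
  shows "integrable M (\<lambda>\<alpha>. \<integral>t. g t \<partial>\<nu> \<alpha> \<Phi>)"
    and "(\<integral>t. g t \<partial>di.\<nu> \<Phi>) = (\<integral>\<alpha>. \<integral>t. g t \<partial>\<nu> \<alpha> \<Phi> \<partial>M)"
    and "\<alpha> \<in> space M \<Longrightarrow> integrable (\<nu> \<alpha> \<Phi>) g"
proof -
  have eq: "(\<integral>\<^sup>+t. ennreal (g t) \<partial>di.\<nu> \<Phi>) = (\<integral>\<^sup>+\<alpha>. \<integral>\<^sup>+t. ennreal (g t) \<partial>\<nu> \<alpha> \<Phi> \<partial>M)"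
    using g \<Phi> by (intro nn_integral_di_\<nu>) auto
  \<comment> \<open>Finiteness holds at every atom, not only almost everywhere, because the positive
    mass can be cancelled.\<close>
  have finite: "(\<integral>\<^sup>+t. ennreal (g t) \<partial>\<nu> \<alpha> \<Phi>) < \<infinity>" if \<alpha>: "\<alpha> \<in> space M" for \<alpha>
  proof -
    have "(\<integral>\<^sup>+t. ennreal (g t) \<partial>\<nu> \<alpha> \<Phi>) * emeasure M {\<alpha>} < \<infinity>"
      using point_le[OF \<alpha>, of "\<lambda>\<alpha>. \<integral>\<^sup>+t. ennreal (g t) \<partial>\<nu> \<alpha> \<Phi>"] fin unfolding eq
      by (rule order_le_less_trans)
    then show ?thesis using atom_pos[OF \<alpha>] by (auto simp: ennreal_mult_less_top)
  qed
  have gm: "g \<in> borel_measurable (\<nu> \<alpha> \<Phi>)" if "\<alpha> \<in> space M" for \<alpha>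
    using that g(1) by (rule fibre_measurable)
  show int: "integrable (\<nu> \<alpha> \<Phi>) g" if "\<alpha> \<in> space M" for \<alpha>
    using finite[OF that] gm[OF that] g(2) by (simp add: integrable_iff_bounded)
  have inner: "(\<integral>\<^sup>+t. ennreal (g t) \<partial>\<nu> \<alpha> \<Phi>) = ennreal (\<integral>t. g t \<partial>\<nu> \<alpha> \<Phi>)" if "\<alpha> \<in> space M" for \<alpha>
    using int[OF that] g(2) by (intro nn_integral_eq_integral) auto
  have eq2: "(\<integral>\<^sup>+t. ennreal (g t) \<partial>di.\<nu> \<Phi>) = (\<integral>\<^sup>+\<alpha>. ennreal (\<integral>t. g t \<partial>\<nu> \<alpha> \<Phi>) \<partial>M)"
    unfolding eq by (intro nn_integral_cong inner)
  have pos: "0 \<le> (\<integral>t. g t \<partial>\<nu> \<alpha> \<Phi>)" for \<alpha> using g(2) by simp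
  show I: "integrable M (\<lambda>\<alpha>. \<integral>t. g t \<partial>\<nu> \<alpha> \<Phi>)"
    using fin pos unfolding eq2 by (simp add: integrable_iff_bounded)
  have "ennreal (\<integral>t. g t \<partial>di.\<nu> \<Phi>) = (\<integral>\<^sup>+t. ennreal (g t) \<partial>di.\<nu> \<Phi>)"
    using g fin by (intro nn_integral_eq_integral[symmetric]) (auto simp: integrable_iff_bounded)
  also have "\<dots> = ennreal (\<integral>\<alpha>. \<integral>t. g t \<partial>\<nu> \<alpha> \<Phi> \<partial>M)"
    unfolding eq2 using I pos by (intro nn_integral_eq_integral) auto
  finally show "(\<integral>t. g t \<partial>di.\<nu> \<Phi>) = (\<integral>\<alpha>. \<integral>t. g t \<partial>\<nu> \<alpha> \<Phi> \<partial>M)"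
    using pos g(2) by (subst (asm) ennreal_inj) (auto intro!: Bochner_Integration.integral_nonneg)
qed

text \<open>The signed integrand is split into positive and negative part; membership in the form
  domain makes |t| integrable, which bounds both.\<close>

lemma integral_di_\<nu>:
  assumes \<Phi>: "\<Phi> \<in> di.dm di.sq"
  shows "integrable M (\<lambda>\<alpha>. \<integral>t. t \<partial>\<nu> \<alpha> \<Phi>)"
    and "(\<integral>t. t \<partial>di.\<nu> \<Phi>) = (\<integral>\<alpha>. \<integral>t. t \<partial>\<nu> \<alpha> \<Phi> \<partial>M)"
proof -
  have \<Phi>C: "\<Phi> \<in> hcarrier HH" using \<Phi> by (rule di.dm_C)
  define p where "p t = max t 0" for t :: real
  define n where "n t = max (- t) 0" for t :: real
  have pn: "t = p t - n t" for t by (simp add: p_def n_def)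
  have m [measurable]: "p \<in> borel_measurable borel" "n \<in> borel_measurable borel"
    unfolding p_def[abs_def] n_def[abs_def] by measurable
  have nonneg: "0 \<le> p t" "0 \<le> n t" for t by (simp_all add: p_def n_def)
  have bound: "p t \<le> \<bar>t\<bar>" "n t \<le> \<bar>t\<bar>" for t by (simp_all add: p_def n_def)
  have fin: "(\<integral>\<^sup>+t. ennreal \<bar>t\<bar> \<partial>di.\<nu> \<Phi>) < \<infinity>"
    using \<Phi> by (simp add: di.dm_iff)
  have pf: "(\<integral>\<^sup>+t. ennreal (p t) \<partial>di.\<nu> \<Phi>) < \<infinity>" and nf: "(\<integral>\<^sup>+t. ennreal (n t) \<partial>di.\<nu> \<Phi>) < \<infinity>"
    by (rule order_le_less_trans[OF nn_integral_mono fin], simp add: bound ennreal_leI)+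
  note P = integral_di_\<nu>_nonneg[OF m(1) nonneg(1) \<Phi>C pf]
  note N = integral_di_\<nu>_nonneg[OF m(2) nonneg(2) \<Phi>C nf]
  have inner: "(\<integral>t. t \<partial>\<nu> \<alpha> \<Phi>) = (\<integral>t. p t \<partial>\<nu> \<alpha> \<Phi>) - (\<integral>t. n t \<partial>\<nu> \<alpha> \<Phi>)" if "\<alpha> \<in> space M" for \<alpha>
    using P(3)[OF that] N(3)[OF that] by (subst pn) simp
  have "integrable M (\<lambda>\<alpha>. (\<integral>t. p t \<partial>\<nu> \<alpha> \<Phi>) - (\<integral>t. n t \<partial>\<nu> \<alpha> \<Phi>))"
    using P(1) N(1) by simp
  then show "integrable M (\<lambda>\<alpha>. \<integral>t. t \<partial>\<nu> \<alpha> \<Phi>)"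
    by (rule Bochner_Integration.integrable_cong[THEN iffD1, rotated -1]) (simp_all add: inner)
  have "integrable (di.\<nu> \<Phi>) p" "integrable (di.\<nu> \<Phi>) n"
    using pf nf nonneg by (simp_all add: integrable_iff_bounded)
  then have "(\<integral>t. t \<partial>di.\<nu> \<Phi>) = (\<integral>t. p t \<partial>di.\<nu> \<Phi>) - (\<integral>t. n t \<partial>di.\<nu> \<Phi>)"
    by (subst pn) simp
  also have "\<dots> = (\<integral>\<alpha>. (\<integral>t. p t \<partial>\<nu> \<alpha> \<Phi>) - (\<integral>t. n t \<partial>\<nu> \<alpha> \<Phi>) \<partial>M)"
    using P(1,2) N(1,2) by simp
  also have "\<dots> = (\<integral>\<alpha>. \<integral>t. t \<partial>\<nu> \<alpha> \<Phi> \<partial>M)"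
    by (intro Bochner_Integration.integral_cong) (simp_all add: inner)
  finally show "(\<integral>t. t \<partial>di.\<nu> \<Phi>) = (\<integral>\<alpha>. \<integral>t. t \<partial>\<nu> \<alpha> \<Phi> \<partial>M)" .
qed

end

section \<open>Exhaustion by finite sets of atoms\<close>

context atomic_field
begin

lemma block_C:
  assumes "\<Phi> \<in> hcarrier HH" shows "block_proj \<Delta> \<Phi> \<in> hcarrier HH"
proof (rule HC_I)
  fix \<alpha> show "\<alpha> \<in> space M \<Longrightarrow> block_proj \<Delta> \<Phi> \<alpha> \<in> hcarrier (H \<alpha>)"
    "\<alpha> \<notin> space M \<Longrightarrow> block_proj \<Delta> \<Phi> \<alpha> = 0"
    using assms HC_outside[OF assms] by (simp_all add: block_proj_def)
next
  have "(\<integral>\<^sup>+\<alpha>. ennreal (w (block_proj \<Delta> \<Phi>) \<alpha>) \<partial>M) \<le> (\<integral>\<^sup>+\<alpha>. ennreal (w \<Phi> \<alpha>) \<partial>M)"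
    by (intro nn_integral_mono) (simp add: block_proj_def)
  then show "(\<integral>\<^sup>+\<alpha>. ennreal (w (block_proj \<Delta> \<Phi>) \<alpha>) \<partial>M) < \<infinity>"
    using assms by (simp add: order_le_less_trans)
qed

text \<open>The atoms with index below n in a fixed enumeration; for a finite space the sequence
  becomes constant, so no case distinction is needed.\<close>

definition fin_part :: "nat \<Rightarrow> 'a set"
  where "fin_part n = {\<alpha> \<in> space M. to_nat_on (space M) \<alpha> < n}"

lemma fin_part_subset: "fin_part n \<subseteq> space M"
  by (auto simp: fin_part_def)

lemma finite_fin_part: "finite (fin_part n)"
proof (rule finite_imageD)
  show "finite (to_nat_on (space M) ` fin_part n)"
    by (rule finite_subset[of _ "{..<n}"]) (auto simp: fin_part_def)
  show "inj_on (to_nat_on (space M)) (fin_part n)"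
    using inj_on_to_nat_on[OF countable_space] fin_part_subset by (rule inj_on_subset)
qed

lemma fin_part_mono: "n \<le> m \<Longrightarrow> fin_part n \<subseteq> fin_part m"
  by (auto simp: fin_part_def)

lemma eventually_fin_part: "\<alpha> \<in> space M \<Longrightarrow> \<forall>\<^sub>F n in sequentially. \<alpha> \<in> fin_part n"
  by (intro eventually_sequentiallyI[of "Suc (to_nat_on (space M) \<alpha>)"]) (simp add: fin_part_def)

text \<open>Writes an integral over M as a limit of finite weighted sums, the form in which
  orthogonal additivity delivers Q on finitely many atoms.\<close>

lemma fin_part_integral:
  assumes f: "integrable M (f :: 'a \<Rightarrow> real)"
  shows "(\<lambda>n. \<Sum>\<alpha>\<in>fin_part n. f \<alpha> * measure M {\<alpha>}) \<longlonglongrightarrow> (\<integral>\<alpha>. f \<alpha> \<partial>M)"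
proof -
  have "(\<lambda>n. \<integral>\<alpha>. f \<alpha> * indicator (fin_part n) \<alpha> \<partial>M) \<longlonglongrightarrow> (\<integral>\<alpha>. f \<alpha> \<partial>M)"
  proof (rule integral_dominated_convergence[where w = "\<lambda>\<alpha>. \<bar>f \<alpha>\<bar>"])
    show "AE \<alpha> in M. (\<lambda>n. f \<alpha> * indicator (fin_part n) \<alpha>) \<longlonglongrightarrow> f \<alpha>"
    proof (rule AE_I2, rule tendsto_eventually)
      fix \<alpha> assume "\<alpha> \<in> space M"
      from eventually_fin_part[OF this] show "\<forall>\<^sub>F n in sequentially. f \<alpha> * indicator (fin_part n) \<alpha> = f \<alpha>"
        by eventually_elim simp
    qed
    show "AE \<alpha> in M. norm (f \<alpha> * indicator (fin_part n) \<alpha>) \<le> \<bar>f \<alpha>\<bar>" for n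
      by (auto simp: indicator_def)
  qed (use f in simp_all)
  moreover have "(\<integral>\<alpha>. f \<alpha> * indicator (fin_part n) \<alpha> \<partial>M) = (\<Sum>\<alpha>\<in>fin_part n. f \<alpha> * measure M {\<alpha>})" for n
    using finite_fin_part fin_part_subset atom_finite
    by (intro integral_indicator_finite_real) (auto simp: sets_Pow)
  ultimately show ?thesis by simp
qed

lemma fin_part_tail:
  assumes f: "(\<integral>\<^sup>+\<alpha>. f \<alpha> \<partial>M) < \<infinity>"
  shows "(\<lambda>n. \<integral>\<^sup>+\<alpha>. f \<alpha> * indicator (- fin_part n) \<alpha> \<partial>M) \<longlonglongrightarrow> 0"
proof -
  have "(\<lambda>n. \<integral>\<^sup>+\<alpha>. f \<alpha> * indicator (- fin_part n) \<alpha> \<partial>M) \<longlonglongrightarrow> (\<integral>\<^sup>+\<alpha>. 0 \<partial>M)"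
  proof (rule nn_integral_dominated_convergence[where w = f])
    show "AE \<alpha> in M. (\<lambda>n. f \<alpha> * indicator (- fin_part n) \<alpha>) \<longlonglongrightarrow> 0"
    proof (rule AE_I2, rule tendsto_eventually)
      fix \<alpha> assume "\<alpha> \<in> space M"
      from eventually_fin_part[OF this]
      show "\<forall>\<^sub>F n in sequentially. f \<alpha> * indicator (- fin_part n) \<alpha> = 0"
        by eventually_elim simp
    qed
    show "AE \<alpha> in M. f \<alpha> * indicator (- fin_part n) \<alpha> \<le> f \<alpha>" for n
      by (auto simp: indicator_def)
  qed (use f in simp_all)
  then show ?thesis by simp
qed

lemma hlim_block_tail:
  assumes \<Phi>: "\<Phi> \<in> hcarrier HH"
  shows "hlim HH (\<lambda>n. block_proj (space M - fin_part n) \<Phi>) 0"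
proof -
  have "(\<integral>\<^sup>+\<alpha>. ennreal (w (block_proj (space M - fin_part n) \<Phi>) \<alpha>) \<partial>M)
      = (\<integral>\<^sup>+\<alpha>. ennreal (w \<Phi> \<alpha>) * indicator (- fin_part n) \<alpha> \<partial>M)" for n
    by (intro nn_integral_cong) (simp add: block_proj_def indicator_def)
  then have "(\<lambda>n. ennreal ((hnorm HH (block_proj (space M - fin_part n) \<Phi>))\<^sup>2)) \<longlonglongrightarrow> ennreal 0"
    using fin_part_tail[of "\<lambda>\<alpha>. ennreal (w \<Phi> \<alpha>)"] \<Phi>
    by (simp add: ennreal_hnorm_HH[OF block_C[OF \<Phi>]])
  then have "(\<lambda>n. (hnorm HH (block_proj (space M - fin_part n) \<Phi>))\<^sup>2) \<longlonglongrightarrow> 0"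
    by (subst (asm) tendsto_ennreal_iff) auto
  then have "(\<lambda>n. sqrt ((hnorm HH (block_proj (space M - fin_part n) \<Phi>))\<^sup>2)) \<longlonglongrightarrow> sqrt 0"
    by (rule tendsto_real_sqrt)
  then show ?thesis
    using hnorm_HH_nonneg[OF block_C[OF \<Phi>]] by (simp add: hlim_def)
qed

end

section \<open>Orthogonal additivity on finite blocks and symmetry of Q\<close>

lemma orthogonally_additive_Un:
  assumes oa: "orthogonally_additive M D Q" and "A \<in> sets M" "B \<in> sets M" "A \<inter> B = {}" "\<Phi> \<in> D"
  shows "Q (block_proj (A \<union> B) \<Phi>) = Q (block_proj A \<Phi>) + Q (block_proj B \<Phi>)"
proof -
  \<comment> \<open>The two blocks become an indexed partition with N = 2; only the indices 0 and 1
    are read.\<close>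
  define d where "d i = (if i = (0::nat) then A else B)" for i
  have rule: "\<And>\<Delta> (N::nat) d. \<Delta> \<in> sets M \<Longrightarrow> (\<forall>i<N. d i \<in> sets M) \<Longrightarrow> disjoint_family_on d {..<N} \<Longrightarrow>
      (\<Union>i<N. d i) = \<Delta> \<Longrightarrow> Q (block_proj \<Delta> \<Phi>) = (\<Sum>i<N. Q (block_proj (d i) \<Phi>))"
    using oa assms(5) unfolding orthogonally_additive_def by blast
  have "Q (block_proj (A \<union> B) \<Phi>) = (\<Sum>i<Suc (Suc 0). Q (block_proj (d i) \<Phi>))"
    using assms(2-4)
    by (intro rule) (auto simp: d_def disjoint_family_on_def lessThan_Suc)
  then show ?thesis by (simp add: d_def)
qed

text \<open>The empty set is partitioned into two empty blocks, so the value q satisfies q = q +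
  q.\<close>

lemma orthogonally_additive_empty:
  assumes oa: "orthogonally_additive M D Q" and "\<Phi> \<in> D"
  shows "Q (block_proj {} \<Phi>) = 0"
  using orthogonally_additive_Un[OF oa _ _ _ assms(2), of "{}" "{}"] by simp

lemma orthogonally_additive_finite:
  assumes oa: "orthogonally_additive M D Q" and \<Phi>: "\<Phi> \<in> D"
    and "finite A" "\<And>\<alpha>. \<alpha> \<in> A \<Longrightarrow> {\<alpha>} \<in> sets M"
  shows "Q (block_proj A \<Phi>) = (\<Sum>\<alpha>\<in>A. Q (block_proj {\<alpha>} \<Phi>))"
  using assms(3,4)
proof (induction A rule: finite_induct)
  case empty
  show ?case using orthogonally_additive_empty[OF oa \<Phi>] by simp
next
  case (insert \<alpha> A)
  have "(\<Union>\<beta>\<in>A. {\<beta>}) \<in> sets M"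
    using insert by (intro sets.finite_UN) auto
  then have "Q (block_proj ({\<alpha>} \<union> A) \<Phi>) = Q (block_proj {\<alpha>} \<Phi>) + Q (block_proj A \<Phi>)"
    using insert by (intro orthogonally_additive_Un[OF oa _ _ _ \<Phi>]) auto
  then show ?case using insert by simp
qed

text \<open>The Cauchy condition in \<open>closable_form\<close> compares tails in both orders, but
  a difference of tails is a block projection in one order only; evenness of Q supplies the
  other.\<close>

lemma hermitian_quadratic_form_minus:
  assumes "hermitian_quadratic_form H D Q" "x \<in> D"
  shows "Q (- x) = Q x"
proof -
  obtain B where D: "csubspace D"
    and B: "\<And>c x y. x \<in> D \<Longrightarrow> y \<in> D \<Longrightarrow> B x (c *\<^sub>C y) = c * B x y"
      "\<And>x y. x \<in> D \<Longrightarrow> y \<in> D \<Longrightarrow> B x y = cnj (B y x)"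
      "\<And>x. x \<in> D \<Longrightarrow> complex_of_real (Q x) = B x x"
    using assms(1) unfolding hermitian_quadratic_form_def by metis
  have m: "- x = (-1) *\<^sub>C x" by (simp add: complex_vector.scale_minus_left scaleC_one)
  have mx: "- x \<in> D" using D assms(2) by (rule complex_vector.subspace_neg)
  have minus: "B y (- x) = - B y x" if "y \<in> D" for y
    using B(1)[OF that assms(2), of "-1"] unfolding m[symmetric] by simp
  have "complex_of_real (Q (- x)) = - cnj (B x (- x))"
    using minus[OF mx] B(2)[OF mx assms(2)] B(3)[OF mx] by simp
  also have "\<dots> = complex_of_real (Q x)"
    using minus[OF assms(2)] B(3)[OF assms(2), symmetric] by simp
  finally show ?thesis by (simp only: of_real_eq_iff)
qed

section \<open>Density of D in the form domain and identification of Q\<close>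

context atomic_pvm
begin

text \<open>The error is split at a finite set F of atoms: outside F the approximant is 0 and the
  error is a tail of a convergent integral; on F each fibre error is at most \<delta>, hence the
  total at most \<delta> times the finite mass of F.\<close>

lemma spectral_norm_sq_dense:
  assumes D: "csubspace D" "D \<subseteq> hcarrier HH"
    and block: "\<And>\<alpha> \<Psi>. \<alpha> \<in> space M \<Longrightarrow> \<Psi> \<in> D \<Longrightarrow> block_proj {\<alpha>} \<Psi> \<in> D"
    and dense: "\<And>\<alpha> u e. \<alpha> \<in> space M \<Longrightarrow> u \<in> spectral_dom (H \<alpha>) (E \<alpha>) (\<lambda>t. sqrt \<bar>t\<bar>) \<Longrightarrow> 0 < e \<Longrightarrow>
      \<exists>\<Psi>\<in>D. spectral_norm_sq (H \<alpha>) (E \<alpha>) (u - \<Psi> \<alpha>) < e"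
    and \<Phi>: "\<Phi> \<in> di.dm di.sq" and e: "0 < e"
  shows "\<exists>\<Psi>\<in>D. spectral_norm_sq HH EE (\<Phi> - \<Psi>) < e"
proof -
  define N where "N \<alpha> u = spectral_norm_sq (H \<alpha>) (E \<alpha>) u" for \<alpha> u
  have \<Phi>C: "\<Phi> \<in> hcarrier HH" using \<Phi> by (rule di.dm_C)
  have fin: "(\<integral>\<^sup>+\<alpha>. N \<alpha> (\<Phi> \<alpha>) \<partial>M) < \<infinity>"
    using \<Phi> unfolding di.dm_sq_iff N_def spectral_norm_sq_di[OF \<Phi>C] by blast
  have e4: "0 < e / 4" using e by (simp add: ennreal_zero_less_divide)
  have "\<forall>\<^sub>F n in sequentially. (\<integral>\<^sup>+\<alpha>. N \<alpha> (\<Phi> \<alpha>) * indicator (- fin_part n) \<alpha> \<partial>M) < e / 4"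
    using fin_part_tail[OF fin] e4 by (rule order_tendstoD)
  then obtain n where tail: "(\<integral>\<^sup>+\<alpha>. N \<alpha> (\<Phi> \<alpha>) * indicator (- fin_part n) \<alpha> \<partial>M) < e / 4"
    by (auto simp: eventually_sequentially)
  define F where "F = fin_part n"
  have F: "finite F" "F \<subseteq> space M"
    using finite_fin_part fin_part_subset by (simp_all add: F_def)
  have "emeasure M F = (\<Sum>\<alpha>\<in>F. emeasure M {\<alpha>})"
    using F by (intro emeasure_eq_sum_singleton) (auto simp: sets_Pow)
  also have "\<dots> < \<infinity>"
    using F atom_finite by (auto simp: ennreal_sum_less_top subset_iff)
  finally have "emeasure M F < \<infinity>" .
  then obtain c where c: "emeasure M F = ennreal c" "0 \<le> c"
    by (cases "emeasure M F") auto
  \<comment> \<open>As e may be \<infinity>, a finite positive number below e / 4 is inserted before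
    dividing.\<close>
  obtain q where q: "0 < q" "q < e / 4" using dense_order_class.dense[OF e4] by blast
  then obtain r where r: "q = ennreal r" "0 < r"
    by (cases q) auto
  \<comment> \<open>Dividing by c + 1 rather than c covers an empty F, whose mass c is 0.\<close>
  define \<delta> where "\<delta> = ennreal (r / (c + 1))"
  have \<delta>: "0 < \<delta>" using r c by (simp add: \<delta>_def)
  have "r / (c + 1) * c \<le> r" using r c by (simp add: field_simps)
  then have \<delta>F: "\<delta> * emeasure M F < e / 4"
    using q r c by (simp add: \<delta>_def ennreal_mult[symmetric] order_le_less_trans[OF ennreal_leI])
  have "\<exists>\<Psi>\<in>D. N \<alpha> (\<Phi> \<alpha> - \<Psi> \<alpha>) < \<delta>" if \<alpha>: "\<alpha> \<in> space M" for \<alpha>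
    unfolding N_def
  proof (rule dense[OF \<alpha> _ \<delta>])
    interpret P: pvm "H \<alpha>" "E \<alpha>" using fibre_pvm[OF \<alpha>] .
    have "N \<alpha> (\<Phi> \<alpha>) * emeasure M {\<alpha>} < \<infinity>"
      using point_le[OF \<alpha>, of "\<lambda>\<alpha>. N \<alpha> (\<Phi> \<alpha>)"] fin by (rule order_le_less_trans)
    then have "N \<alpha> (\<Phi> \<alpha>) < \<infinity>" using atom_pos[OF \<alpha>] by (auto simp: ennreal_mult_less_top)
    then show "\<Phi> \<alpha> \<in> P.dm P.sq"
      using P.dm_sq_iff[of "\<Phi> \<alpha>"] \<Phi>C \<alpha> by (simp add: N_def)
  qed
  then obtain \<psi> where \<psi>: "\<And>\<alpha>. \<alpha> \<in> space M \<Longrightarrow> \<psi> \<alpha> \<in> D"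
    "\<And>\<alpha>. \<alpha> \<in> space M \<Longrightarrow> N \<alpha> (\<Phi> \<alpha> - \<psi> \<alpha> \<alpha>) < \<delta>"
    by metis
  \<comment> \<open>Each \<open>\<psi> \<alpha>\<close> is a whole section of D that is good only at
    \<alpha>. The block projection keeps that one value and stays in D, so the finite sum is again
    in D.\<close>
  define \<Psi> where "\<Psi> = (\<Sum>\<alpha>\<in>F. block_proj {\<alpha>} (\<psi> \<alpha>))"
  have \<Psi>D: "\<Psi> \<in> D"
    unfolding \<Psi>_def using F \<psi>(1) block by (intro complex_vector.subspace_sum[OF D(1)]) auto
  have \<Psi>: "\<Psi> \<alpha> = (if \<alpha> \<in> F then \<psi> \<alpha> \<alpha> else 0)" for \<alpha>
  proof -
    have "\<Psi> \<alpha> = (\<Sum>\<beta>\<in>F. if \<beta> = \<alpha> then \<psi> \<beta> \<alpha> else 0)"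
      unfolding \<Psi>_def sum_fun_apply by (intro sum.cong) (auto simp: block_proj_def)
    then show ?thesis using F(1) by (simp add: sum.delta')
  qed
  have "spectral_norm_sq HH EE (\<Phi> - \<Psi>) = (\<integral>\<^sup>+\<alpha>. N \<alpha> (\<Phi> \<alpha> - \<Psi> \<alpha>) \<partial>M)"
    using \<Phi>C \<Psi>D D(2) HC_diff[of \<Phi> \<Psi>] by (simp add: spectral_norm_sq_di N_def subset_iff)
  also have "\<dots> \<le> (\<integral>\<^sup>+\<alpha>. \<delta> * indicator F \<alpha> + N \<alpha> (\<Phi> \<alpha>) * indicator (- F) \<alpha> \<partial>M)"
    using \<psi>(2) by (intro nn_integral_mono) (auto simp: \<Psi> indicator_def less_imp_le)
  also have "\<dots> = \<delta> * emeasure M F + (\<integral>\<^sup>+\<alpha>. N \<alpha> (\<Phi> \<alpha>) * indicator (- F) \<alpha> \<partial>M)"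
    using F by (simp add: nn_integral_add nn_integral_cmult_indicator sets_Pow)
  \<comment> \<open>The doubling is slack that brings the sum into the shape of
    \<open>ennreal_sum_less_of_quarters\<close>.\<close>
  also have "\<dots> \<le> 2 * (\<delta> * emeasure M F) + 2 * (\<integral>\<^sup>+\<alpha>. N \<alpha> (\<Phi> \<alpha>) * indicator (- F) \<alpha> \<partial>M)"
    by (intro add_mono) (simp_all add: mult_2 add_increasing)
  also have "\<dots> < e"
    using \<delta>F tail by (intro ennreal_sum_less_of_quarters) (simp_all add: F_def)
  finally show ?thesis using \<Psi>D by blast
qed

text \<open>The premise \<open>fibre_eq\<close> is the fibre representation with the division by the
  mass of the atom undone, so that summing it over finitely many atoms gives values of Q.\<close>

lemma form_eq_integral:
  assumes form: "hermitian_quadratic_form HH D Q"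
    and closable: "closable_form HH D Q" and oa: "orthogonally_additive M D Q"
    and fibre_eq: "\<And>\<alpha> \<Phi>. \<alpha> \<in> space M \<Longrightarrow> \<Phi> \<in> D \<Longrightarrow>
      Q (block_proj {\<alpha>} \<Phi>) = (\<integral>t. t \<partial>\<nu> \<alpha> \<Phi>) * measure M {\<alpha>}"
    and D: "D \<subseteq> di.dm di.sq" and \<Phi>: "\<Phi> \<in> D"
  shows "Q \<Phi> = (\<integral>t. t \<partial>di.\<nu> \<Phi>)"
proof -
  have \<Phi>dm: "\<Phi> \<in> di.dm di.sq" using D \<Phi> by blast
  then have \<Phi>C: "\<Phi> \<in> hcarrier HH" by (rule di.dm_C)
  have blockD: "block_proj \<Delta> \<Phi> \<in> D" if "\<Delta> \<subseteq> space M" for \<Delta>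
    using oa \<Phi> that unfolding orthogonally_additive_def by (auto simp: sets_Pow)
  \<comment> \<open>\<open>a n\<close> is the value on the first n atoms, computable fibre by fibre;
    \<open>s n\<close> is the remaining tail. Additivity gives Q \<Phi> = a n + Q (s n), so the
    claim becomes Q (s n) \<longlonglongrightarrow> 0.\<close>
  define a where "a n = Q (block_proj (fin_part n) \<Phi>)" for n
  define s where "s n = block_proj (space M - fin_part n) \<Phi>" for n
  have "a n = (\<Sum>\<alpha>\<in>fin_part n. (\<integral>t. t \<partial>\<nu> \<alpha> \<Phi>) * measure M {\<alpha>})" for n
  proof -
    have "a n = (\<Sum>\<alpha>\<in>fin_part n. Q (block_proj {\<alpha>} \<Phi>))"
      unfolding a_def using finite_fin_part fin_part_subset
      by (intro orthogonally_additive_finite[OF oa \<Phi>]) (auto simp: sets_Pow)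
    also have "\<dots> = (\<Sum>\<alpha>\<in>fin_part n. (\<integral>t. t \<partial>\<nu> \<alpha> \<Phi>) * measure M {\<alpha>})"
      using fin_part_subset \<Phi> by (intro sum.cong fibre_eq) auto
    finally show ?thesis .
  qed
  then have "a = (\<lambda>n. \<Sum>\<alpha>\<in>fin_part n. (\<integral>t. t \<partial>\<nu> \<alpha> \<Phi>) * measure M {\<alpha>})" ..
  then have lim: "a \<longlonglongrightarrow> (\<integral>t. t \<partial>di.\<nu> \<Phi>)"
    using fin_part_integral[OF integral_di_\<nu>(1)[OF \<Phi>dm]] integral_di_\<nu>(2)[OF \<Phi>dm] by simp
  have whole: "block_proj (space M) \<Phi> = \<Phi>"
    using HC_outside[OF \<Phi>C] by (auto simp: block_proj_def fun_eq_iff)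
  have split: "Q (block_proj B \<Phi>) = Q (block_proj A \<Phi>) + Q (block_proj (B - A) \<Phi>)"
    if "A \<subseteq> B" "B \<subseteq> space M" for A B
  proof -
    have "A \<union> (B - A) = B" using that by blast
    then show ?thesis
      using orthogonally_additive_Un[OF oa _ _ _ \<Phi>, of A "B - A"] that by (auto simp: sets_Pow)
  qed
  have Qs: "Q (s n) = Q \<Phi> - a n" for n
    using split[of "fin_part n" "space M"] fin_part_subset whole by (simp add: s_def a_def)
  \<comment> \<open>For n \<le> m the difference of tails is the block of atoms between n and m, so
    its Q-value is an increment of the sequence a.\<close>
  have diff: "Q (s n - s m) = a m - a n" if "n \<le> m" for n m
  proof -
    have "s n - s m = block_proj (fin_part m - fin_part n) \<Phi>"
      using fin_part_mono[OF that] fin_part_subset[of m] by (auto simp: s_def block_proj_def fun_eq_iff)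
    then show ?thesis
      using split[OF fin_part_mono[OF that] fin_part_subset] by (simp add: a_def)
  qed
  have absdiff: "\<bar>Q (s n - s m)\<bar> = \<bar>a m - a n\<bar>" for n m
  proof (cases "n \<le> m")
    case False
    have "s m \<in> D" "s n \<in> D" using blockD by (simp_all add: s_def)
    then have "s m - s n \<in> D"
      using form unfolding hermitian_quadratic_form_def by (simp add: complex_vector.subspace_diff)
    from hermitian_quadratic_form_minus[OF form this] diff[of m n] False
    show ?thesis by simp
  qed (simp add: diff)
  have "(\<lambda>n. Q (s n)) \<longlonglongrightarrow> 0"
  proof (rule closable[unfolded closable_form_def, rule_format])
    show "s n \<in> D" for n using blockD by (simp add: s_def)
    show "hlim HH s 0" using hlim_block_tail[OF \<Phi>C] by (simp add: s_def[abs_def])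
    fix r :: real assume r: "0 < r"
    \<comment> \<open>Convergence of a is exactly the Q-Cauchy condition for the tails, since their
      Q-differences are increments of a.\<close>
    have "Cauchy a" using lim by (rule LIMSEQ_imp_Cauchy)
    then obtain K where "\<And>m n. m \<ge> K \<Longrightarrow> n \<ge> K \<Longrightarrow> \<bar>a m - a n\<bar> < r"
      using r unfolding Cauchy_def dist_real_def by meson
    then show "\<exists>N. \<forall>m\<ge>N. \<forall>n\<ge>N. \<bar>Q (s n - s m)\<bar> < r"
      unfolding absdiff by blast
  qed
  moreover have "(\<lambda>n. Q (s n)) \<longlonglongrightarrow> Q \<Phi> - (\<integral>t. t \<partial>di.\<nu> \<Phi>)"
    unfolding Qs by (intro tendsto_intros lim)
  ultimately show ?thesis using LIMSEQ_unique by fastforce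
qed

end

text \<open>That the extension is the stated one is expressed by existence of a representation
  together with a claim about all representing pairs D', Q'. The values of Q' are compared on D'
  only, because Q' is a total function.\<close>

theorem theorem4p8:
  fixes M :: "'a measure"
    and H :: "'a \<Rightarrow> 'v::complex_vector hspace"
    and S :: "('a \<Rightarrow> 'v) set"
    and HH :: "('a \<Rightarrow> 'v) hspace"
    and D :: "('a \<Rightarrow> 'v) set"
    and Q :: "('a \<Rightarrow> 'v) \<Rightarrow> real"
    and T :: "'a \<Rightarrow> ('v \<times> 'v) set"
    and E :: "'a \<Rightarrow> real set \<Rightarrow> 'v \<Rightarrow> 'v"
    and EE :: "real set \<Rightarrow> ('a \<Rightarrow> 'v) \<Rightarrow> 'a \<Rightarrow> 'v"
    and TT :: "(('a \<Rightarrow> 'v) \<times> ('a \<Rightarrow> 'v)) set"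
  assumes sigma_finite: "sigma_finite_measure M"
    and field: "measurable_field M H S"
    and HH: "HH = direct_integral M H S"
    and form: "hermitian_quadratic_form HH D Q"
    and H1: "closable_form HH D Q" "orthogonally_additive M D Q"
    and H2: "point_supported M" "\<forall>\<alpha>\<in>space M. emeasure M {\<alpha>} > 0"
    and H3: "\<forall>\<alpha>\<in>space M.
      strongly_representable (H \<alpha>) (fibre_dom D \<alpha>) (fibre_form M Q \<alpha>) (T \<alpha>) (E \<alpha>)"
    and EE: "EE = direct_integral_pvm M E"
    and TT: "TT = spectral_integral HH EE (\<lambda>t. t)"
    and approx: "D \<subseteq> closure_in (field_norm_sq M H S E)
      {\<Phi> \<in> hcarrier HH. field_norm_sq M H S E \<Phi> < \<infinity>} (D_Fin M D E)"
  shows "strongly_representable HH D Q TT EE \<and>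
    (\<forall>D' Q'. strong_representation HH D Q TT EE D' Q' \<longrightarrow>
      D' = Domain (sqrt_abs_op HH EE) \<and>
      (\<forall>\<Phi>\<in>D'.
        complex_of_real (Q' \<Phi>) =
          hinner HH (op_app (sqrt_abs_op HH EE) \<Phi>) (sgn_op EE (op_app (sqrt_abs_op HH EE) \<Phi>)) \<and>
        Q' \<Phi> = (\<integral>t. t \<partial>spectral_measure HH EE \<Phi>)))"
proof -
  have sets_Pow: "sets M = Pow (space M)" and count: "countable (space M)"
    using H2(1) by (auto simp: point_supported_def)
  have atom_finite: "emeasure M {\<alpha>} < \<infinity>" if "\<alpha> \<in> space M" for \<alpha>
  proof -
    obtain A :: "nat \<Rightarrow> 'a set" where A: "range A \<subseteq> sets M" "(\<Union>i. A i) = space M"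
      "\<And>i. emeasure M (A i) \<noteq> \<infinity>"
      using sigma_finite_measure.sigma_finite[OF sigma_finite] by metis
    from that A(2) obtain i where "\<alpha> \<in> A i" by auto
    then have "emeasure M {\<alpha>} \<le> emeasure M (A i)" using A(1) by (intro emeasure_mono) auto
    also have "\<dots> < \<infinity>" using A(3)[of i] by (simp add: less_top)
    finally show ?thesis .
  qed
  have fib: "complete_inner_space (H \<alpha>)" if "\<alpha> \<in> space M" for \<alpha>
    by (rule hilbert_space.complete_inner_space[OF measurable_field.fibre_hilbert[OF field that]])
  have "\<exists>D' Q'. strong_representation (H \<alpha>) (fibre_dom D \<alpha>) (fibre_form M Q \<alpha>) (T \<alpha>) (E \<alpha>) D' Q'"
    if "\<alpha> \<in> space M" for \<alpha>
    using H3 that by (simp add: strongly_representable_def)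
  then obtain D' Q' where rep: "\<And>\<alpha>. \<alpha> \<in> space M \<Longrightarrow>
      strong_representation (H \<alpha>) (fibre_dom D \<alpha>) (fibre_form M Q \<alpha>) (T \<alpha>) (E \<alpha>) (D' \<alpha>) (Q' \<alpha>)"
    by metis
  \<comment> \<open>The fibre projection valued measures are contained in (H3), since a strong
    representation includes a resolution of the identity.\<close>
  interpret atomic_pvm M H S E
    unfolding atomic_pvm_def atomic_field_def atomic_field_axioms_def atomic_pvm_axioms_def
    using field count sets_Pow H2(2) atom_finite strong_representation_unique(1)[OF fib rep] by blast
  have HH': "HH = direct_integral M H S" "EE = direct_integral_pvm M E" by (fact HH, fact EE)
  have Dsub: "csubspace D" and Dform: "hermitian_quadratic_form (direct_integral M H S) D Q"
    using form HH by (auto simp: hermitian_quadratic_form_def)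
  \<comment> \<open>\<open>closure_in\<close> carries its ambient set, here the vectors of finite
    field norm; by \<open>field_norm_sq_di\<close> this set is the form domain of T.\<close>
  have Ddm: "D \<subseteq> di.dm di.sq"
  proof
    fix \<Phi> assume "\<Phi> \<in> D"
    then have "\<Phi> \<in> di.C" "field_norm_sq M H S E \<Phi> < \<infinity>"
      using approx HH by (auto simp: closure_in_def)
    then show "\<Phi> \<in> di.dm di.sq" by (simp add: di.dm_sq_iff field_norm_sq_di)
  qed
  have blockD: "block_proj \<Delta> \<Phi> \<in> D" if "\<Delta> \<subseteq> space M" "\<Phi> \<in> D" for \<Delta> \<Phi>
    using H1(2) that unfolding orthogonally_additive_def by (auto simp: sets_Pow)
  have dense: "\<exists>\<Psi>\<in>D. spectral_norm_sq (H \<alpha>) (E \<alpha>) (u - \<Psi> \<alpha>) < e"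
    if \<alpha>: "\<alpha> \<in> space M" and u: "u \<in> spectral_dom (H \<alpha>) (E \<alpha>) (\<lambda>t. sqrt \<bar>t\<bar>)" and e: "0 < e" for \<alpha> u e
  proof -
    have "u \<in> D' \<alpha>" using u strong_representation_unique(2)[OF fib[OF \<alpha>] rep[OF \<alpha>]] by simp
    moreover have "D' \<alpha> = closure_in (spectral_norm_sq (H \<alpha>) (E \<alpha>)) (Domain (sqrt_abs_op (H \<alpha>) (E \<alpha>))) (fibre_dom D \<alpha>)"
      using rep[OF \<alpha>] unfolding strong_representation_def by blast
    ultimately obtain v where "v \<in> fibre_dom D \<alpha>" "spectral_norm_sq (H \<alpha>) (E \<alpha>) (u - v) < e"
      using e by (auto simp: closure_in_def)
    then show ?thesis by (auto simp: fibre_dom_def)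
  qed
  have fibre_eq: "Q (block_proj {\<alpha>} \<Phi>) = (\<integral>t. t \<partial>spectral_measure (H \<alpha>) (E \<alpha>) (\<Phi> \<alpha>)) * measure M {\<alpha>}"
    if \<alpha>: "\<alpha> \<in> space M" and \<Phi>: "\<Phi> \<in> D" for \<alpha> \<Phi>
  proof -
    have u: "\<Phi> \<alpha> \<in> fibre_dom D \<alpha>" using \<Phi> by (auto simp: fibre_dom_def)
    have "fibre_dom D \<alpha> \<subseteq> D' \<alpha>" "\<forall>x\<in>fibre_dom D \<alpha>. Q' \<alpha> x = fibre_form M Q \<alpha> x"
      using rep[OF \<alpha>] unfolding strong_representation_def by blast+
    then have "fibre_form M Q \<alpha> (\<Phi> \<alpha>) = (\<integral>t. t \<partial>spectral_measure (H \<alpha>) (E \<alpha>) (\<Phi> \<alpha>))"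
      using u strong_representation_unique(3)[OF fib[OF \<alpha>] rep[OF \<alpha>], of "\<Phi> \<alpha>"] by auto
    moreover have "block_proj {\<alpha>} (\<lambda>_. \<Phi> \<alpha>) = block_proj {\<alpha>} \<Phi>"
      by (auto simp: block_proj_def fun_eq_iff)
    \<comment> \<open>Positivity of \<open>emeasure\<close> alone is not enough:
      \<open>measure\<close> would be 0 on an atom of infinite mass, and the division in
      \<open>fibre_form\<close> could not be undone.\<close>
    moreover have "measure M {\<alpha>} > 0"
      using H2(2) atom_finite[OF \<alpha>] \<alpha> by (simp add: measure_def enn2real_positive_iff)
    ultimately show ?thesis by (simp add: fibre_form_def field_simps)
  qed
  have Q: "Q \<Phi> = (\<integral>t. t \<partial>di.\<nu> \<Phi>)" if "\<Phi> \<in> D" for \<Phi>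
    using form_eq_integral[OF Dform _ H1(2) fibre_eq Ddm that] H1(1) HH by simp
  have closure: "di.dm di.sq = closure_in (spectral_norm_sq (direct_integral M H S) (direct_integral_pvm M E)) (di.dm di.sq) D"
  proof -
    have "\<exists>\<Psi>\<in>D. spectral_norm_sq (direct_integral M H S) (direct_integral_pvm M E) (\<Phi> - \<Psi>) < e"
      if "\<Phi> \<in> di.dm di.sq" "0 < e" for \<Phi> e
    proof (rule spectral_norm_sq_dense[OF Dsub _ _ dense that])
      show "D \<subseteq> di.C" using Ddm di.dm_subset by (rule order_trans)
      show "block_proj {\<alpha>} \<Psi> \<in> D" if "\<alpha> \<in> space M" "\<Psi> \<in> D" for \<alpha> \<Psi>
        using that by (intro blockD) auto
    qed
    then show ?thesis by (auto simp: closure_in_def)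
  qed
  \<comment> \<open>The representing pair consists of the form domain of T and the integral of t
    against the spectral measure.\<close>
  have "strong_representation HH D Q TT EE (di.dm di.sq) (\<lambda>\<Phi>. \<integral>t. t \<partial>di.\<nu> \<Phi>)"
    unfolding strong_representation_def resolution_of_identity_def TT HH'
    using di.self_adjoint_spectral_integral[of "\<lambda>t. t"] di.pvm di.hermitian_spectral_form Ddm Q
      di.Domain_spectral_integral[of "\<lambda>t. t"] di.dm_id_subset closure
    by (simp add: di.Domain_sqrt_abs_op)
  moreover have "D0 = Domain (sqrt_abs_op HH EE) \<and>
      (\<forall>\<Phi>\<in>D0.
        complex_of_real (Q0 \<Phi>) =
          hinner HH (op_app (sqrt_abs_op HH EE) \<Phi>) (sgn_op EE (op_app (sqrt_abs_op HH EE) \<Phi>)) \<and>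
        Q0 \<Phi> = (\<integral>t. t \<partial>spectral_measure HH EE \<Phi>))"
    if r: "strong_representation HH D Q TT EE D0 Q0" for D0 Q0
  proof -
    note u = strong_representation_unique[OF HH_complete_inner_space r[unfolded HH']]
    have "D0 = di.dm di.sq" by (rule u(2))
    then show ?thesis
      unfolding HH' by (simp add: u(3) di.Domain_sqrt_abs_op di.op_app_sqrt_abs_op di.sgn_form)
  qed
  ultimately show ?thesis
    unfolding strongly_representable_def by blast
qed

end
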